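(* Let $\varphi$ be a free holomorphic self-map of the noncommutative ball $[B(\mathcal H)^n]_1$ and let $C_\varphi$ be the composition operator on $H^2_{\bf ball}$. Then the following statements are equivalent: (i) $C_\varphi$ is similar to a contraction; (ii) $C_\varphi$ is polynomially bounded; (iii) $C_\varphi$ is power bounded; (iv) there is $\xi\in\mathbb B_n$ such that $\varphi(\xi)=\xi$.
   Context: $n\ge1$; $\mathcal H$ is a separable infinite dimensional complex Hilbert space. $\mathbb F_n^+$ is the free semigroup with generators $g_1,\ldots,g_n$ and identity $g_0$; $|g_0|=0$, $|\alpha|=k$ if $\alpha=g_{i_1}\cdots g_{i_k}$; $X_\alpha:=X_{i_1}\cdots X_{i_k}$, $X_{g_0}:=I$. $[B(\mathcal H)^n]_1:=\{(X_1,\ldots,X_n)\in B(\mathcal H)^n:\ \|X_1X_1^*+\cdots+X_nX_n^*\|^{1/2}<1\}$. A free holomorphic function $f:[B(\mathcal H)^n]_1\to B(\mathcal H)$ is a map $f(X)=\sum_{k=0}^\infty\sum_{|\alpha|=k}a_\alpha X_\alpha$ (series over $k$ converging in operator norm) with $a_\alpha\in\mathbb C$ and $\limsup_{k\to\infty}(\sum_{|\alpha|=k}|a_\alpha|^2)^{1/2k}\le1$. A free holomorphic self-map $\varphi=(\varphi_1,\ldots,\varphi_n)$ of $[B(\mathcal H)^n]_1$ has each $\varphi_i$ free holomorphic and maps $[B(\mathcal H)^n]_1$ into itself. With $\varphi_\alpha:=\varphi_{i_1}\cdots\varphi_{i_k}$, the composition is $(f\circ\varphi)(X)=\sum_{k=0}^\infty\sum_{|\alpha|=k}a_\alpha\varphi_\alpha(X)$.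 $H^2_{\bf ball}$ is the Hilbert space of free holomorphic functions $f=\sum_\alpha a_\alpha X_\alpha$ on $[B(\mathcal H)^n]_1$ with $\|f\|_2^2:=\sum_\alpha|a_\alpha|^2<\infty$; $C_\varphi f:=f\circ\varphi$ is a bounded operator on $H^2_{\bf ball}$. $\mathbb B_n$ is the open Euclidean unit ball of $\mathbb C^n$; $\lambda\in\mathbb B_n$ is identified with $(\lambda_1I,\ldots,\lambda_nI)$, so $\varphi$ induces a holomorphic self-map $\lambda\mapsto\varphi(\lambda)$ of $\mathbb B_n$. A bounded operator $T$ is power bounded if $\sup_{k\in\mathbb N}\|T^k\|<\infty$; it is polynomially bounded if there is $M>0$ with $\|p(T)\|\le M\sup_{|z|\le1}|p(z)|$ for every complex polynomial $p$ in one variable; it is similar to a contraction if there are a bounded invertible operator $V$ and an operator $A$ with $\|A\|\le1$ such that $T=V^{-1}AV$. *)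

theory Defs
  imports "HOL-Analysis.Analysis"
begin

section \<open>Complex Hilbert spaces and their bounded operators\<close>

class complex_vector = real_vector +
  fixes scaleC :: "complex \<Rightarrow> 'a \<Rightarrow> 'a" (infixr \<open>*\<^sub>C\<close> 75)
  assumes scaleC_add_right: "a *\<^sub>C (x + y) = a *\<^sub>C x + a *\<^sub>C y"
    and scaleC_add_left: "(a + b) *\<^sub>C x = a *\<^sub>C x + b *\<^sub>C x"
    and scaleC_scaleC: "a *\<^sub>C (b *\<^sub>C x) = (a * b) *\<^sub>C x"
    and scaleC_one: "1 *\<^sub>C x = x"
    and scaleR_scaleC: "r *\<^sub>R x = complex_of_real r *\<^sub>C x"

global_interpretation complex_vector:
  vector_space "scaleC :: complex \<Rightarrow> 'a \<Rightarrow> 'a::complex_vector"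
  defines cspan = "module.span (scaleC :: complex \<Rightarrow> 'a \<Rightarrow> 'a::complex_vector)"
  by unfold_locales
    (simp_all add: scaleC_add_right scaleC_add_left scaleC_scaleC scaleC_one)

class complex_normed_vector = complex_vector + real_normed_vector +
  assumes norm_scaleC: "norm (a *\<^sub>C x) = cmod a * norm x"

text \<open>
  The complex inner product is linear in its first argument.  Its real part is the inner product of
  the underlying real space, so that positivity, definiteness and
  \<open>norm x = sqrt (Re (cinner x x))\<close> are inherited from \<^class>\<open>real_inner\<close>.
\<close>

class complex_inner = complex_normed_vector + real_inner +
  fixes cinner :: "'a \<Rightarrow> 'a \<Rightarrow> complex"
  assumes cinner_commute: "cinner x y = cnj (cinner y x)"
    and cinner_add_left: "cinner (x + y) z = cinner x z + cinner y z"
    and cinner_scaleC_left: "cinner (a *\<^sub>C x) y = a * cinner x y"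
    and inner_eq_Re_cinner: "inner x y = Re (cinner x y)"

class chilbert_space = complex_inner + complete_space

instantiation blinfun :: (real_normed_vector, complex_normed_vector) complex_normed_vector
begin

lift_definition scaleC_blinfun :: "complex \<Rightarrow> 'a \<Rightarrow>\<^sub>L 'b \<Rightarrow> 'a \<Rightarrow>\<^sub>L 'b" is "\<lambda>c T x. c *\<^sub>C T x"
proof -
  fix c and T :: "'a \<Rightarrow> 'b"
  assume "bounded_linear T"
  then interpret T: bounded_linear T .
  obtain K where K: "\<And>x. norm (T x) \<le> norm x * K"
    using T.bounded by blast
  show "bounded_linear (\<lambda>x. c *\<^sub>C T x)"
  proof (rule bounded_linear_intro[where K = "cmod c * K"])
    show "norm (c *\<^sub>C T x) \<le> norm x * (cmod c * K)" for x
      using mult_left_mono[OF K[of x] norm_ge_zero[of c]]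
      by (simp add: norm_scaleC algebra_simps)
  qed (simp_all add: T.add T.scaleR scaleC_add_right scaleR_scaleC scaleC_scaleC mult.commute)
qed

instance
proof
  fix a b :: complex and r :: real and S T :: "'a \<Rightarrow>\<^sub>L 'b"
  show "a *\<^sub>C (S + T) = a *\<^sub>C S + a *\<^sub>C T"
    by transfer (simp add: scaleC_add_right)
  show "(a + b) *\<^sub>C S = a *\<^sub>C S + b *\<^sub>C S"
    by transfer (simp add: scaleC_add_left)
  show "a *\<^sub>C b *\<^sub>C S = (a * b) *\<^sub>C S"
    by transfer (simp add: scaleC_scaleC)
  show "1 *\<^sub>C S = S"
    by transfer (simp add: scaleC_one)
  show "r *\<^sub>R S = complex_of_real r *\<^sub>C S"
    by transfer (simp add: scaleR_scaleC)
  have le: "norm (c *\<^sub>C U) \<le> cmod c * norm U" for c and U :: "'a \<Rightarrow>\<^sub>L 'b"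
  proof (rule norm_blinfun_bound)
    show "norm (blinfun_apply (c *\<^sub>C U) x) \<le> cmod c * norm U * norm x" for x
      by (simp add: scaleC_blinfun.rep_eq norm_scaleC mult.assoc mult_left_mono norm_blinfun)
  qed simp
  show "norm (a *\<^sub>C S) = cmod a * norm S"
  proof (cases "a = 0")
    case True
    then show ?thesis using le[of 0 S] by simp
  next
    case False
    have "inverse a *\<^sub>C a *\<^sub>C S = S"
      using False by transfer (simp add: scaleC_scaleC scaleC_one)
    then have "norm S \<le> cmod (inverse a) * norm (a *\<^sub>C S)"
      by (metis le)
    then have "cmod a * norm S \<le> norm (a *\<^sub>C S)"
      using False mult_left_mono[of "norm S" _ "cmod a"]
      by (fastforce simp: norm_inverse simp flip: mult.assoc)
    with le[of a S] show ?thesis by simp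
  qed
qed

end

text \<open>
  The type \<^typ>\<open>'h \<Rightarrow>\<^sub>L 'h\<close> consists of the bounded real-linear maps; \<open>B(\<H>)\<close> is the set of
  those that are complex linear.
\<close>

definition bounded_ops :: "('h::chilbert_space \<Rightarrow>\<^sub>L 'h) set" where
  "bounded_ops = {T. \<forall>c x. blinfun_apply T (c *\<^sub>C x) = c *\<^sub>C blinfun_apply T x}"

definition adj :: "('h::chilbert_space \<Rightarrow>\<^sub>L 'h) \<Rightarrow> ('h \<Rightarrow>\<^sub>L 'h)" where
  "adj T = (THE S. \<forall>x y. cinner (blinfun_apply T x) y = cinner x (blinfun_apply S y))"

section \<open>Free holomorphic functions on the noncommutative ball\<close>

text \<open>
  The generators of the free semigroup are indexed by a finite type \<open>'n\<close>, hence \<open>n = CARD('n) \<ge> 1\<close>;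
  the elements of the free semigroup are the lists over \<open>'n\<close>, with length \<open>|\<alpha>|\<close>.
\<close>

definition words :: "nat \<Rightarrow> 'n::finite list set" where
  "words k = {\<alpha>. length \<alpha> = k}"

definition word_op :: "('h::chilbert_space \<Rightarrow>\<^sub>L 'h) ^ 'n \<Rightarrow> 'n list \<Rightarrow> ('h \<Rightarrow>\<^sub>L 'h)" where
  "word_op X \<alpha> = foldr (\<lambda>i T. (X $ i) o\<^sub>L T) \<alpha> id_blinfun"

definition nc_ball :: "(('h::chilbert_space \<Rightarrow>\<^sub>L 'h) ^ 'n::finite) set" where
  "nc_ball = {X. (\<forall>i. X $ i \<in> bounded_ops) \<and> sqrt (norm (\<Sum>i\<in>UNIV. (X $ i) o\<^sub>L adj (X $ i))) < 1}"

definition has_coeffs ::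
  "(('h::chilbert_space \<Rightarrow>\<^sub>L 'h) ^ 'n::finite \<Rightarrow> ('h \<Rightarrow>\<^sub>L 'h)) \<Rightarrow> ('n list \<Rightarrow> complex) \<Rightarrow> bool" where
  "has_coeffs f a \<longleftrightarrow>
     limsup (\<lambda>k. ereal (root (2 * k) (\<Sum>\<alpha>\<in>words k. (cmod (a \<alpha>))\<^sup>2))) \<le> 1 \<and>
     (\<forall>X\<in>nc_ball. (\<lambda>k. \<Sum>\<alpha>\<in>words k. a \<alpha> *\<^sub>C word_op X \<alpha>) sums f X)"

definition free_holomorphic ::
  "(('h::chilbert_space \<Rightarrow>\<^sub>L 'h) ^ 'n::finite \<Rightarrow> ('h \<Rightarrow>\<^sub>L 'h)) \<Rightarrow> bool" where
  "free_holomorphic f \<longleftrightarrow> (\<exists>a. has_coeffs f a)"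

text \<open>The coefficients of a free holomorphic function are unique because \<open>\<H>\<close> is infinite dimensional.\<close>

definition free_coeff ::
  "(('h::chilbert_space \<Rightarrow>\<^sub>L 'h) ^ 'n::finite \<Rightarrow> ('h \<Rightarrow>\<^sub>L 'h)) \<Rightarrow> 'n list \<Rightarrow> complex" where
  "free_coeff f = (THE a. has_coeffs f a)"

definition free_holomorphic_self_map ::
  "(('h::chilbert_space \<Rightarrow>\<^sub>L 'h) ^ 'n::finite \<Rightarrow> ('h \<Rightarrow>\<^sub>L 'h) ^ 'n) \<Rightarrow> bool" where
  "free_holomorphic_self_map \<phi> \<longleftrightarrow>
     (\<forall>i. free_holomorphic (\<lambda>X. \<phi> X $ i)) \<and> (\<forall>X\<in>nc_ball. \<phi> X \<in> nc_ball)"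

definition scalar_tuple :: "complex ^ 'n::finite \<Rightarrow> ('h::chilbert_space \<Rightarrow>\<^sub>L 'h) ^ 'n" where
  "scalar_tuple \<xi> = (\<chi> i. (\<xi> $ i) *\<^sub>C id_blinfun)"

section \<open>The Hardy space and its composition operators\<close>

text \<open>
  Functions on the noncommutative ball are represented by total functions vanishing outside of it,
  so that equality in \<open>H2_ball\<close> is equality on the noncommutative ball.
\<close>

definition H2_ball :: "(('h::chilbert_space \<Rightarrow>\<^sub>L 'h) ^ 'n::finite \<Rightarrow> ('h \<Rightarrow>\<^sub>L 'h)) set" where
  "H2_ball = {f. free_holomorphic f \<and> (\<forall>X. X \<notin> nc_ball \<longrightarrow> f X = 0) \<and>
     (\<lambda>\<alpha>. (cmod (free_coeff f \<alpha>))\<^sup>2) summable_on UNIV}"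

definition H2_norm :: "(('h::chilbert_space \<Rightarrow>\<^sub>L 'h) ^ 'n::finite \<Rightarrow> ('h \<Rightarrow>\<^sub>L 'h)) \<Rightarrow> real" where
  "H2_norm f = sqrt (\<Sum>\<^sub>\<infinity>\<alpha>\<in>UNIV. (cmod (free_coeff f \<alpha>))\<^sup>2)"

definition comp_op ::
  "(('h::chilbert_space \<Rightarrow>\<^sub>L 'h) ^ 'n::finite \<Rightarrow> ('h \<Rightarrow>\<^sub>L 'h) ^ 'n) \<Rightarrow>
   (('h \<Rightarrow>\<^sub>L 'h) ^ 'n \<Rightarrow> ('h \<Rightarrow>\<^sub>L 'h)) \<Rightarrow> (('h \<Rightarrow>\<^sub>L 'h) ^ 'n \<Rightarrow> ('h \<Rightarrow>\<^sub>L 'h))" where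
  "comp_op \<phi> f = (\<lambda>X. if X \<in> nc_ball
     then (\<Sum>k. \<Sum>\<alpha>\<in>words k. free_coeff f \<alpha> *\<^sub>C word_op (\<phi> X) \<alpha>) else 0)"

lemma comp_op_eq:
  assumes "has_coeffs f (free_coeff f)" "free_holomorphic_self_map \<phi>" "X \<in> nc_ball"
  shows "comp_op \<phi> f X = f (\<phi> X)"
proof -
  have "\<phi> X \<in> nc_ball"
    using assms(2,3) by (simp add: free_holomorphic_self_map_def)
  then have "(\<lambda>k. \<Sum>\<alpha>\<in>words k. free_coeff f \<alpha> *\<^sub>C word_op (\<phi> X) \<alpha>) sums f (\<phi> X)"
    using assms(1) unfolding has_coeffs_def by blast
  then show ?thesis
    using assms(3) by (simp add: comp_op_def sums_iff)
qed

section \<open>Operators on a normed space of functions\<close>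

text \<open>
  \<open>S\<close> is the set of vectors, a space of functions with the pointwise operations, and \<open>N\<close> its norm.
\<close>

definition bounded_op_on ::
  "('x \<Rightarrow> 'v::complex_normed_vector) set \<Rightarrow> (('x \<Rightarrow> 'v) \<Rightarrow> real) \<Rightarrow> (('x \<Rightarrow> 'v) \<Rightarrow> ('x \<Rightarrow> 'v)) \<Rightarrow> bool"
  where
  "bounded_op_on S N T \<longleftrightarrow>
     (\<forall>f\<in>S. T f \<in> S) \<and>
     (\<forall>f\<in>S. \<forall>g\<in>S. T (\<lambda>x. f x + g x) = (\<lambda>x. T f x + T g x)) \<and>
     (\<forall>c. \<forall>f\<in>S. T (\<lambda>x. c *\<^sub>C f x) = (\<lambda>x. c *\<^sub>C T f x)) \<and>
     (\<exists>M. \<forall>f\<in>S. N (T f) \<le> M * N f)"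

text \<open>The supremum is meaningful only for bounded operators; all uses below are restricted to these.\<close>

definition op_norm_on ::
  "('x \<Rightarrow> 'v::complex_normed_vector) set \<Rightarrow> (('x \<Rightarrow> 'v) \<Rightarrow> real) \<Rightarrow> (('x \<Rightarrow> 'v) \<Rightarrow> ('x \<Rightarrow> 'v)) \<Rightarrow> real"
  where
  "op_norm_on S N T = (SUP f\<in>{f\<in>S. N f \<le> 1}. N (T f))"

definition poly_op ::
  "complex poly \<Rightarrow> (('x \<Rightarrow> 'v::complex_normed_vector) \<Rightarrow> ('x \<Rightarrow> 'v)) \<Rightarrow> ('x \<Rightarrow> 'v) \<Rightarrow> ('x \<Rightarrow> 'v)" where
  "poly_op p T f = (\<lambda>x. \<Sum>k\<le>degree p. coeff p k *\<^sub>C (T ^^ k) f x)"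

definition power_bounded_on ::
  "('x \<Rightarrow> 'v::complex_normed_vector) set \<Rightarrow> (('x \<Rightarrow> 'v) \<Rightarrow> real) \<Rightarrow> (('x \<Rightarrow> 'v) \<Rightarrow> ('x \<Rightarrow> 'v)) \<Rightarrow> bool"
  where
  "power_bounded_on S N T \<longleftrightarrow>
     bounded_op_on S N T \<and> bdd_above (range (\<lambda>k. op_norm_on S N (T ^^ k)))"

definition polynomially_bounded_on ::
  "('x \<Rightarrow> 'v::complex_normed_vector) set \<Rightarrow> (('x \<Rightarrow> 'v) \<Rightarrow> real) \<Rightarrow> (('x \<Rightarrow> 'v) \<Rightarrow> ('x \<Rightarrow> 'v)) \<Rightarrow> bool"
  where
  "polynomially_bounded_on S N T \<longleftrightarrow>
     bounded_op_on S N T \<and>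
     (\<exists>M>0. \<forall>p. op_norm_on S N (poly_op p T) \<le> M * (SUP z\<in>{z. cmod z \<le> 1}. cmod (poly p z)))"

definition similar_to_contraction_on ::
  "('x \<Rightarrow> 'v::complex_normed_vector) set \<Rightarrow> (('x \<Rightarrow> 'v) \<Rightarrow> real) \<Rightarrow> (('x \<Rightarrow> 'v) \<Rightarrow> ('x \<Rightarrow> 'v)) \<Rightarrow> bool"
  where
  "similar_to_contraction_on S N T \<longleftrightarrow>
     bounded_op_on S N T \<and>
     (\<exists>V W A. bounded_op_on S N V \<and> bounded_op_on S N W \<and>
        (\<forall>f\<in>S. W (V f) = f) \<and> (\<forall>f\<in>S. V (W f) = f) \<and>
        bounded_op_on S N A \<and> op_norm_on S N A \<le> 1 \<and>
        (\<forall>f\<in>S. T f = W (A (V f))))"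

end

theory Submission
  imports Defs
begin

text \<open>
  Only (i) \<open>\<Rightarrow>\<close> (ii) \<open>\<Rightarrow>\<close> (iii) \<open>\<Rightarrow>\<close> (iv) \<open>\<Rightarrow>\<close> (i) is needed.  An orthonormal family in \<open>\<H>\<close> indexed by
  the words carries the left creation operators \<open>L\<^sub>i\<close>; evaluating at the tuple \<open>(r L\<^sub>1, \<dots>, r L\<^sub>n)\<close>,
  \<open>r < 1\<close>, and applying the result to the vacuum vector recovers the coefficients of a free holomorphic
  function, so that no Fock space has to be constructed.

  (i) implies (ii) by von Neumann's inequality, and (iii) is the case of monomials in (ii).  If \<open>C\<^sub>\<phi>\<close> is
  power bounded, testing \<open>C\<^sub>\<phi>\<^sup>k\<close> on the reproducing kernel at the point \<open>\<phi>\<^sup>k(0)\<close> shows that the orbit of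
  \<open>0\<close> stays away from the sphere; with the Schwarz--Pick inequality, Brouwer's theorem then yields a fixed
  point.  If \<open>\<phi>(\<xi>) = \<xi>\<close>, conjugation with the involutive automorphism exchanging \<open>0\<close> and \<open>\<xi>\<close> reduces to a
  map fixing \<open>0\<close>, whose composition operator is a contraction by Littlewood's subordination principle.
  Both that principle and the boundedness of the composition operator of the automorphism come from one
  estimate: if \<open>v\<close> is orthogonal to the ranges of the components of a row contraction \<open>Z\<close>, then
  \<open>\<parallel>f(Z) v\<parallel> \<le> \<parallel>f\<parallel>\<^sub>2 \<parallel>v\<parallel>\<close>.
\<close>

section \<open>Inner product spaces over the complex numbers\<close>

text \<open>Boundedness of the operator is part of each of the three operator conditions, so under
  (iv) it has to be proved; it is read off from a factorisation \<open>V A V\<close> with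
  \<open>A\<close> a contraction and \<open>V\<close> composition with the involution. The
  difficulty thus sits in \<open>V\<close>. For a centre other than 0 the vacuum is not wandering
  for the automorphism evaluated at the dilated shifts, but a kernel vector is. What is then bounded
  is a convolution of the desired coefficients with those of a resolvent, and removing the resolvent
  costs a constant that does not depend on the dilation radius. Convergence everywhere rests on
  strictness: a point of the ball has a row bound \<rho> < 1, and so has its image under \<phi>,
  which controls the composed series at the shifts. Power boundedness with constant M gives
  \<open>1 \<le> M\<^sup>2 * (1 - |\<phi>\<^sup>k(0)|\<^sup>2)\<close>. This M squared becomes the
  size of the pseudohyperbolic balls in the fixed point argument: all of them contain 0, and their
  intersections keep a common distance from the sphere. \<open>H2_ball\<close> is a set of functions
  with a norm, not a type of a normed class; Hilbert space inequalities reach it through an isometry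
  into \<open>'h\<close>.\<close>

lemma scaleC_zero_right [simp]: "c *\<^sub>C (0::'a::complex_vector) = 0"
  by (metis add_cancel_left_left scaleC_add_right)

lemma scaleC_zero_left [simp]: "0 *\<^sub>C (x::'a::complex_vector) = 0"
  by (metis add_cancel_left_left scaleC_add_left)

lemma scaleC_minus_left [simp]: "(- c) *\<^sub>C (x::'a::complex_vector) = - (c *\<^sub>C x)"
  by (metis add.right_inverse eq_neg_iff_add_eq_0 add.commute scaleC_add_left scaleC_zero_left)

lemma scaleC_minus_right [simp]: "c *\<^sub>C (- x::'a::complex_vector) = - (c *\<^sub>C x)"
  by (metis add.right_inverse eq_neg_iff_add_eq_0 add.commute scaleC_add_right scaleC_zero_right)

lemma scaleC_diff_left: "(a - b) *\<^sub>C (x::'a::complex_vector) = a *\<^sub>C x - b *\<^sub>C x"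
  by (metis diff_conv_add_uminus scaleC_add_left scaleC_minus_left)

lemma scaleC_diff_right: "c *\<^sub>C (x - y::'a::complex_vector) = c *\<^sub>C x - c *\<^sub>C y"
  by (metis diff_conv_add_uminus scaleC_add_right scaleC_minus_right)

lemma scaleC_sum_right: "c *\<^sub>C (\<Sum>i\<in>A. f i :: 'a::complex_vector) = (\<Sum>i\<in>A. c *\<^sub>C f i)"
  by (induction A rule: infinite_finite_induct) (auto simp: scaleC_add_right)

lemma scaleC_sum_left: "(\<Sum>i\<in>A. f i) *\<^sub>C (x :: 'a::complex_vector) = (\<Sum>i\<in>A. f i *\<^sub>C x)"
  by (induction A rule: infinite_finite_induct) (auto simp: scaleC_add_left)

lemma bounded_linear_scaleC_right: "bounded_linear (\<lambda>x::'a::complex_normed_vector. c *\<^sub>C x)"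
  by (rule bounded_linear_intro[where K = "cmod c"])
    (auto simp: scaleC_add_right norm_scaleC scaleR_scaleC scaleC_scaleC mult.commute)

lemma bounded_linear_scaleC_left: "bounded_linear (\<lambda>c. c *\<^sub>C (x::'a::complex_normed_vector))"
  by (rule bounded_linear_intro[where K = "norm x"])
    (auto simp: scaleC_add_left norm_scaleC scaleR_scaleC scaleC_scaleC scaleR_conv_of_real)

lemma cinner_add_right: "cinner x (y + z :: 'a::complex_inner) = cinner x y + cinner x z"
  by (metis cinner_add_left cinner_commute complex_cnj_add)

lemma cinner_scaleC_right: "cinner x (a *\<^sub>C y :: 'a::complex_inner) = cnj a * cinner x y"
  by (metis cinner_scaleC_left cinner_commute complex_cnj_mult)

lemma cinner_zero_left [simp]: "cinner (0::'a::complex_inner) x = 0"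
  by (metis add_cancel_left_left cinner_add_left)

lemma cinner_zero_right [simp]: "cinner x (0::'a::complex_inner) = 0"
  by (metis add_cancel_left_left cinner_add_right)

lemma cinner_minus_left [simp]: "cinner (- x::'a::complex_inner) y = - cinner x y"
  by (metis add.right_inverse eq_neg_iff_add_eq_0 add.commute cinner_add_left cinner_zero_left)

lemma cinner_minus_right [simp]: "cinner x (- y::'a::complex_inner) = - cinner x y"
  by (metis add.right_inverse eq_neg_iff_add_eq_0 add.commute cinner_add_right cinner_zero_right)

lemma cinner_diff_left: "cinner (x - y :: 'a::complex_inner) z = cinner x z - cinner y z"
  by (metis diff_conv_add_uminus cinner_add_left cinner_minus_left)

lemma cinner_diff_right: "cinner z (x - y :: 'a::complex_inner) = cinner z x - cinner z y"
  by (metis diff_conv_add_uminus cinner_add_right cinner_minus_right)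

lemma cinner_sum_left: "cinner (\<Sum>i\<in>A. f i :: 'a::complex_inner) y = (\<Sum>i\<in>A. cinner (f i) y)"
  by (induction A rule: infinite_finite_induct) (auto simp: cinner_add_left)

lemma cinner_sum_right: "cinner y (\<Sum>i\<in>A. f i :: 'a::complex_inner) = (\<Sum>i\<in>A. cinner y (f i))"
  by (induction A rule: infinite_finite_induct) (auto simp: cinner_add_right)

lemma cinner_scaleR_left: "cinner (r *\<^sub>R x :: 'a::complex_inner) y = of_real r * cinner x y"
  by (simp add: scaleR_scaleC cinner_scaleC_left)

lemma cinner_scaleR_right: "cinner x (r *\<^sub>R y :: 'a::complex_inner) = of_real r * cinner x y"
  by (simp add: scaleR_scaleC cinner_scaleC_right)

lemmas cinner_simps = cinner_add_left cinner_add_right cinner_diff_left cinner_diff_right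
  cinner_scaleC_left cinner_scaleC_right cinner_scaleR_left cinner_scaleR_right

lemma cinner_self: "cinner (x::'a::complex_inner) x = complex_of_real ((norm x)\<^sup>2)"
proof (rule complex_eqI)
  show "Re (cinner x x) = Re (complex_of_real ((norm x)\<^sup>2))"
    by (metis Re_complex_of_real inner_eq_Re_cinner power2_norm_eq_inner)
  have "Im (cinner x x) = - Im (cinner x x)"
    by (metis cinner_commute cnj.simps(2))
  then show "Im (cinner x x) = Im (complex_of_real ((norm x)\<^sup>2))" by simp
qed

lemma norm_sq_cinner: "(norm (x::'a::complex_inner))\<^sup>2 = Re (cinner x x)"
  by (simp add: cinner_self)

lemma Im_cinner: "Im (cinner (x::'a::complex_inner) y) = - inner (\<i> *\<^sub>C x) y"
  by (simp add: inner_eq_Re_cinner cinner_scaleC_left)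

lemma cinner_eq_inner: "cinner (x::'a::complex_inner) y = Complex (inner x y) (- inner (\<i> *\<^sub>C x) y)"
  by (simp add: complex_eq_iff Im_cinner inner_eq_Re_cinner)

lemma norm_cinner_le: "cmod (cinner (x::'a::complex_inner) y) \<le> norm x * norm y"
proof (cases "cinner x y = 0")
  case False
  define c where "c = cnj (sgn (cinner x y))"
  have c: "cmod c = 1" using False by (simp add: c_def norm_sgn)
  have "c * cinner x y = cnj (cinner x y) * cinner x y / of_real (cmod (cinner x y))"
    by (simp add: c_def sgn_eq)
  also have "\<dots> = of_real (cmod (cinner x y))"
    using False by (subst mult.commute, subst complex_norm_square[symmetric])
      (simp add: power2_eq_square)
  finally have "c * cinner x y = of_real (cmod (cinner x y))" .
  then have "cmod (cinner x y) = inner (c *\<^sub>C x) y"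
    by (simp add: inner_eq_Re_cinner cinner_scaleC_left)
  also have "\<dots> \<le> norm (c *\<^sub>C x) * norm y" by (rule norm_cauchy_schwarz)
  finally show ?thesis by (simp add: norm_scaleC c)
qed simp

lemma bounded_linear_cinner_left: "bounded_linear (\<lambda>x::'a::complex_inner. cinner x y)"
  by (rule bounded_linear_intro[where K = "norm y"])
    (auto simp: cinner_simps scaleR_conv_of_real norm_cinner_le)

lemma bounded_linear_cinner_right: "bounded_linear (\<lambda>y::'a::complex_inner. cinner x y)"
  by (rule bounded_linear_intro[where K = "norm x"])
    (auto simp: cinner_simps scaleR_conv_of_real, metis mult.commute norm_cinner_le)

lemma cinner_left_eqI:
  assumes "\<And>y. cinner x y = cinner x' (y::'a::complex_inner)"
  shows "x = x'"
proof -
  have "cinner (x - x') (x - x') = 0"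
    using assms by (simp add: cinner_diff_left)
  then show ?thesis by (simp add: cinner_self)
qed

lemma cinner_right_eqI:
  assumes "\<And>x. cinner x y = cinner x (y'::'a::complex_inner)"
  shows "y = y'"
  by (rule cinner_left_eqI) (metis assms cinner_commute)

section \<open>Adjoints and the noncommutative ball\<close>

text \<open>The representing vector is the minimiser of \<open>\<parallel>x\<parallel>\<^sup>2 - 2 f x\<close>; minimising sequences are
  Cauchy by the parallelogram law.\<close>

lemma riesz_representation:
  fixes f :: "'a::{real_inner, complete_space} \<Rightarrow> real"
  assumes "bounded_linear f"
  obtains z where "\<And>y. f y = inner z y"
proof -
  interpret bounded_linear f by fact
  define J where "J x = (norm x)\<^sup>2 - 2 * f x" for x
  define m where "m = Inf (range J)"
  have bdd: "bdd_below (range J)"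
  proof -
    obtain K where K: "\<And>x. norm (f x) \<le> norm x * K" using bounded by blast
    show ?thesis
    proof (rule bdd_belowI2)
      fix x
      have "2 * f x \<le> 2 * (norm x * K)" using K[of x] by simp
      moreover have "0 \<le> (norm x - K)\<^sup>2" by simp
      ultimately show "- K\<^sup>2 \<le> J x" by (simp add: J_def power2_diff)
    qed
  qed
  have m: "m \<le> J x" for x by (auto simp: m_def intro: cInf_lower bdd)
  have "\<exists>x. J x < m + inverse (Suc k)" for k
  proof -
    have "0 < inverse (real (Suc k))"
      by (simp only: inverse_positive_iff_positive of_nat_0_less_iff)
    then have "Inf (range J) < m + inverse (Suc k)"
      unfolding m_def by linarith
    then show ?thesis using cInf_lessD[of "range J"] by blast
  qed
  then obtain x where x: "\<And>k. J (x k) < m + inverse (Suc k)" by metis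
  have par: "(norm (u - v))\<^sup>2 \<le> 2 * (J u - m) + 2 * (J v - m)" for u v
  proof -
    have "4 * J ((1/2) *\<^sub>R (u + v)) = (norm (u + v))\<^sup>2 - 4 * (f u + f v)"
    proof -
      have "f ((1/2) *\<^sub>R (u + v)) = (f u + f v) / 2" by (simp only: scaleR add) simp
      moreover have "(norm ((1/2) *\<^sub>R (u + v)))\<^sup>2 = (norm (u + v))\<^sup>2 / 4"
        by (simp only: norm_scaleR power_mult_distrib) (simp add: power2_eq_square)
      ultimately show ?thesis by (simp add: J_def)
    qed
    moreover have "(norm (u - v))\<^sup>2 + (norm (u + v))\<^sup>2 = 2 * (norm u)\<^sup>2 + 2 * (norm v)\<^sup>2"
      by (simp add: power2_norm_eq_inner algebra_simps inner_commute)
    ultimately show ?thesis using m[of "(1/2) *\<^sub>R (u + v)"] by (simp add: J_def)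
  qed
  have "Cauchy x"
  proof (rule metric_CauchyI)
    fix \<epsilon> :: real assume "\<epsilon> > 0"
    then obtain N where N: "inverse (real (Suc N)) < \<epsilon>\<^sup>2 / 4"
      using reals_Archimedean[of "\<epsilon>\<^sup>2 / 4"] by auto
    have "dist (x j) (x k) < \<epsilon>" if "j \<ge> N" "k \<ge> N" for j k
    proof -
      have "J (x i) - m < \<epsilon>\<^sup>2 / 4" if "i \<ge> N" for i
      proof -
        have "inverse (real (Suc i)) \<le> inverse (real (Suc N))" using that by (simp add: field_simps)
        then show ?thesis using x[of i] N by linarith
      qed
      from this[OF that(1)] this[OF that(2)]
      have "2 * (J (x j) - m) + 2 * (J (x k) - m) < \<epsilon>\<^sup>2" by simp
      with par[of "x j" "x k"] have "(norm (x j - x k))\<^sup>2 < \<epsilon>\<^sup>2" by (rule order_le_less_trans)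
      then show ?thesis using \<open>\<epsilon> > 0\<close> by (simp add: dist_norm power2_less_imp_less)
    qed
    then show "\<exists>M. \<forall>j\<ge>M. \<forall>k\<ge>M. dist (x j) (x k) < \<epsilon>" by blast
  qed
  then obtain z where z: "x \<longlonglongrightarrow> z" using Cauchy_convergent convergent_def by blast
  have "(\<lambda>k. J (x k)) \<longlonglongrightarrow> J z"
    unfolding J_def by (intro tendsto_intros tendsto z)
  moreover have "(\<lambda>k. m + inverse (real (Suc k))) \<longlonglongrightarrow> m + 0"
    by (intro tendsto_intros LIMSEQ_inverse_real_of_nat)
  ultimately have Jz: "J z \<le> m" using x
    by (intro LIMSEQ_le[of "\<lambda>k. J (x k)" "J z"]) (auto intro: less_imp_le)
  have "f y = inner z y" for y
  proof -
    define d where "d = inner z y - f y"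
    have pos: "0 \<le> 2 * t * d + t\<^sup>2 * (norm y)\<^sup>2" for t
    proof -
      have "(norm (z + t *\<^sub>R y))\<^sup>2 = (norm z)\<^sup>2 + 2 * t * inner z y + t\<^sup>2 * (norm y)\<^sup>2"
        unfolding power2_norm_eq_inner by (simp add: inner_simps inner_commute power2_eq_square)
      then have "J (z + t *\<^sub>R y) = J z + 2 * t * d + t\<^sup>2 * (norm y)\<^sup>2"
        by (simp add: J_def d_def add scaleR algebra_simps)
      then show ?thesis using m[of "z + t *\<^sub>R y"] Jz by linarith
    qed
    have "d = 0"
    proof (rule ccontr)
      assume "d \<noteq> 0"
      \<comment> \<open>Minimality is tested at \<open>t = - d / n\<close>. The summand 1 keeps
        \<open>n\<close> positive for \<open>y = 0\<close>, and
        \<open>n \<ge> (norm y)\<^sup>2\<close> lets the linear term win.\<close>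
      define n where "n = (norm y)\<^sup>2 + 1"
      have "n > 0" by (simp add: n_def add_nonneg_pos)
      have "0 \<le> 2 * (- d / n) * d + (- d / n)\<^sup>2 * (norm y)\<^sup>2" by (rule pos)
      also have "\<dots> \<le> 2 * (- d / n) * d + (- d / n)\<^sup>2 * n"
        by (intro add_left_mono mult_left_mono) (auto simp: n_def)
      also have "\<dots> = - d\<^sup>2 / n" using \<open>n > 0\<close> by (simp add: field_simps power2_eq_square)
      also have "\<dots> < 0" using \<open>n > 0\<close> \<open>d \<noteq> 0\<close> by simp
      finally show False by simp
    qed
    then show ?thesis by (simp add: d_def)
  qed
  then show thesis by (rule that)
qed

lemma real_adjoint_exists:
  fixes T :: "'a::{real_inner, complete_space} \<Rightarrow>\<^sub>L 'a"
  obtains S :: "'a \<Rightarrow>\<^sub>L 'a" where "\<And>x y. inner (T x) y = inner x (S y)"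
proof -
  have "\<exists>z. \<forall>x. inner (T x) y = inner z x" for y
  proof -
    have "bounded_linear (\<lambda>x. inner (T x) y)"
      by (intro bounded_linear_intros)
    then show ?thesis using riesz_representation by metis
  qed
  then obtain S where S: "\<And>x y. inner (T x) y = inner x (S y)"
    by (metis inner_commute)
  have eqI: "u = v" if "\<And>x. inner x u = inner x v" for u v :: 'a
  proof -
    have "inner (u - v) (u - v) = 0" using that[of "u - v"] by (simp only: inner_diff_right)
    then show ?thesis by simp
  qed
  have "bounded_linear S"
  proof (rule bounded_linear_intro[where K = "norm T"])
    show "S (x + y) = S x + S y" for x y
      by (rule eqI) (simp add: inner_simps flip: S)
    show "S (r *\<^sub>R x) = r *\<^sub>R S x" for r x
      by (rule eqI) (simp add: inner_simps flip: S)
    show "norm (S x) \<le> norm x * norm T" for x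
    proof (cases "S x = 0")
      case False
      have "(norm (S x))\<^sup>2 = inner (T (S x)) x" by (simp add: S power2_norm_eq_inner)
      also have "\<dots> \<le> norm (T (S x)) * norm x" by (rule norm_cauchy_schwarz)
      also have "\<dots> \<le> norm T * norm (S x) * norm x" by (intro mult_right_mono norm_blinfun) auto
      finally show ?thesis using False by (simp add: power2_eq_square mult.commute)
    qed simp
  qed
  then show thesis
    using that[of "Blinfun S"] S by (simp add: bounded_linear_Blinfun_apply)
qed

lemma bounded_opsD: "T \<in> bounded_ops \<Longrightarrow> T (c *\<^sub>C x) = c *\<^sub>C T x"
  by (simp add: bounded_ops_def)

text \<open>Real Riesz representation suffices: \<open>cinner x y\<close> is determined by the real
  inner products of \<open>x\<close> and \<open>\<i> *\<^sub>C x\<close> with \<open>y\<close>, and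
  \<open>T\<close> commutes with multiplication by \<open>\<i>\<close>. Uniqueness makes the
  definite description in \<open>adj\<close> denote the real adjoint.\<close>

lemma cinner_adj:
  assumes "T \<in> bounded_ops"
  shows "cinner (T x) y = cinner x (adj T y)"
proof -
  obtain S :: "'a \<Rightarrow>\<^sub>L 'a" where S: "\<And>x y. inner (T x) y = inner x (S y)"
    using real_adjoint_exists[of T] by blast
  have cS: "cinner (T x) y = cinner x (S y)" for x y
    by (simp add: cinner_eq_inner S flip: bounded_opsD[OF assms])
  have "adj T = S" unfolding adj_def
  proof (rule the_equality)
    fix S' assume "\<forall>x y. cinner (T x) y = cinner x (blinfun_apply S' y)"
    then show "S' = S"
      by (intro blinfun_eqI cinner_right_eqI) (metis cS)
  qed (use cS in blast)
  with cS show ?thesis by simp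
qed

text \<open>Says that the row operator from the direct sum of n copies of \<open>'h\<close> has norm
  at most |\<rho>|, tested on vectors so that the direct sum is never formed. A tuple in
  \<open>bounded_ops\<close> belongs to \<open>nc_ball\<close> iff this holds for some 0 \<le>
  \<rho> < 1.\<close>

definition row_bound :: "('h::chilbert_space \<Rightarrow>\<^sub>L 'h) ^ 'n::finite \<Rightarrow> real \<Rightarrow> bool" where
  "row_bound X \<rho> \<longleftrightarrow> (\<forall>y. (norm (\<Sum>i\<in>UNIV. (X $ i) (y i)))\<^sup>2 \<le> \<rho>\<^sup>2 * (\<Sum>i\<in>UNIV. (norm (y i))\<^sup>2))"

lemma row_boundD:
  "row_bound X \<rho> \<Longrightarrow> (norm (\<Sum>i\<in>UNIV. (X $ i) (y i)))\<^sup>2 \<le> \<rho>\<^sup>2 * (\<Sum>i\<in>UNIV. (norm (y i))\<^sup>2)"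
  by (simp add: row_bound_def)

lemma sum_cinner_le:
  fixes x y :: "'i \<Rightarrow> 'h::complex_inner"
  shows "(cmod (\<Sum>i\<in>A. cinner (x i) (y i)))\<^sup>2 \<le> (\<Sum>i\<in>A. (norm (x i))\<^sup>2) * (\<Sum>i\<in>A. (norm (y i))\<^sup>2)"
proof -
  have "cmod (\<Sum>i\<in>A. cinner (x i) (y i)) \<le> (\<Sum>i\<in>A. norm (x i) * norm (y i))"
    by (intro sum_norm_le norm_cinner_le)
  then have "(cmod (\<Sum>i\<in>A. cinner (x i) (y i)))\<^sup>2 \<le> (\<Sum>i\<in>A. norm (x i) * norm (y i))\<^sup>2"
    by (rule power_mono) simp
  also have "\<dots> \<le> (\<Sum>i\<in>A. (norm (x i))\<^sup>2) * (\<Sum>i\<in>A. (norm (y i))\<^sup>2)"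
    by (rule Cauchy_Schwarz_ineq_sum)
  finally show ?thesis .
qed

text \<open>A row and its adjoint column have the same norm. Pairing the image \<open>z\<close> with
  itself and applying Cauchy--Schwarz leaves a surplus factor \<open>(norm z)\<^sup>2\<close>, which
  cancels unless it is 0. \<open>row_bound_adj\<close> is the converse by the same device.\<close>

lemma row_bound_dual:
  assumes X: "\<And>i. X $ i \<in> bounded_ops"
    and dual: "\<And>h. (\<Sum>i\<in>UNIV. (norm (adj (X $ i) h))\<^sup>2) \<le> \<rho>\<^sup>2 * (norm h)\<^sup>2"
  shows "row_bound X \<rho>"
  unfolding row_bound_def
proof
  fix y
  define z where "z = (\<Sum>i\<in>UNIV. (X $ i) (y i))"
  have "cinner z z = (\<Sum>i\<in>UNIV. cinner (y i) (adj (X $ i) z))"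
    by (subst (1) z_def) (simp add: cinner_sum_left cinner_adj[OF X])
  then have "((norm z)\<^sup>2)\<^sup>2 = (cmod (\<Sum>i\<in>UNIV. cinner (y i) (adj (X $ i) z)))\<^sup>2"
    by (metis cinner_self norm_of_real abs_power2 power2_abs)
  also have "\<dots> \<le> (\<Sum>i\<in>UNIV. (norm (y i))\<^sup>2) * (\<Sum>i\<in>UNIV. (norm (adj (X $ i) z))\<^sup>2)"
    by (rule sum_cinner_le)
  also have "\<dots> \<le> (\<Sum>i\<in>UNIV. (norm (y i))\<^sup>2) * (\<rho>\<^sup>2 * (norm z)\<^sup>2)"
    by (intro mult_left_mono dual sum_nonneg) auto
  finally have *: "(norm z)\<^sup>2 * (norm z)\<^sup>2 \<le> (\<rho>\<^sup>2 * (\<Sum>i\<in>UNIV. (norm (y i))\<^sup>2)) * (norm z)\<^sup>2"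
    by (simp add: power2_eq_square mult_ac)
  have "(norm z)\<^sup>2 \<le> \<rho>\<^sup>2 * (\<Sum>i\<in>UNIV. (norm (y i))\<^sup>2)"
  proof (cases "z = 0")
    case False
    then show ?thesis using * by (intro mult_right_le_imp_le[OF *]) simp
  qed (simp add: sum_nonneg)
  then show "(norm (\<Sum>i\<in>UNIV. (X $ i) (y i)))\<^sup>2 \<le> \<rho>\<^sup>2 * (\<Sum>i\<in>UNIV. (norm (y i))\<^sup>2)"
    by (simp add: z_def)
qed

lemma cinner_row_square:
  assumes X: "\<And>i. X $ i \<in> bounded_ops"
  shows "cinner (blinfun_apply (\<Sum>i\<in>UNIV. (X $ i) o\<^sub>L adj (X $ i)) h) h
    = of_real (\<Sum>i\<in>UNIV. (norm (adj (X $ i) h))\<^sup>2)"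
  by (simp add: blinfun.sum_left cinner_sum_left cinner_adj[OF X] cinner_self)

lemma row_bound_adj:
  assumes X: "\<And>i. X $ i \<in> bounded_ops" and "row_bound X \<rho>"
  shows "(\<Sum>i\<in>UNIV. (norm (adj (X $ i) h))\<^sup>2) \<le> \<rho>\<^sup>2 * (norm h)\<^sup>2"
proof -
  define S where "S = (\<Sum>i\<in>UNIV. (norm (adj (X $ i) h))\<^sup>2)"
  have S0: "S \<ge> 0" by (simp add: S_def sum_nonneg)
  define z where "z = (\<Sum>i\<in>UNIV. (X $ i) (adj (X $ i) h))"
  have "cinner z h = of_real S"
    using cinner_row_square[OF X, of h] by (simp add: z_def S_def blinfun.sum_left)
  then have "S \<le> norm z * norm h" using norm_cinner_le[of z h] S0 by simp
  then have "S\<^sup>2 \<le> (norm z)\<^sup>2 * (norm h)\<^sup>2" using S0 by (metis power_mono power_mult_distrib)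
  also have "\<dots> \<le> (\<rho>\<^sup>2 * S) * (norm h)\<^sup>2"
    using row_boundD[OF assms(2), of "\<lambda>i. adj (X $ i) h"]
    by (intro mult_right_mono) (auto simp: z_def S_def)
  finally have *: "S * S \<le> (\<rho>\<^sup>2 * (norm h)\<^sup>2) * S" by (simp add: power2_eq_square mult_ac)
  have "S \<le> \<rho>\<^sup>2 * (norm h)\<^sup>2"
    using S0 mult_right_le_imp_le[OF *] by (cases "S = 0") auto
  then show ?thesis by (simp add: S_def)
qed

lemma nc_ball_ops: "X \<in> nc_ball \<Longrightarrow> X $ i \<in> bounded_ops"
  by (simp add: nc_ball_def)

lemma nc_ball_row_bound:
  assumes "X \<in> nc_ball"
  obtains \<rho> where "0 \<le> \<rho>" "\<rho> < 1" "row_bound X \<rho>"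
proof -
  have X: "\<And>i. X $ i \<in> bounded_ops" using assms by (simp add: nc_ball_def)
  define T where "T = (\<Sum>i\<in>UNIV. (X $ i) o\<^sub>L adj (X $ i))"
  have "sqrt (norm T) < 1" using assms by (simp add: nc_ball_def T_def)
  moreover have "row_bound X (sqrt (norm T))"
  proof (rule row_bound_dual[OF X])
    fix h
    have "(\<Sum>i\<in>UNIV. (norm (adj (X $ i) h))\<^sup>2) \<le> cmod (cinner (T h) h)"
      unfolding T_def cinner_row_square[OF X] norm_of_real by simp
    also have "\<dots> \<le> norm (T h) * norm h" by (rule norm_cinner_le)
    also have "\<dots> \<le> norm T * norm h * norm h" by (intro mult_right_mono norm_blinfun) auto
    finally show "(\<Sum>i\<in>UNIV. (norm (adj (X $ i) h))\<^sup>2) \<le> (sqrt (norm T))\<^sup>2 * (norm h)\<^sup>2"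
      by (simp add: power2_eq_square)
  qed
  ultimately show thesis using that[of "sqrt (norm T)"] by simp
qed

lemma nc_ballI:
  assumes X: "\<And>i. X $ i \<in> bounded_ops" and "row_bound X \<rho>" "0 \<le> \<rho>" "\<rho> < 1"
  shows "X \<in> nc_ball"
proof -
  define T where "T = (\<Sum>i\<in>UNIV. (X $ i) o\<^sub>L adj (X $ i))"
  have "norm T \<le> \<rho>\<^sup>2"
  proof (rule norm_blinfun_bound)
    fix h
    have "(norm (T h))\<^sup>2 \<le> \<rho>\<^sup>2 * (\<Sum>i\<in>UNIV. (norm (adj (X $ i) h))\<^sup>2)"
      using row_boundD[OF assms(2), of "\<lambda>i. adj (X $ i) h"] by (simp add: T_def blinfun.sum_left)
    also have "\<dots> \<le> \<rho>\<^sup>2 * (\<rho>\<^sup>2 * (norm h)\<^sup>2)"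
      by (intro mult_left_mono row_bound_adj assms) auto
    also have "\<dots> = (\<rho>\<^sup>2 * norm h)\<^sup>2" by (simp add: power2_eq_square)
    finally show "norm (T h) \<le> \<rho>\<^sup>2 * norm h"
      by (rule power2_le_imp_le) simp
  qed simp
  also have "\<rho>\<^sup>2 < 1" using assms(3,4) by (simp add: power_less_one_iff)
  finally show ?thesis using X by (simp add: nc_ball_def T_def)
qed

section \<open>Free power series\<close>

instance chilbert_space \<subseteq> banach ..

lemma words_0 [simp]: "words 0 = {[]}"
  by (auto simp: words_def)

lemma words_Suc: "words (Suc k) = (\<lambda>(i, \<alpha>). i # \<alpha>) ` (UNIV \<times> words k)"
  by (auto simp: words_def length_Suc_conv image_iff)

lemma finite_words [simp]: "finite (words k :: 'n::finite list set)"
  by (induction k) (auto simp: words_Suc)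

lemma sum_words_Suc: "(\<Sum>\<gamma>\<in>words (Suc k). f \<gamma>) = (\<Sum>i\<in>UNIV. \<Sum>\<alpha>\<in>words k. f (i # \<alpha>))"
proof -
  have "inj_on (\<lambda>(i, \<alpha>). i # \<alpha>) (UNIV \<times> words k)" by (auto simp: inj_on_def)
  then show ?thesis
    unfolding words_Suc sum.cartesian_product by (subst sum.reindex) (auto simp: o_def case_prod_unfold)
qed

lemma word_op_Nil [simp]: "word_op X [] = id_blinfun"
  by (simp add: word_op_def)

lemma word_op_Cons [simp]: "word_op X (i # \<alpha>) = (X $ i) o\<^sub>L word_op X \<alpha>"
  by (simp add: word_op_def)

lemma bounded_ops_id [simp]: "id_blinfun \<in> bounded_ops"
  by (simp add: bounded_ops_def)

lemma bounded_ops_compose: "S \<in> bounded_ops \<Longrightarrow> T \<in> bounded_ops \<Longrightarrow> S o\<^sub>L T \<in> bounded_ops"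
  by (simp add: bounded_ops_def)

lemma bounded_ops_scaleC: "S \<in> bounded_ops \<Longrightarrow> c *\<^sub>C S \<in> bounded_ops"
  by (simp add: bounded_ops_def scaleC_blinfun.rep_eq scaleC_scaleC mult.commute)

lemma bounded_ops_add: "S \<in> bounded_ops \<Longrightarrow> T \<in> bounded_ops \<Longrightarrow> S + T \<in> bounded_ops"
  by (simp add: bounded_ops_def blinfun.add_left scaleC_add_right)

lemma bounded_ops_zero [simp]: "0 \<in> bounded_ops"
  by (simp add: bounded_ops_def)

lemma bounded_ops_sum: "(\<And>i. i \<in> A \<Longrightarrow> S i \<in> bounded_ops) \<Longrightarrow> (\<Sum>i\<in>A. S i) \<in> bounded_ops"
  by (induction A rule: infinite_finite_induct) (auto intro: bounded_ops_add)

lemma bounded_ops_limit: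
  assumes "S \<longlonglongrightarrow> T" "\<And>k. S k \<in> bounded_ops"
  shows "T \<in> bounded_ops"
  unfolding bounded_ops_def
proof (intro CollectI allI)
  fix c x
  have "(\<lambda>k. S k (c *\<^sub>C x)) \<longlonglongrightarrow> T (c *\<^sub>C x)"
    by (intro tendsto_intros assms)
  moreover have "(\<lambda>k. c *\<^sub>C S k x) \<longlonglongrightarrow> c *\<^sub>C T x"
    by (intro bounded_linear.tendsto[OF bounded_linear_scaleC_right] tendsto_intros assms)
  ultimately show "T (c *\<^sub>C x) = c *\<^sub>C T x"
    using LIMSEQ_unique by (simp add: bounded_opsD[OF assms(2)]) blast
qed

lemma word_op_bounded_ops: "(\<And>i. X $ i \<in> bounded_ops) \<Longrightarrow> word_op X \<alpha> \<in> bounded_ops"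
  by (induction \<alpha>) (auto intro: bounded_ops_compose)

text \<open>The row of all words of length \<open>k\<close> is the \<open>k\<close>-fold iterate of
  the row \<open>X\<close>: splitting off the first letter uses the row bound once and leaves one
  family of shorter words for each letter.\<close>

lemma row_bound_words:
  assumes "row_bound X \<rho>"
  shows "(norm (\<Sum>\<alpha>\<in>words k. word_op X \<alpha> (y \<alpha>)))\<^sup>2 \<le> (\<rho> ^ k)\<^sup>2 * (\<Sum>\<alpha>\<in>words k. (norm (y \<alpha>))\<^sup>2)"
proof (induction k arbitrary: y)
  case (Suc k)
  have "(norm (\<Sum>\<alpha>\<in>words (Suc k). word_op X \<alpha> (y \<alpha>)))\<^sup>2
      = (norm (\<Sum>i\<in>UNIV. (X $ i) (\<Sum>\<alpha>\<in>words k. word_op X \<alpha> (y (i # \<alpha>)))))\<^sup>2"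
    by (simp add: sum_words_Suc blinfun.sum_right)
  also have "\<dots> \<le> \<rho>\<^sup>2 * (\<Sum>i\<in>UNIV. (norm (\<Sum>\<alpha>\<in>words k. word_op X \<alpha> (y (i # \<alpha>))))\<^sup>2)"
    by (rule row_boundD[OF assms])
  also have "\<dots> \<le> \<rho>\<^sup>2 * (\<Sum>i\<in>UNIV. (\<rho> ^ k)\<^sup>2 * (\<Sum>\<alpha>\<in>words k. (norm (y (i # \<alpha>)))\<^sup>2))"
    by (intro mult_left_mono sum_mono Suc.IH) auto
  also have "\<dots> = (\<rho> ^ Suc k)\<^sup>2 * (\<Sum>\<alpha>\<in>words (Suc k). (norm (y \<alpha>))\<^sup>2)"
    by (simp add: sum_words_Suc sum_distrib_left power_mult_distrib mult_ac)
  finally show ?case .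
qed simp

section \<open>Homogeneous parts, radius of convergence and evaluation\<close>

definition level :: "('n::finite list \<Rightarrow> complex) \<Rightarrow> nat \<Rightarrow> real" where
  "level a k = L2_set (\<lambda>\<alpha>. cmod (a \<alpha>)) (words k)"

lemma level_nonneg [simp]: "0 \<le> level a k"
  by (simp add: level_def)

lemma level_sq: "(level a k)\<^sup>2 = (\<Sum>\<alpha>\<in>words k. (cmod (a \<alpha>))\<^sup>2)"
  by (simp add: level_def L2_set_def sum_nonneg)

lemma norm_le_level: "cmod (a \<alpha>) \<le> level a (length \<alpha>)"
  unfolding level_def by (rule member_le_L2_set) (auto simp: words_def finite_words[unfolded words_def])

lemma level_add_le: "level (\<lambda>\<alpha>. a \<alpha> + b \<alpha>) k \<le> level a k + level b k"
proof -
  have "level (\<lambda>\<alpha>. a \<alpha> + b \<alpha>) k \<le> L2_set (\<lambda>\<alpha>. cmod (a \<alpha>) + cmod (b \<alpha>)) (words k)"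
    unfolding level_def by (intro L2_set_mono norm_triangle_ineq) auto
  also have "\<dots> \<le> level a k + level b k" unfolding level_def by (rule L2_set_triangle_ineq)
  finally show ?thesis .
qed

lemma level_scale: "level (\<lambda>\<alpha>. c * a \<alpha>) k = cmod c * level a k"
  unfolding level_def by (simp add: norm_mult L2_set_right_distrib)

definition homog :: "('n::finite list \<Rightarrow> complex) \<Rightarrow> ('h::chilbert_space \<Rightarrow>\<^sub>L 'h) ^ 'n \<Rightarrow> nat \<Rightarrow> ('h \<Rightarrow>\<^sub>L 'h)"
  where "homog a X k = (\<Sum>\<alpha>\<in>words k. a \<alpha> *\<^sub>C word_op X \<alpha>)"

lemma homog_apply: "homog a X k h = (\<Sum>\<alpha>\<in>words k. a \<alpha> *\<^sub>C word_op X \<alpha> h)"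
  by (simp add: homog_def blinfun.sum_left scaleC_blinfun.rep_eq)

lemma homog_bounded_ops: "(\<And>i. X $ i \<in> bounded_ops) \<Longrightarrow> homog a X k \<in> bounded_ops"
  unfolding homog_def by (intro bounded_ops_sum bounded_ops_scaleC word_op_bounded_ops)

text \<open>Complex linearity moves the coefficients into the argument, so the row bound for words
  applies to the vectors \<open>a \<alpha> *\<^sub>C h\<close>. The square norm of the coefficients
  enters and not their absolute sum, which is why the radius of convergence is governed by square
  sums.\<close>

lemma norm_homog_le:
  assumes "\<And>i. X $ i \<in> bounded_ops" "row_bound X \<rho>" "0 \<le> \<rho>"
  shows "norm (homog a X k) \<le> \<rho> ^ k * level a k"
proof (rule norm_blinfun_bound)
  fix h
  have "homog a X k h = (\<Sum>\<alpha>\<in>words k. word_op X \<alpha> (a \<alpha> *\<^sub>C h))"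
    by (simp add: homog_apply bounded_opsD[OF word_op_bounded_ops] assms)
  then have "(norm (homog a X k h))\<^sup>2 \<le> (\<rho> ^ k)\<^sup>2 * (\<Sum>\<alpha>\<in>words k. (norm (a \<alpha> *\<^sub>C h))\<^sup>2)"
    using row_bound_words[OF assms(2)] by metis
  also have "\<dots> = (\<rho> ^ k * level a k * norm h)\<^sup>2"
    by (simp add: norm_scaleC power_mult_distrib level_sq sum_distrib_right sum_distrib_left mult_ac)
  finally show "norm (homog a X k h) \<le> \<rho> ^ k * level a k * norm h"
    by (rule power2_le_imp_le) (use assms in auto)
qed (use assms in auto)

text \<open>The limsup condition in the form in which it is used, absolute convergence at every
  radius below 1; \<open>hol_coeffs_iff_limsup\<close> identifies the two.\<close>

definition hol_coeffs :: "('n::finite list \<Rightarrow> complex) \<Rightarrow> bool" where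
  "hol_coeffs a \<longleftrightarrow> (\<forall>r. 0 \<le> r \<longrightarrow> r < 1 \<longrightarrow> summable (\<lambda>k. r ^ k * level a k))"

lemma hol_coeffsD: "hol_coeffs a \<Longrightarrow> 0 \<le> r \<Longrightarrow> r < 1 \<Longrightarrow> summable (\<lambda>k. r ^ k * level a k)"
  by (simp add: hol_coeffs_def)

lemma hol_coeffs_bounded:
  assumes "\<And>r. 0 < r \<Longrightarrow> r < 1 \<Longrightarrow> \<exists>C. \<forall>k. r ^ k * level a k \<le> C"
  shows "hol_coeffs a"
  unfolding hol_coeffs_def
proof (intro allI impI)
  fix r :: real assume r: "0 \<le> r" "r < 1"
  then obtain t where t: "r < t" "t < 1" using dense by blast
  with r have "0 < t" by simp
  obtain C where C: "\<And>k. t ^ k * level a k \<le> C" using assms \<open>0 < t\<close> t by blast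
  show "summable (\<lambda>k. r ^ k * level a k)"
  proof (rule summable_comparison_test')
    show "summable (\<lambda>k. C * (r / t) ^ k)"
      using r t by (intro summable_mult summable_geometric) simp
    fix k
    have "r ^ k * level a k = (r / t) ^ k * (t ^ k * level a k)"
      using \<open>0 < t\<close> by (simp add: power_divide)
    also have "\<dots> \<le> (r / t) ^ k * C"
      using r \<open>0 < t\<close> by (intro mult_left_mono C) simp
    finally show "norm (r ^ k * level a k) \<le> C * (r / t) ^ k"
      using r by (simp add: mult.commute)
  qed
qed

lemma root_level: "k > 0 \<Longrightarrow> root (2 * k) (\<Sum>\<alpha>\<in>words k. (cmod (a \<alpha>))\<^sup>2) = root k (level a k)"
  by (subst mult.commute) (simp add: real_root_mult_exp level_sq[symmetric] real_root_power_cancel)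

text \<open>Cauchy--Hadamard. For r < t < 1 the roots are eventually below 1/t, so the terms are
  dominated by powers of r/t. Conversely the terms at radius 1/(1 + \<epsilon>) tend to 0, so the
  roots are eventually at most 1 + \<epsilon>.\<close>

lemma hol_coeffs_iff_limsup:
  "limsup (\<lambda>k. ereal (root (2 * k) (\<Sum>\<alpha>\<in>words k. (cmod (a \<alpha>))\<^sup>2))) \<le> 1 \<longleftrightarrow> hol_coeffs a"
proof
  assume L: "limsup (\<lambda>k. ereal (root (2 * k) (\<Sum>\<alpha>\<in>words k. (cmod (a \<alpha>))\<^sup>2))) \<le> 1"
  show "hol_coeffs a" unfolding hol_coeffs_def
  proof (intro allI impI)
    fix r :: real assume r: "0 \<le> r" "r < 1"
    obtain t where t: "r < t" "t < 1" using dense r by blast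
    define s where "s = inverse t"
    have s: "1 < s" "s > 0" using r t by (auto simp: s_def one_less_inverse_iff)
    have rs: "r * s < 1" "0 \<le> r * s" using r t by (auto simp: s_def field_simps)
    have "ereal s > 1" using s by simp
    with L have "limsup (\<lambda>k. ereal (root (2 * k) (\<Sum>\<alpha>\<in>words k. (cmod (a \<alpha>))\<^sup>2))) < ereal s"
      by (rule le_less_trans)
    then have "\<forall>\<^sub>F k in sequentially. ereal (root (2 * k) (\<Sum>\<alpha>\<in>words k. (cmod (a \<alpha>))\<^sup>2)) < ereal s"
      by (rule Limsup_lessD)
    then have "\<forall>\<^sub>F k in sequentially. norm (r ^ k * level a k) \<le> (r * s) ^ k"
      using eventually_gt_at_top[of 0]
    proof eventually_elim
      case (elim k)
      then have "root k (level a k) \<le> s" using root_level[of k a] by simp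
      then have "level a k \<le> s ^ k"
        using elim power_mono[of "root k (level a k)" s k] by (simp add: real_root_pow_pos2)
      then show ?case using r by (simp add: power_mult_distrib mult_left_mono)
    qed
    then show "summable (\<lambda>k. r ^ k * level a k)"
      by (rule summable_comparison_test_ev) (use rs in \<open>simp add: summable_geometric\<close>)
  qed
next
  assume h: "hol_coeffs a"
  show "limsup (\<lambda>k. ereal (root (2 * k) (\<Sum>\<alpha>\<in>words k. (cmod (a \<alpha>))\<^sup>2))) \<le> 1"
  proof (rule ereal_le_epsilon2)
    fix \<epsilon> :: real assume "\<epsilon> > 0"
    define s where "s = 1 + \<epsilon>"
    define r where "r = inverse s"
    have s: "s > 1" "s > 0" using \<open>\<epsilon> > 0\<close> by (auto simp: s_def)
    then have r: "0 \<le> r" "r < 1" "0 < r" by (auto simp: r_def inverse_less_1_iff)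
    have "(\<lambda>k. r ^ k * level a k) \<longlonglongrightarrow> 0"
      by (intro summable_LIMSEQ_zero hol_coeffsD h r)
    then have "\<forall>\<^sub>F k in sequentially. r ^ k * level a k < 1"
      by (rule order_tendstoD) simp
    then have "\<forall>\<^sub>F k in sequentially. ereal (root (2 * k) (\<Sum>\<alpha>\<in>words k. (cmod (a \<alpha>))\<^sup>2)) \<le> ereal s"
      using eventually_gt_at_top[of 0]
    proof eventually_elim
      case (elim k)
      have "level a k \<le> s ^ k"
        using elim s by (simp add: r_def power_inverse field_simps)
      then have "root k (level a k) \<le> s"
        using elim s real_root_le_mono[of k "level a k" "s ^ k"] by (simp add: real_root_power_cancel)
      then show ?case using root_level[of k a] elim by simp
    qed
    then have "limsup (\<lambda>k. ereal (root (2 * k) (\<Sum>\<alpha>\<in>words k. (cmod (a \<alpha>))\<^sup>2))) \<le> ereal s"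
      by (rule Limsup_bounded)
    then show "limsup (\<lambda>k. ereal (root (2 * k) (\<Sum>\<alpha>\<in>words k. (cmod (a \<alpha>))\<^sup>2))) \<le> 1 + ereal \<epsilon>"
      by (simp add: s_def one_ereal_def)
  qed
qed

definition ev :: "('n::finite list \<Rightarrow> complex) \<Rightarrow> ('h::chilbert_space \<Rightarrow>\<^sub>L 'h) ^ 'n \<Rightarrow> ('h \<Rightarrow>\<^sub>L 'h)" where
  "ev a X = (\<Sum>k. homog a X k)"

lemma summable_norm_homog:
  assumes "hol_coeffs a" "X \<in> nc_ball"
  shows "summable (\<lambda>k. norm (homog a X k))"
proof -
  obtain \<rho> where \<rho>: "0 \<le> \<rho>" "\<rho> < 1" "row_bound X \<rho>" using nc_ball_row_bound assms(2) by blast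
  show ?thesis
    by (rule summable_comparison_test'[OF hol_coeffsD[OF assms(1) \<rho>(1,2)]])
      (simp add: norm_homog_le nc_ball_ops[OF assms(2)] \<rho>)
qed

lemma ev_sums:
  assumes "hol_coeffs a" "X \<in> nc_ball"
  shows "homog a X sums ev a X"
  unfolding ev_def by (rule summable_sums[OF summable_norm_cancel[OF summable_norm_homog[OF assms]]])

lemma ev_bounded_ops:
  assumes "hol_coeffs a" "X \<in> nc_ball"
  shows "ev a X \<in> bounded_ops"
  using ev_sums[OF assms] unfolding sums_def
  by (rule bounded_ops_limit) (intro bounded_ops_sum homog_bounded_ops nc_ball_ops assms)

lemma ev_apply_sums:
  assumes "hol_coeffs a" "X \<in> nc_ball"
  shows "(\<lambda>k. homog a X k h) sums ev a X h"
  using bounded_linear.sums[OF blinfun.bounded_linear_left ev_sums[OF assms]] .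

lemma has_coeffs_iff:
  "has_coeffs f a \<longleftrightarrow> hol_coeffs a \<and> (\<forall>X\<in>nc_ball. f X = ev a X)"
  unfolding has_coeffs_def hol_coeffs_iff_limsup
  by (auto simp: homog_def[symmetric] dest: sums_unique2[OF ev_sums] intro: ev_sums)

lemma homog_add: "homog (\<lambda>\<alpha>. a \<alpha> + b \<alpha>) X k = homog a X k + homog b X k"
  by (simp add: homog_def scaleC_add_left sum.distrib)

lemma homog_scale: "homog (\<lambda>\<alpha>. c * a \<alpha>) X k = c *\<^sub>C homog a X k"
  by (simp add: homog_def scaleC_scaleC scaleC_sum_right)

lemma hol_coeffs_add:
  assumes "hol_coeffs a" "hol_coeffs b"
  shows "hol_coeffs (\<lambda>\<alpha>. a \<alpha> + b \<alpha>)"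
  unfolding hol_coeffs_def
proof (intro allI impI)
  fix r :: real assume r: "0 \<le> r" "r < 1"
  show "summable (\<lambda>k. r ^ k * level (\<lambda>\<alpha>. a \<alpha> + b \<alpha>) k)"
  proof (rule summable_comparison_test'[OF summable_add[OF hol_coeffsD[OF assms(1) r] hol_coeffsD[OF assms(2) r]]])
    fix k
    show "norm (r ^ k * level (\<lambda>\<alpha>. a \<alpha> + b \<alpha>) k) \<le> r ^ k * level a k + r ^ k * level b k"
      using mult_left_mono[OF level_add_le[of a b k], of "r ^ k"] r by (simp add: algebra_simps)
  qed
qed

lemma hol_coeffs_scale:
  assumes "hol_coeffs a"
  shows "hol_coeffs (\<lambda>\<alpha>. c * a \<alpha>)"
  unfolding hol_coeffs_def level_scale
  using summable_mult[OF hol_coeffsD[OF assms], of _ "cmod c"] by (simp add: mult.left_commute)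

lemma ev_add:
  assumes "hol_coeffs a" "hol_coeffs b" "X \<in> nc_ball"
  shows "ev (\<lambda>\<alpha>. a \<alpha> + b \<alpha>) X = ev a X + ev b X"
  using sums_unique2[OF ev_sums[OF hol_coeffs_add[OF assms(1,2)] assms(3)]]
    sums_add[OF ev_sums[OF assms(1,3)] ev_sums[OF assms(2,3)]]
  by (simp add: homog_add[abs_def])

lemma ev_scale:
  assumes "hol_coeffs a" "X \<in> nc_ball"
  shows "ev (\<lambda>\<alpha>. c * a \<alpha>) X = c *\<^sub>C ev a X"
  unfolding ev_def homog_scale
  by (rule sums_unique[symmetric])
    (rule bounded_linear.sums[OF bounded_linear_scaleC_right ev_sums[OF assms, unfolded ev_def]])

text \<open>The Cauchy product of free power series: the sum of
  \<open>c \<alpha> * d \<beta>\<close> over all splittings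
  \<open>\<gamma> = \<alpha> @ \<beta>\<close>, organised by the first letter. The summand with
  \<open>c []\<close> is the splitting with empty prefix.\<close>

fun conv :: "('n list \<Rightarrow> complex) \<Rightarrow> ('n list \<Rightarrow> complex) \<Rightarrow> 'n list \<Rightarrow> complex" where
  "conv c d [] = c [] * d []"
| "conv c d (i # \<gamma>) = c [] * d (i # \<gamma>) + conv (\<lambda>\<alpha>. c (i # \<alpha>)) d \<gamma>"

lemma homog_Suc: "homog c X (Suc k) = (\<Sum>i\<in>UNIV. (X $ i) o\<^sub>L homog (\<lambda>\<alpha>. c (i # \<alpha>)) X k)"
  if "\<And>i. X $ i \<in> bounded_ops"
  by (intro blinfun_eqI)
    (simp add: homog_apply sum_words_Suc blinfun.sum_left blinfun.sum_right bounded_opsD[OF that])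

text \<open>The induction generalises over \<open>c\<close>: removing the first letter replaces
  \<open>c\<close> by its translates \<open>\<lambda>\<alpha>. c (i # \<alpha>)\<close> and leaves
  \<open>d\<close> alone.\<close>

lemma homog_conv:
  assumes "\<And>i. X $ i \<in> bounded_ops"
  shows "homog (conv c d) X m = (\<Sum>j\<le>m. homog c X j o\<^sub>L homog d X (m - j))"
proof (induction m arbitrary: c)
  case 0
  show ?case
    by (intro blinfun_eqI) (simp add: homog_apply scaleC_scaleC)
next
  case (Suc m)
  have "homog (conv c d) X (Suc m)
      = (\<Sum>i\<in>UNIV. (X $ i) o\<^sub>L (c [] *\<^sub>C homog (\<lambda>\<gamma>. d (i # \<gamma>)) X m + homog (conv (\<lambda>\<alpha>. c (i # \<alpha>)) d) X m))"
    by (simp add: homog_Suc[OF assms] homog_add homog_scale)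
  also have "\<dots> = c [] *\<^sub>C homog d X (Suc m)
      + (\<Sum>i\<in>UNIV. (X $ i) o\<^sub>L (\<Sum>j\<le>m. homog (\<lambda>\<alpha>. c (i # \<alpha>)) X j o\<^sub>L homog d X (m - j)))"
    by (intro blinfun_eqI)
      (simp add: homog_Suc[OF assms] Suc.IH blinfun.add_left blinfun.sum_left blinfun.add_right
        scaleC_blinfun.rep_eq bounded_opsD[OF assms] scaleC_sum_right sum.distrib)
  also have "(\<Sum>i\<in>UNIV. (X $ i) o\<^sub>L (\<Sum>j\<le>m. homog (\<lambda>\<alpha>. c (i # \<alpha>)) X j o\<^sub>L homog d X (m - j)))
      = (\<Sum>j\<le>m. homog c X (Suc j) o\<^sub>L homog d X (m - j))"
    by (intro blinfun_eqI)
      (simp add: homog_Suc[OF assms] blinfun.sum_left blinfun.sum_right, rule sum.swap)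
  also have "c [] *\<^sub>C homog d X (Suc m) = homog c X 0 o\<^sub>L homog d X (Suc m - 0)"
    by (intro blinfun_eqI) (simp add: homog_apply[of c] scaleC_blinfun.rep_eq)
  finally show ?case
    by (subst sum.atMost_Suc_shift) simp
qed

text \<open>Domination by a product makes the double family absolutely summable, so the three orders
  of summation agree. Antidiagonals serve the Cauchy product, rows and columns the interchange of
  series in a composition.\<close>

lemma double_series:
  fixes F :: "nat \<Rightarrow> nat \<Rightarrow> 'a::banach"
  assumes F: "\<And>j k. norm (F j k) \<le> A j * B k" and A: "summable A" "\<And>j. 0 \<le> A j"
    and B: "summable B" "\<And>k. 0 \<le> B k"
  shows sums_antidiagonal: "(\<lambda>m. \<Sum>j\<le>m. F j (m - j)) sums (\<Sum>j. \<Sum>k. F j k)"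
    and sums_rows: "(\<lambda>j. \<Sum>k. F j k) sums (\<Sum>j. \<Sum>k. F j k)"
    and sums_columns: "(\<lambda>k. \<Sum>j. F j k) sums (\<Sum>j. \<Sum>k. F j k)"
proof -
  have "A summable_on UNIV" "B summable_on UNIV"
    using A B by (auto intro: summable_nonneg_imp_summable_on)
  then have "(\<lambda>(j, k). A j * B k) summable_on UNIV \<times> UNIV"
  proof (intro summable_on_SigmaI[where g = "\<lambda>j. A j * infsum B UNIV"])
    show "((\<lambda>k. case (j, k) of (j, k) \<Rightarrow> A j * B k) has_sum A j * infsum B UNIV) UNIV" for j
      unfolding prod.case by (intro has_sum_cmult_right has_sum_infsum) fact
    show "(\<lambda>j. A j * infsum B UNIV) summable_on UNIV"
      by (intro summable_on_cmult_left) fact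
  qed (simp add: A(2) B(2))
  then have "(\<lambda>p. norm (case p of (j, k) \<Rightarrow> F j k)) summable_on UNIV \<times> UNIV"
    by (rule summable_on_comparison_test) (auto intro: F)
  then have "(\<lambda>(j, k). F j k) summable_on UNIV \<times> UNIV"
    by (rule abs_summable_summable)
  then obtain S where S: "((\<lambda>(j, k). F j k) has_sum S) (UNIV \<times> UNIV)"
    by (auto simp: summable_on_def)
  have row: "((\<lambda>k. F j k) has_sum (\<Sum>k. F j k)) UNIV" for j
  proof (rule norm_summable_imp_has_sum)
    show "summable (\<lambda>k. norm (F j k))"
      by (rule summable_comparison_test'[OF summable_mult[OF B(1), of "A j"]]) (simp add: F)
    then show "(\<lambda>k. F j k) sums (\<Sum>k. F j k)" by (rule summable_sums[OF summable_norm_cancel])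
  qed
  have col: "((\<lambda>j. F j k) has_sum (\<Sum>j. F j k)) UNIV" for k
  proof (rule norm_summable_imp_has_sum)
    show "summable (\<lambda>j. norm (F j k))"
      by (rule summable_comparison_test'[OF summable_mult2[OF A(1), of "B k"]]) (simp add: F)
    then show "(\<lambda>j. F j k) sums (\<Sum>j. F j k)" by (rule summable_sums[OF summable_norm_cancel])
  qed
  have "((\<lambda>j. \<Sum>k. F j k) has_sum S) UNIV"
    by (rule has_sum_SigmaD[OF S]) (use row in simp)
  then have sumsS: "(\<lambda>j. \<Sum>k. F j k) sums S" by (rule has_sum_imp_sums)
  then have Seq: "(\<Sum>j. \<Sum>k. F j k) = S" by (simp add: sums_iff)
  show "(\<lambda>j. \<Sum>k. F j k) sums (\<Sum>j. \<Sum>k. F j k)" using sumsS Seq by simp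
  have "((\<lambda>(k, j). F j k) has_sum S) (UNIV \<times> UNIV)"
    using S by (subst (asm) has_sum_swap) simp
  then have "((\<lambda>k. \<Sum>j. F j k) has_sum S) UNIV"
    by (rule has_sum_SigmaD) (use col in simp)
  then show "(\<lambda>k. \<Sum>j. F j k) sums (\<Sum>j. \<Sum>k. F j k)" unfolding Seq by (rule has_sum_imp_sums)
  have "((\<lambda>(m, j). F j (m - j)) has_sum S) (SIGMA m:UNIV. {..m})"
    using S by (subst has_sum_reindex_bij_witness[where i = "\<lambda>(j, k). (j + k, j)"
          and j = "\<lambda>(m, j). (j, m - j)" and T = "UNIV \<times> UNIV" and h = "\<lambda>(j, k). F j k" and s' = S]) auto
  then have "((\<lambda>m. \<Sum>j\<le>m. F j (m - j)) has_sum S) UNIV"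
    by (rule has_sum_SigmaD) (simp add: has_sum_finite)
  then show "(\<lambda>m. \<Sum>j\<le>m. F j (m - j)) sums (\<Sum>j. \<Sum>k. F j k)" unfolding Seq by (rule has_sum_imp_sums)
qed

lemma homog_conv_sums:
  assumes "hol_coeffs c" "hol_coeffs d" "X \<in> nc_ball"
  shows "homog (conv c d) X sums (ev c X o\<^sub>L ev d X)"
proof -
  let ?F = "\<lambda>j k. homog c X j o\<^sub>L homog d X k"
  have "(\<lambda>m. \<Sum>j\<le>m. ?F j (m - j)) sums (\<Sum>j. \<Sum>k. ?F j k)"
    by (rule sums_antidiagonal[OF norm_blinfun_compose])
      (use assms in \<open>auto intro: summable_norm_homog\<close>)
  moreover have "(\<Sum>k. ?F j k) = homog c X j o\<^sub>L ev d X" for j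
    by (intro sums_unique[symmetric] bounded_linear.sums[OF
          bounded_bilinear.bounded_linear_right[OF bounded_bilinear_blinfun_compose]] ev_sums assms)
  moreover have "(\<Sum>j. homog c X j o\<^sub>L ev d X) = ev c X o\<^sub>L ev d X"
    by (intro sums_unique[symmetric] bounded_linear.sums[OF
          bounded_bilinear.bounded_linear_left[OF bounded_bilinear_blinfun_compose]] ev_sums assms)
  ultimately show ?thesis
    by (simp add: homog_conv[OF nc_ball_ops[OF assms(3)], abs_def])
qed

lemma sum_words_less: "(\<Sum>k<K. \<Sum>\<alpha>\<in>words k. f \<alpha>) = (\<Sum>\<alpha>\<in>{\<alpha>::'a::finite list. length \<alpha> < K}. f \<alpha>)"
proof -
  have "{\<alpha>::'a list. length \<alpha> < K} = (\<Union>k<K. words k)" by (auto simp: words_def)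
  then show ?thesis
    by (simp only:) (rule sum.UNION_disjoint[symmetric], auto simp: words_def[of _] finite_words[unfolded words_def])
qed

lemma finite_words_less [simp]: "finite {\<alpha>::'a::finite list. length \<alpha> < K}"
proof -
  have "{\<alpha>::'a list. length \<alpha> < K} = (\<Union>k<K. words k)" by (auto simp: words_def)
  then show ?thesis by simp
qed

section \<open>Orthonormal families\<close>

definition orthonormal :: "('i \<Rightarrow> 'h::complex_inner) \<Rightarrow> bool" where
  "orthonormal u \<longleftrightarrow> (\<forall>i j. cinner (u i) (u j) = (if i = j then 1 else 0))"

lemma orthonormalD: "orthonormal u \<Longrightarrow> cinner (u i) (u j) = (if i = j then 1 else 0)"
  by (simp add: orthonormal_def)

lemma orthonormal_cinner_sum:
  assumes "orthonormal u" "finite F"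
  shows "cinner (\<Sum>i\<in>F. c i *\<^sub>C u i) (u j) = (if j \<in> F then c j else 0)"
proof -
  have "cinner (\<Sum>i\<in>F. c i *\<^sub>C u i) (u j) = (\<Sum>i\<in>F. if i = j then c i else 0)"
    by (auto simp: cinner_sum_left cinner_scaleC_left orthonormalD[OF assms(1)] intro!: sum.cong)
  then show ?thesis using assms(2) by simp
qed

lemma orthonormal_norm_sum:
  assumes "orthonormal u" "finite F"
  shows "(norm (\<Sum>i\<in>F. c i *\<^sub>C u i))\<^sup>2 = (\<Sum>i\<in>F. (cmod (c i))\<^sup>2)"
proof -
  have "complex_of_real ((norm (\<Sum>i\<in>F. c i *\<^sub>C u i))\<^sup>2) = (\<Sum>j\<in>F. cnj (c j) * c j)"
    unfolding cinner_self[symmetric]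
    by (subst cinner_sum_right) (simp add: cinner_scaleC_right orthonormal_cinner_sum[OF assms])
  also have "\<dots> = complex_of_real (\<Sum>i\<in>F. (cmod (c i))\<^sup>2)"
    by (simp add: complex_norm_square mult.commute del: of_real_power)
  finally show ?thesis by (simp only: of_real_eq_iff)
qed

lemma bessel:
  assumes "orthonormal u" "finite F"
  shows "(\<Sum>i\<in>F. (cmod (cinner x (u i)))\<^sup>2) \<le> (norm x)\<^sup>2"
proof -
  define p where "p = (\<Sum>i\<in>F. cinner x (u i) *\<^sub>C u i)"
  have np: "(norm p)\<^sup>2 = (\<Sum>i\<in>F. (cmod (cinner x (u i)))\<^sup>2)"
    unfolding p_def by (rule orthonormal_norm_sum[OF assms])
  have "cinner x p = (\<Sum>i\<in>F. cnj (cinner x (u i)) * cinner x (u i))"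
    by (simp add: p_def cinner_sum_right cinner_scaleC_right)
  also have "\<dots> = complex_of_real ((norm p)\<^sup>2)"
    by (simp add: np complex_norm_square mult.commute del: of_real_power)
  finally have "inner x p = (norm p)\<^sup>2" by (simp add: inner_eq_Re_cinner)
  moreover have "0 \<le> inner (x - p) (x - p)" by simp
  ultimately have "(norm p)\<^sup>2 \<le> (norm x)\<^sup>2"
    by (simp add: inner_simps inner_commute power2_norm_eq_inner)
  with np show ?thesis by simp
qed

text \<open>Square summability is expressed through a bound on all finite partial sums, a form that is
  stable under pointwise limits.\<close>

definition l2_le :: "('i \<Rightarrow> complex) \<Rightarrow> real \<Rightarrow> bool" where
  "l2_le c C \<longleftrightarrow> (\<forall>F. finite F \<longrightarrow> (\<Sum>i\<in>F. (cmod (c i))\<^sup>2) \<le> C)"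

lemma l2_leD: "l2_le c C \<Longrightarrow> finite F \<Longrightarrow> (\<Sum>i\<in>F. (cmod (c i))\<^sup>2) \<le> C"
  by (simp add: l2_le_def)

lemma l2_le_nonneg: "l2_le c C \<Longrightarrow> 0 \<le> C"
  using l2_leD[of c C "{}"] by simp

lemma l2_le_mono: "l2_le c C \<Longrightarrow> C \<le> D \<Longrightarrow> l2_le c D"
  unfolding l2_le_def by (meson order_trans)

lemma l2_le_summable: "l2_le c C \<Longrightarrow> (\<lambda>i. (cmod (c i))\<^sup>2) summable_on UNIV"
  by (rule nonneg_bdd_above_summable_on) (auto simp: l2_le_def bdd_above_def)

lemma l2_le_infsum: "l2_le c C \<Longrightarrow> (\<Sum>\<^sub>\<infinity>i. (cmod (c i))\<^sup>2) \<le> C"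
  by (rule infsum_le_finite_sums[OF l2_le_summable]) (auto simp: l2_le_def)

lemma summable_l2_le:
  assumes "(\<lambda>i. (cmod (c i))\<^sup>2) summable_on UNIV"
  shows "l2_le c (\<Sum>\<^sub>\<infinity>i. (cmod (c i))\<^sup>2)"
  unfolding l2_le_def by (auto intro!: finite_sum_le_infsum assms)

lemma l2_le_limit:
  assumes "\<And>k. l2_le (c k) C" "\<And>i. (\<lambda>k. c k i) \<longlonglongrightarrow> d i"
  shows "l2_le d C"
  unfolding l2_le_def
proof (intro allI impI)
  fix F :: "'a set" assume "finite F"
  have "(\<lambda>k. \<Sum>i\<in>F. (cmod (c k i))\<^sup>2) \<longlonglongrightarrow> (\<Sum>i\<in>F. (cmod (d i))\<^sup>2)"
    by (intro tendsto_intros assms)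
  then show "(\<Sum>i\<in>F. (cmod (d i))\<^sup>2) \<le> C"
    by (rule LIMSEQ_le_const2) (use l2_leD[OF assms(1) \<open>finite F\<close>] in blast)
qed

lemma orthonormal_l2_le_cinner:
  assumes "orthonormal u"
  shows "l2_le (\<lambda>i. cinner x (u i)) ((norm x)\<^sup>2)"
  unfolding l2_le_def using bessel[OF assms] by blast

text \<open>For \<open>F0 \<subseteq> F\<close> the partial sums over \<open>F\<close> and
  \<open>F0\<close> differ, by Pythagoras, by a vector whose squared norm is part of a tail of the
  square sum. The net of partial sums is therefore Cauchy.\<close>

lemma orthonormal_summable:
  fixes u :: "'i \<Rightarrow> 'h::chilbert_space"
  assumes u: "orthonormal u" and c: "l2_le c C"
  shows "(\<lambda>i. c i *\<^sub>C u i) summable_on UNIV"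
proof -
  define q where "q = (\<lambda>i. (cmod (c i))\<^sup>2)"
  define f where "f = (\<lambda>i. c i *\<^sub>C u i)"
  have q0: "0 \<le> q i" for i by (simp add: q_def)
  obtain S where S: "(q has_sum S) UNIV"
    using l2_le_summable[OF c] by (auto simp: q_def summable_on_def)
  have "\<exists>P. eventually P (finite_subsets_at_top UNIV) \<and>
        (\<forall>F F'. P F \<and> P F' \<longrightarrow> dist (sum f F) (sum f F') < \<epsilon>)" if "\<epsilon> > 0" for \<epsilon>
  proof -
    have pos: "0 < \<epsilon>\<^sup>2 / 4" using that by simp
    from S have "\<forall>\<^sub>F F in finite_subsets_at_top UNIV. dist (sum q F) S < \<epsilon>\<^sup>2 / 4"
      unfolding has_sum_def by (rule tendstoD[OF _ pos])
    then obtain F0 where F0: "finite F0" "\<And>F. finite F \<Longrightarrow> F0 \<subseteq> F \<Longrightarrow> dist (sum q F) S < \<epsilon>\<^sup>2 / 4"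
      by (auto simp: eventually_finite_subsets_at_top)
    define P where "P F \<longleftrightarrow> finite F \<and> F0 \<subseteq> F" for F
    have "eventually P (finite_subsets_at_top UNIV)"
      unfolding P_def eventually_finite_subsets_at_top using F0(1) by auto
    moreover have near: "dist (sum f F) (sum f F0) < \<epsilon> / 2" if "P F" for F
    proof -
      have F: "finite F" "F0 \<subseteq> F" using that by (auto simp: P_def)
      have "sum f F - sum f F0 = sum f (F - F0)" using F by (simp add: sum_diff)
      then have "(norm (sum f F - sum f F0))\<^sup>2 = sum q (F - F0)"
        using F orthonormal_norm_sum[OF u, of "F - F0" c] by (simp add: f_def q_def)
      also have "\<dots> = sum q F - sum q F0" using F by (simp add: sum_diff)
      also have "\<dots> \<le> S - sum q F0"
        using finite_sum_le_has_sum[OF S, of F] F q0 by simp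
      also have "\<dots> < \<epsilon>\<^sup>2 / 4" using F0(2)[OF F0(1)] by (simp add: dist_real_def abs_if split: if_splits)
      also have "\<dots> = (\<epsilon> / 2)\<^sup>2" by (simp add: power_divide)
      finally show ?thesis
        unfolding dist_norm using \<open>\<epsilon> > 0\<close> by (rule power2_less_imp_less[OF _ less_imp_le[OF half_gt_zero]])
    qed
    have "dist (sum f F) (sum f F') < \<epsilon>" if "P F" "P F'" for F F'
      using dist_triangle_half_l[OF near near] that by blast
    with calculation show ?thesis by blast
  qed
  then have "cauchy_filter (filtermap (sum f) (finite_subsets_at_top UNIV))"
    by (simp add: cauchy_filter_metric_filtermap)
  moreover have "complete (UNIV::'h set)"
    by (meson Cauchy_convergent UNIV_I complete_def convergent_def)
  ultimately obtain L' where "(sum f \<longlongrightarrow> L') (finite_subsets_at_top UNIV)"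
    using complete_uniform[where S = "UNIV::'h set"] by (force simp: filterlim_def)
  then show ?thesis
    unfolding f_def using summable_on_def has_sum_def by blast
qed

definition osum :: "('i \<Rightarrow> 'h::chilbert_space) \<Rightarrow> ('i \<Rightarrow> complex) \<Rightarrow> 'h" where
  "osum u c = (\<Sum>\<^sub>\<infinity>i. c i *\<^sub>C u i)"

lemma osum_has_sum:
  assumes "orthonormal u" "l2_le c C"
  shows "((\<lambda>i. c i *\<^sub>C u i) has_sum osum u c) UNIV"
  unfolding osum_def by (rule has_sum_infsum[OF orthonormal_summable[OF assms]])

lemma cinner_osum:
  assumes u: "orthonormal u" and c: "l2_le c C"
  shows "cinner (osum u c) (u j) = c j"
proof -
  have "((\<lambda>i. cinner (c i *\<^sub>C u i) (u j)) has_sum cinner (osum u c) (u j)) UNIV"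
    by (rule has_sum_bounded_linear[OF bounded_linear_cinner_left osum_has_sum[OF assms]])
  moreover have "((\<lambda>i. cinner (c i *\<^sub>C u i) (u j)) has_sum c j) UNIV"
    by (rule has_sum_finite_neutralI[of "{j}"]) (auto simp: cinner_scaleC_left orthonormalD[OF u])
  ultimately show ?thesis using has_sum_unique by blast
qed

lemma norm_osum:
  assumes u: "orthonormal u" and c: "l2_le c C"
  shows "(norm (osum u c))\<^sup>2 = (\<Sum>\<^sub>\<infinity>i. (cmod (c i))\<^sup>2)"
proof -
  have "((\<lambda>F. (norm (\<Sum>i\<in>F. c i *\<^sub>C u i))\<^sup>2) \<longlongrightarrow> (norm (osum u c))\<^sup>2) (finite_subsets_at_top UNIV)"
    using osum_has_sum[OF assms] unfolding has_sum_def by (intro tendsto_intros)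
  moreover have "\<forall>\<^sub>F F in finite_subsets_at_top UNIV.
      (norm (\<Sum>i\<in>F. c i *\<^sub>C u i))\<^sup>2 = (\<Sum>i\<in>F. (cmod (c i))\<^sup>2)"
    using orthonormal_norm_sum[OF u] by (intro eventually_finite_subsets_at_top_weakI) auto
  ultimately have "((\<lambda>i. (cmod (c i))\<^sup>2) has_sum (norm (osum u c))\<^sup>2) UNIV"
    unfolding has_sum_def by (rule Lim_transform_eventually)
  then show ?thesis by (simp add: infsumI)
qed

lemma norm_osum_le: "orthonormal u \<Longrightarrow> l2_le c C \<Longrightarrow> (norm (osum u c))\<^sup>2 \<le> C"
  by (metis norm_osum l2_le_infsum)

lemma osum_add:
  assumes "orthonormal u" "l2_le c C" "l2_le d D"
  shows "osum u (\<lambda>i. c i + d i) = osum u c + osum u d"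
  unfolding osum_def scaleC_add_left
  by (rule infsum_add[OF orthonormal_summable[OF assms(1,2)] orthonormal_summable[OF assms(1,3)]])

lemma osum_scale:
  assumes "orthonormal u" "l2_le c C"
  shows "osum u (\<lambda>i. a * c i) = a *\<^sub>C osum u c"
  using has_sum_bounded_linear[OF bounded_linear_scaleC_right osum_has_sum[OF assms], of a]
  unfolding scaleC_scaleC osum_def by (rule infsumI)

text \<open>Gram--Schmidt with a fresh vector at each stage: finitely many vectors never span, so
  some \<open>z\<close> lies outside their span and its component orthogonal to them is nonzero.
  Countability of \<open>'n list\<close> turns the sequence into a family indexed by words.\<close>

lemma orthonormal_family_exists:
  assumes inf: "\<not> (\<exists>B :: 'h::chilbert_space set. finite B \<and> cspan B = UNIV)"
  obtains e :: "'n::finite list \<Rightarrow> 'h::chilbert_space" where "orthonormal e"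
proof -
  define P where "P f x r \<longleftrightarrow> norm r = 1 \<and> (\<forall>y<x. cinner r (f y) = 0)"
    for f :: "nat \<Rightarrow> 'h" and x r
  have "\<exists>f. \<forall>x. P f x (f x)"
  proof (rule dependent_wellorder_choice)
    show "P f x r = P g x r" if "\<And>y. y < x \<Longrightarrow> f y = g y" for r f g and x :: nat
      using that by (auto simp: P_def)
  next
    fix x :: nat and f assume f: "\<And>y. y < x \<Longrightarrow> P f y (f y)"
    have on: "cinner (f i) (f j) = (if i = j then 1 else 0)" if "i < x" "j < x" for i j
    proof (cases i j rule: linorder_cases)
      case less
      then have "cinner (f j) (f i) = 0" using f[OF that(2)] by (simp add: P_def)
      then show ?thesis using less cinner_commute[of "f i" "f j"] by simp
    next
      case equal
      then show ?thesis using f[OF that(1)] by (simp add: P_def cinner_self)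
    next
      case greater
      then show ?thesis using f[OF that(1)] by (simp add: P_def)
    qed
    have "cspan (f ` {..<x}) \<noteq> UNIV" using inf by blast
    then obtain z where z: "z \<notin> cspan (f ` {..<x})" by blast
    define p where "p = (\<Sum>i<x. cinner z (f i) *\<^sub>C f i)"
    define w where "w = z - p"
    have "p \<in> cspan (f ` {..<x})"
      unfolding p_def
      by (intro complex_vector.span_sum complex_vector.span_scale complex_vector.span_base) auto
    then have "w \<noteq> 0" using z by (auto simp: w_def)
    have "cinner w (f j) = 0" if "j < x" for j
    proof -
      have "cinner p (f j) = (\<Sum>i<x. if i = j then cinner z (f i) else 0)"
        unfolding p_def cinner_sum_left cinner_scaleC_left using that on by (intro sum.cong) auto
      then show ?thesis using that by (simp add: w_def cinner_diff_left)
    qed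
    then have "P f x (inverse (norm w) *\<^sub>R w)"
      using \<open>w \<noteq> 0\<close> by (simp add: P_def cinner_scaleR_left)
    then show "\<exists>r. P f x r" by blast
  qed
  then obtain f where f: "\<And>x. P f x (f x)" by blast
  have "orthonormal f"
    unfolding orthonormal_def
  proof (intro allI)
    fix i j
    show "cinner (f i) (f j) = (if i = j then 1 else 0)"
    proof (cases i j rule: linorder_cases)
      case less
      then have "cinner (f j) (f i) = 0" using f[of j] by (simp add: P_def)
      then show ?thesis using less cinner_commute[of "f i" "f j"] by simp
    next
      case equal
      then show ?thesis using f[of i] by (simp add: P_def cinner_self)
    next
      case greater
      then show ?thesis using f[of i] by (simp add: P_def)
    qed
  qed
  then have "orthonormal (\<lambda>\<alpha>::'n list. f (to_nat \<alpha>))"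
    by (simp add: orthonormal_def)
  then show thesis by (rule that)
qed

section \<open>The left creation operators\<close>

text \<open>The family need not be complete. Its closed span plays the role of the full Fock space,
  and each \<open>shift i\<close> below is a partial isometry vanishing on the orthogonal
  complement.\<close>

locale fock =
  fixes e :: "'n::finite list \<Rightarrow> 'h::chilbert_space"
  assumes orthonormal_e: "orthonormal e"
begin

lemma cinner_e: "cinner (e \<alpha>) (e \<beta>) = (if \<alpha> = \<beta> then 1 else 0)"
  by (rule orthonormalD[OF orthonormal_e])

lemma norm_e [simp]: "norm (e \<alpha>) = 1"
  using norm_sq_cinner[of "e \<alpha>"] norm_ge_zero[of "e \<alpha>"] power2_eq_1_iff[of "norm (e \<alpha>)"]
  by (auto simp: cinner_e)

definition shift :: "'n \<Rightarrow> 'h \<Rightarrow>\<^sub>L 'h" where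
  "shift i = Blinfun (\<lambda>x. osum (\<lambda>\<alpha>. e (i # \<alpha>)) (\<lambda>\<alpha>. cinner x (e \<alpha>)))"

lemma orthonormal_Cons: "orthonormal (\<lambda>\<alpha>. e (i # \<alpha>))"
  by (simp add: orthonormal_def cinner_e)

lemma l2_le_e: "l2_le (\<lambda>\<alpha>. cinner x (e \<alpha>)) ((norm x)\<^sup>2)"
  by (rule orthonormal_l2_le_cinner[OF orthonormal_e])

lemma shift_apply: "shift i x = osum (\<lambda>\<alpha>. e (i # \<alpha>)) (\<lambda>\<alpha>. cinner x (e \<alpha>))"
proof -
  have "bounded_linear (\<lambda>x. osum (\<lambda>\<alpha>. e (i # \<alpha>)) (\<lambda>\<alpha>. cinner x (e \<alpha>)))"
  proof (rule bounded_linear_intro[where K = 1])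
    fix x y :: 'h and r :: real
    show "osum (\<lambda>\<alpha>. e (i # \<alpha>)) (\<lambda>\<alpha>. cinner (x + y) (e \<alpha>))
        = osum (\<lambda>\<alpha>. e (i # \<alpha>)) (\<lambda>\<alpha>. cinner x (e \<alpha>)) + osum (\<lambda>\<alpha>. e (i # \<alpha>)) (\<lambda>\<alpha>. cinner y (e \<alpha>))"
      unfolding cinner_add_left by (rule osum_add[OF orthonormal_Cons l2_le_e l2_le_e])
    show "osum (\<lambda>\<alpha>. e (i # \<alpha>)) (\<lambda>\<alpha>. cinner (r *\<^sub>R x) (e \<alpha>))
        = r *\<^sub>R osum (\<lambda>\<alpha>. e (i # \<alpha>)) (\<lambda>\<alpha>. cinner x (e \<alpha>))"
      unfolding scaleR_scaleC cinner_scaleC_left by (rule osum_scale[OF orthonormal_Cons l2_le_e])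
    show "norm (osum (\<lambda>\<alpha>. e (i # \<alpha>)) (\<lambda>\<alpha>. cinner x (e \<alpha>))) \<le> norm x * 1"
      using power2_le_imp_le[OF norm_osum_le[OF orthonormal_Cons l2_le_e] norm_ge_zero] by simp
  qed
  then show ?thesis by (simp add: shift_def bounded_linear_Blinfun_apply)
qed

lemma shift_bounded_ops [simp]: "shift i \<in> bounded_ops"
  unfolding bounded_ops_def
  by (simp add: shift_apply cinner_scaleC_left osum_scale[OF orthonormal_Cons l2_le_e])

lemma norm_shift_le: "norm (shift i x) \<le> norm x"
  unfolding shift_apply by (rule power2_le_imp_le[OF norm_osum_le[OF orthonormal_Cons l2_le_e] norm_ge_zero])

lemma cinner_shift_same: "cinner (shift i x) (e (i # \<alpha>)) = cinner x (e \<alpha>)"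
  unfolding shift_apply by (rule cinner_osum[OF orthonormal_Cons l2_le_e])

lemma cinner_shift_zero:
  assumes "\<And>\<alpha>. cinner (e (i # \<alpha>)) y = 0"
  shows "cinner (shift i x) y = 0"
proof -
  have "((\<lambda>\<alpha>. cinner (cinner x (e \<alpha>) *\<^sub>C e (i # \<alpha>)) y) has_sum cinner (shift i x) y) UNIV"
    unfolding shift_apply
    by (rule has_sum_bounded_linear[OF bounded_linear_cinner_left osum_has_sum[OF orthonormal_Cons l2_le_e]])
  then have "((\<lambda>\<alpha>. 0) has_sum cinner (shift i x) y) (UNIV :: 'n list set)"
    by (simp add: cinner_scaleC_left assms)
  then show ?thesis by (metis has_sum_0_simp has_sum_unique)
qed

lemma cinner_shift_Nil: "cinner (shift i x) (e []) = 0"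
  by (rule cinner_shift_zero) (simp add: cinner_e)

lemma cinner_shift_Cons: "cinner (shift i x) (e (j # \<alpha>)) = (if i = j then cinner x (e \<alpha>) else 0)"
proof (cases "i = j")
  case False
  then show ?thesis by (simp add: cinner_shift_zero cinner_e)
qed (simp add: cinner_shift_same)

lemma cinner_shift_shift:
  assumes "i \<noteq> j"
  shows "cinner (shift i x) (shift j y) = 0"
proof (rule cinner_shift_zero)
  fix \<alpha>
  have "cinner (shift j y) (e (i # \<alpha>)) = 0" using assms by (simp add: cinner_shift_Cons)
  then show "cinner (e (i # \<alpha>)) (shift j y) = 0"
    by (metis cinner_commute complex_cnj_zero)
qed

lemma shift_e [simp]: "shift i (e \<alpha>) = e (i # \<alpha>)"
proof -
  have "((\<lambda>\<beta>. cinner (e \<alpha>) (e \<beta>) *\<^sub>C e (i # \<beta>)) has_sum shift i (e \<alpha>)) UNIV"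
    unfolding shift_apply by (rule osum_has_sum[OF orthonormal_Cons l2_le_e])
  moreover have "((\<lambda>\<beta>. cinner (e \<alpha>) (e \<beta>) *\<^sub>C e (i # \<beta>)) has_sum e (i # \<alpha>)) UNIV"
    by (rule has_sum_finite_neutralI[of "{\<alpha>}"]) (auto simp: cinner_e scaleC_one)
  ultimately show ?thesis using has_sum_unique by blast
qed

definition shifts :: "real \<Rightarrow> ('h \<Rightarrow>\<^sub>L 'h) ^ 'n" where
  "shifts r = (\<chi> i. of_real r *\<^sub>C shift i)"

lemma shifts_nth [simp]: "shifts r $ i = of_real r *\<^sub>C shift i"
  by (simp add: shifts_def)

lemma shifts_bounded_ops: "shifts r $ i \<in> bounded_ops"
  by (simp add: bounded_ops_scaleC)

text \<open>The shifts have mutually orthogonal ranges, so the squared norm of the sum splits into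
  the squared norms of its terms.\<close>

lemma row_bound_shifts: "row_bound (shifts r) r"
  unfolding row_bound_def
proof
  fix y :: "'n \<Rightarrow> 'h"
  define w where "w = (\<Sum>i\<in>UNIV. shift i (y i))"
  have "cinner w w = (\<Sum>i\<in>UNIV. \<Sum>j\<in>UNIV. cinner (shift i (y i)) (shift j (y j)))"
    by (simp add: w_def cinner_sum_left cinner_sum_right) (rule sum.swap)
  also have "\<dots> = (\<Sum>i\<in>UNIV. \<Sum>j\<in>UNIV. if j = i then cinner (shift i (y i)) (shift i (y i)) else 0)"
    by (intro sum.cong) (auto simp: cinner_shift_shift)
  also have "\<dots> = complex_of_real (\<Sum>i\<in>UNIV. (norm (shift i (y i)))\<^sup>2)"
    by (simp add: cinner_self)
  finally have "(norm w)\<^sup>2 = (\<Sum>i\<in>UNIV. (norm (shift i (y i)))\<^sup>2)"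
    by (simp only: cinner_self of_real_eq_iff)
  also have "\<dots> \<le> (\<Sum>i\<in>UNIV. (norm (y i))\<^sup>2)"
    by (intro sum_mono power_mono norm_shift_le) auto
  finally have "r\<^sup>2 * (norm w)\<^sup>2 \<le> r\<^sup>2 * (\<Sum>i\<in>UNIV. (norm (y i))\<^sup>2)"
    by (intro mult_left_mono) auto
  moreover have "(\<Sum>i\<in>UNIV. (shifts r $ i) (y i)) = of_real r *\<^sub>C w"
    by (simp add: w_def scaleC_blinfun.rep_eq scaleC_sum_right)
  ultimately show "(norm (\<Sum>i\<in>UNIV. (shifts r $ i) (y i)))\<^sup>2 \<le> r\<^sup>2 * (\<Sum>i\<in>UNIV. (norm (y i))\<^sup>2)"
    by (simp add: norm_scaleC power_mult_distrib)
qed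

lemma shifts_nc_ball: "0 \<le> r \<Longrightarrow> r < 1 \<Longrightarrow> shifts r \<in> nc_ball"
  by (rule nc_ballI[OF shifts_bounded_ops row_bound_shifts])

lemma word_op_shifts: "word_op (shifts r) \<alpha> (e \<beta>) = of_real (r ^ length \<alpha>) *\<^sub>C e (\<alpha> @ \<beta>)"
  by (induction \<alpha>)
    (simp_all add: scaleC_one scaleC_blinfun.rep_eq bounded_opsD[OF shift_bounded_ops] scaleC_scaleC)

lemma homog_shifts: "homog a (shifts r) k (e []) = (\<Sum>\<alpha>\<in>words k. (of_real (r ^ k) * a \<alpha>) *\<^sub>C e \<alpha>)"
  unfolding homog_apply word_op_shifts by (intro sum.cong) (auto simp: scaleC_scaleC words_def mult.commute)

lemma norm_homog_shifts: "0 \<le> r \<Longrightarrow> norm (homog a (shifts r) k (e [])) = r ^ k * level a k"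
proof -
  assume "0 \<le> r"
  have "(norm (homog a (shifts r) k (e [])))\<^sup>2 = (r ^ k * level a k)\<^sup>2"
    unfolding homog_shifts orthonormal_norm_sum[OF orthonormal_e finite_words]
    using \<open>0 \<le> r\<close> by (simp add: norm_mult norm_power power_mult_distrib level_sq sum_distrib_left)
  then show ?thesis using \<open>0 \<le> r\<close> by (simp add: power2_eq_iff_nonneg)
qed

lemma cinner_homog_shifts:
  "cinner (homog a (shifts r) k (e [])) (e \<gamma>) = (if length \<gamma> = k then of_real (r ^ k) * a \<gamma> else 0)"
  unfolding homog_shifts orthonormal_cinner_sum[OF orthonormal_e finite_words] by (simp add: words_def)

lemma cinner_ev_shifts:
  assumes "hol_coeffs a" "0 \<le> r" "r < 1"
  shows "cinner (ev a (shifts r) (e [])) (e \<gamma>) = of_real (r ^ length \<gamma>) * a \<gamma>"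
proof -
  have "(\<lambda>k. cinner (homog a (shifts r) k (e [])) (e \<gamma>)) sums cinner (ev a (shifts r) (e [])) (e \<gamma>)"
    by (rule bounded_linear.sums[OF bounded_linear_cinner_left ev_apply_sums])
      (use assms shifts_nc_ball in auto)
  moreover have "(\<lambda>k. cinner (homog a (shifts r) k (e [])) (e \<gamma>)) sums (of_real (r ^ length \<gamma>) * a \<gamma>)"
    unfolding cinner_homog_shifts
    using sums_single[of "length \<gamma>" "\<lambda>k. of_real (r ^ k) * a \<gamma>"] by (simp only: eq_commute)
  ultimately show ?thesis using sums_unique2 by blast
qed

lemma norm_ev_shifts_le:
  assumes "hol_coeffs a" "0 \<le> r" "r < 1" "l2_le a C"
  shows "(norm (ev a (shifts r) (e [])))\<^sup>2 \<le> C"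
proof -
  have "(\<lambda>K. \<Sum>k<K. homog a (shifts r) k (e [])) \<longlonglongrightarrow> ev a (shifts r) (e [])"
    using ev_apply_sums[OF assms(1) shifts_nc_ball[OF assms(2,3)]] by (simp add: sums_def)
  then have "(\<lambda>K. (norm (\<Sum>k<K. homog a (shifts r) k (e [])))\<^sup>2) \<longlonglongrightarrow> (norm (ev a (shifts r) (e [])))\<^sup>2"
    by (intro tendsto_intros)
  moreover have "(norm (\<Sum>k<K. homog a (shifts r) k (e [])))\<^sup>2 \<le> C" for K
  proof -
    have "(\<Sum>k<K. homog a (shifts r) k (e []))
        = (\<Sum>k<K. \<Sum>\<alpha>\<in>words k. (of_real (r ^ length \<alpha>) * a \<alpha>) *\<^sub>C e \<alpha>)"
      unfolding homog_shifts by (intro sum.cong) (auto simp: words_def)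
    then have "(norm (\<Sum>k<K. homog a (shifts r) k (e [])))\<^sup>2
        = (\<Sum>\<alpha>\<in>{\<alpha>. length \<alpha> < K}. (cmod (of_real (r ^ length \<alpha>) * a \<alpha>))\<^sup>2)"
      unfolding sum_words_less by (simp only: orthonormal_norm_sum[OF orthonormal_e finite_words_less])
    also have "\<dots> \<le> (\<Sum>\<alpha>\<in>{\<alpha>. length \<alpha> < K}. (cmod (a \<alpha>))\<^sup>2)"
      using assms(2,3) by (intro sum_mono power_mono) (auto simp: norm_mult norm_power mult_left_le_one_le power_le_one)
    also have "\<dots> \<le> C" using assms(4) by (rule l2_leD) simp
    finally show ?thesis .
  qed
  ultimately show ?thesis by (intro LIMSEQ_le_const2) auto
qed

lemma coeffs_unique:
  assumes "hol_coeffs a" "hol_coeffs b" "\<And>X :: ('h \<Rightarrow>\<^sub>L 'h) ^ 'n. X \<in> nc_ball \<Longrightarrow> ev a X = ev b X"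
  shows "a = b"
proof
  fix \<gamma>
  \<comment> \<open>Any radius strictly between 0 and 1 would serve; the power must be nonzero to be
    cancelled.\<close>
  have "of_real ((1/2) ^ length \<gamma>) * a \<gamma> = of_real ((1/2) ^ length \<gamma>) * b \<gamma>"
    using cinner_ev_shifts[OF assms(1), of "1/2" \<gamma>] cinner_ev_shifts[OF assms(2), of "1/2" \<gamma>]
      assms(3)[OF shifts_nc_ball[of "1/2"]] by simp
  then show "a \<gamma> = b \<gamma>" by simp
qed

lemma free_coeff_eq:
  fixes f :: "('h \<Rightarrow>\<^sub>L 'h) ^ 'n \<Rightarrow> ('h \<Rightarrow>\<^sub>L 'h)"
  assumes "has_coeffs f a"
  shows "free_coeff f = a"
  unfolding free_coeff_def
proof (rule the_equality[where P = "has_coeffs f"])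
  show "b = a" if "has_coeffs f b" for b
    using that assms by (intro coeffs_unique) (auto simp: has_coeffs_iff)
qed fact

lemma has_coeffs_free_coeff:
  fixes f :: "('h \<Rightarrow>\<^sub>L 'h) ^ 'n \<Rightarrow> ('h \<Rightarrow>\<^sub>L 'h)"
  assumes "free_holomorphic f"
  shows "has_coeffs f (free_coeff f)"
  using assms free_coeff_eq unfolding free_holomorphic_def by metis

text \<open>The undilated shifts lie outside the domain of convergence, but only finite sums occur
  here. At the vacuum the norm of a homogeneous part equals its \<open>level\<close>, while its
  operator norm is at most that, so the product formula for operators becomes an inequality between
  levels.\<close>

lemma level_conv_le:
  fixes c d :: "'n list \<Rightarrow> complex"
  shows "level (conv c d) m \<le> (\<Sum>j\<le>m. level c j * level d (m - j))"
proof -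
  have "level (conv c d) m = norm (homog (conv c d) (shifts 1) m (e []))"
    by (subst norm_homog_shifts) simp_all
  also have "\<dots> = norm (\<Sum>j\<le>m. homog c (shifts 1) j (homog d (shifts 1) (m - j) (e [])))"
    by (subst homog_conv[OF shifts_bounded_ops]) (simp add: blinfun.sum_left)
  also have "\<dots> \<le> (\<Sum>j\<le>m. norm (homog c (shifts 1) j) * norm (homog d (shifts 1) (m - j) (e [])))"
    by (intro sum_norm_le norm_blinfun)
  also have "\<dots> \<le> (\<Sum>j\<le>m. level c j * level d (m - j))"
  proof (intro sum_mono mult_mono)
    fix j
    show "norm (homog c (shifts 1) j) \<le> level c j"
      using norm_homog_le[OF shifts_bounded_ops row_bound_shifts, of 1 c j] by simp
    show "norm (homog d (shifts 1) (m - j) (e [])) \<le> level d (m - j)"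
      by (subst norm_homog_shifts) simp_all
  qed auto
  finally show ?thesis .
qed

lemma hol_coeffs_conv:
  fixes c d :: "'n list \<Rightarrow> complex"
  assumes "hol_coeffs c" "hol_coeffs d"
  shows "hol_coeffs (conv c d)"
  unfolding hol_coeffs_def
proof (intro allI impI)
  fix r :: real assume r: "0 \<le> r" "r < 1"
  let ?F = "\<lambda>j k. (r ^ j * level c j) * (r ^ k * level d k)"
  have "summable (\<lambda>m. \<Sum>j\<le>m. ?F j (m - j))"
    using sums_antidiagonal[of ?F "\<lambda>j. r ^ j * level c j" "\<lambda>k. r ^ k * level d k"] r
      hol_coeffsD[OF assms(1) r] hol_coeffsD[OF assms(2) r] by (auto simp: sums_iff)
  then show "summable (\<lambda>m. r ^ m * level (conv c d) m)"
  proof (rule summable_comparison_test')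
    fix m
    have "r ^ m * level (conv c d) m \<le> r ^ m * (\<Sum>j\<le>m. level c j * level d (m - j))"
      using r by (intro mult_left_mono level_conv_le) auto
    also have "\<dots> = (\<Sum>j\<le>m. ?F j (m - j))"
      unfolding sum_distrib_left
    proof (intro sum.cong refl)
      fix j assume "j \<in> {..m}"
      then have "r ^ m = r ^ j * r ^ (m - j)" by (simp flip: power_add)
      then show "r ^ m * (level c j * level d (m - j)) = ?F j (m - j)" by simp
    qed
    finally show "norm (r ^ m * level (conv c d) m) \<le> (\<Sum>j\<le>m. ?F j (m - j))"
      using r by simp
  qed
qed

end

lemma ev_conv:
  assumes "hol_coeffs c" "hol_coeffs d" "X \<in> nc_ball"
  shows "ev (conv c d) X = ev c X o\<^sub>L ev d X"
  unfolding ev_def[of "conv c d"] using homog_conv_sums[OF assms] by (rule sums_unique[symmetric])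

section \<open>Evaluation at scalars and the resolvent\<close>

text \<open>It has two roles: the value of a word at the scalar point \<mu>, and the coefficient
  sequence of the resolvent of \<open>lin \<mu>\<close>, which for a conjugated point is the
  reproducing kernel of the Hardy space.\<close>

definition wsc :: "complex ^ 'n \<Rightarrow> 'n::finite list \<Rightarrow> complex" where
  "wsc \<mu> \<alpha> = prod_list (map (\<lambda>i. \<mu> $ i) \<alpha>)"

lemma wsc_Nil [simp]: "wsc \<mu> [] = 1"
  by (simp add: wsc_def)

lemma wsc_Cons [simp]: "wsc \<mu> (i # \<alpha>) = \<mu> $ i * wsc \<mu> \<alpha>"
  by (simp add: wsc_def)

lemma wsc_append: "wsc \<mu> (\<alpha> @ \<beta>) = wsc \<mu> \<alpha> * wsc \<mu> \<beta>"
  by (simp add: wsc_def)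

lemma norm_vec_sq: "(norm (\<mu> :: complex ^ 'n::finite))\<^sup>2 = (\<Sum>i\<in>UNIV. (cmod (\<mu> $ i))\<^sup>2)"
  by (simp add: norm_vec_def L2_set_def sum_nonneg)

lemma level_wsc: "level (wsc \<mu>) k = norm \<mu> ^ k"
proof -
  have "(\<Sum>\<alpha>\<in>words k. (cmod (wsc \<mu> \<alpha>))\<^sup>2) = ((norm \<mu>)\<^sup>2) ^ k"
  proof (induction k)
    case (Suc k)
    have "(\<Sum>\<alpha>\<in>words (Suc k). (cmod (wsc \<mu> \<alpha>))\<^sup>2)
        = (\<Sum>i\<in>UNIV. (cmod (\<mu> $ i))\<^sup>2 * (\<Sum>\<alpha>\<in>words k. (cmod (wsc \<mu> \<alpha>))\<^sup>2))"
      by (simp add: sum_words_Suc norm_mult power_mult_distrib sum_distrib_left)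
    then show ?case by (simp add: Suc norm_vec_sq sum_distrib_right)
  qed simp
  then have "(level (wsc \<mu>) k)\<^sup>2 = (norm \<mu> ^ k)\<^sup>2"
    by (simp only: level_sq power_mult[symmetric] mult.commute)
  then show ?thesis by (simp add: power2_eq_iff_nonneg)
qed

lemma hol_coeffs_wsc:
  assumes "norm \<mu> < 1"
  shows "hol_coeffs (wsc \<mu>)"
proof (rule hol_coeffs_bounded)
  fix r :: real assume "0 < r" "r < 1"
  then have "r ^ k * level (wsc \<mu>) k \<le> 1" for k
    using assms by (simp add: level_wsc mult_le_one power_le_one)
  then show "\<exists>C. \<forall>k. r ^ k * level (wsc \<mu>) k \<le> C" by blast
qed

lemma l2_le_wsc:
  assumes "norm \<mu> < 1"
  shows "l2_le (wsc \<mu>) (1 / (1 - (norm \<mu>)\<^sup>2))"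
  unfolding l2_le_def
proof (intro allI impI)
  fix F :: "'a list set" assume F: "finite F"
  define q where "q = (norm \<mu>)\<^sup>2"
  have q: "0 \<le> q" "q < 1" using assms by (auto simp: q_def power_less_one_iff)
  obtain K where K: "\<And>\<alpha>. \<alpha> \<in> F \<Longrightarrow> length \<alpha> < K"
    using finite_imageI[OF F, of length] finite_nat_set_iff_bounded by auto
  have "(\<Sum>\<alpha>\<in>F. (cmod (wsc \<mu> \<alpha>))\<^sup>2) \<le> (\<Sum>\<alpha>\<in>{\<alpha>. length \<alpha> < K}. (cmod (wsc \<mu> \<alpha>))\<^sup>2)"
    using K by (intro sum_mono2) auto
  also have "\<dots> = (\<Sum>k<K. \<Sum>\<alpha>\<in>words k. (cmod (wsc \<mu> \<alpha>))\<^sup>2)"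
    by (rule sum_words_less[symmetric])
  also have "\<dots> = (\<Sum>k<K. q ^ k)"
    by (simp only: level_sq[symmetric] level_wsc q_def power_mult[symmetric] mult.commute)
  also have "\<dots> \<le> (\<Sum>k. q ^ k)"
    using q by (intro sum_le_suminf summable_geometric) auto
  also have "\<dots> = 1 / (1 - q)" using q by (intro suminf_geometric) auto
  finally show "(\<Sum>\<alpha>\<in>F. (cmod (wsc \<mu> \<alpha>))\<^sup>2) \<le> 1 / (1 - (norm \<mu>)\<^sup>2)" by (simp add: q_def)
qed

lemma scalar_tuple_apply [simp]: "(scalar_tuple \<mu> $ i) x = \<mu> $ i *\<^sub>C x"
  by (simp add: scalar_tuple_def scaleC_blinfun.rep_eq)

lemma scalar_tuple_bounded_ops: "scalar_tuple \<mu> $ i \<in> bounded_ops"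
  by (simp add: scalar_tuple_def bounded_ops_scaleC)

lemma word_op_scalar_tuple: "word_op (scalar_tuple \<mu>) \<alpha> = wsc \<mu> \<alpha> *\<^sub>C id_blinfun"
  by (rule blinfun_eqI, induction \<alpha>) (auto simp: scaleC_one scaleC_blinfun.rep_eq scaleC_scaleC)

lemma scalar_tuple_nc_ball:
  assumes "norm \<mu> < 1"
  shows "(scalar_tuple \<mu> :: ('h::chilbert_space \<Rightarrow>\<^sub>L 'h) ^ 'n::finite) \<in> nc_ball"
proof (rule nc_ballI[OF scalar_tuple_bounded_ops])
  show "row_bound (scalar_tuple \<mu> :: ('h \<Rightarrow>\<^sub>L 'h) ^ 'n) (norm \<mu>)"
    unfolding row_bound_def
  proof
    fix y :: "'n \<Rightarrow> 'h"
    have "norm (\<Sum>i\<in>UNIV. \<mu> $ i *\<^sub>C y i) \<le> (\<Sum>i\<in>UNIV. cmod (\<mu> $ i) * norm (y i))"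
      by (intro sum_norm_le) (simp add: norm_scaleC)
    then have "(norm (\<Sum>i\<in>UNIV. \<mu> $ i *\<^sub>C y i))\<^sup>2 \<le> (\<Sum>i\<in>UNIV. cmod (\<mu> $ i) * norm (y i))\<^sup>2"
      by (rule power_mono) simp
    also have "\<dots> \<le> (\<Sum>i\<in>UNIV. (cmod (\<mu> $ i))\<^sup>2) * (\<Sum>i\<in>UNIV. (norm (y i))\<^sup>2)"
      by (rule Cauchy_Schwarz_ineq_sum)
    finally show "(norm (\<Sum>i\<in>UNIV. (scalar_tuple \<mu> $ i) (y i)))\<^sup>2
        \<le> (norm \<mu>)\<^sup>2 * (\<Sum>i\<in>UNIV. (norm (y i))\<^sup>2)"
      by (simp add: norm_vec_sq)
  qed
qed (use assms in auto)

definition sev :: "('n::finite list \<Rightarrow> complex) \<Rightarrow> complex ^ 'n \<Rightarrow> complex" where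
  "sev c \<mu> = (\<Sum>k. \<Sum>\<alpha>\<in>words k. c \<alpha> * wsc \<mu> \<alpha>)"

lemma sev_sums:
  assumes c: "hol_coeffs c" and "norm \<mu> < 1"
  shows "(\<lambda>k. \<Sum>\<alpha>\<in>words k. c \<alpha> * wsc \<mu> \<alpha>) sums sev c \<mu>"
  unfolding sev_def
proof (intro summable_sums summable_comparison_test'[OF hol_coeffsD[OF c]])
  fix k
  have "cmod (\<Sum>\<alpha>\<in>words k. c \<alpha> * wsc \<mu> \<alpha>) \<le> (\<Sum>\<alpha>\<in>words k. \<bar>cmod (c \<alpha>)\<bar> * \<bar>cmod (wsc \<mu> \<alpha>)\<bar>)"
    by (intro sum_norm_le) (simp add: norm_mult)
  also have "\<dots> \<le> level c k * level (wsc \<mu>) k"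
    unfolding level_def by (rule L2_set_mult_ineq)
  finally show "norm (\<Sum>\<alpha>\<in>words k. c \<alpha> * wsc \<mu> \<alpha>) \<le> norm \<mu> ^ k * level c k"
    by (simp add: level_wsc mult.commute)
qed (use assms in auto)

lemma ev_scalar_tuple:
  assumes "hol_coeffs c" "norm \<mu> < 1"
  shows "ev c (scalar_tuple \<mu>) = sev c \<mu> *\<^sub>C (id_blinfun :: 'h::chilbert_space \<Rightarrow>\<^sub>L 'h)"
proof -
  have "homog c (scalar_tuple \<mu>) k
      = (\<Sum>\<alpha>\<in>words k. c \<alpha> * wsc \<mu> \<alpha>) *\<^sub>C (id_blinfun :: 'h \<Rightarrow>\<^sub>L 'h)" for k
    by (simp add: homog_def word_op_scalar_tuple scaleC_scaleC scaleC_sum_left)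
  then have "homog c (scalar_tuple \<mu>)
      = (\<lambda>k. (\<Sum>\<alpha>\<in>words k. c \<alpha> * wsc \<mu> \<alpha>) *\<^sub>C (id_blinfun :: 'h \<Rightarrow>\<^sub>L 'h))"
    by (rule ext)
  then have "homog c (scalar_tuple \<mu>) sums (sev c \<mu> *\<^sub>C (id_blinfun :: 'h \<Rightarrow>\<^sub>L 'h))"
    by (simp only: bounded_linear.sums[OF bounded_linear_scaleC_left sev_sums[OF assms]])
  then show ?thesis
    unfolding ev_def by (simp add: sums_iff)
qed

lemma cinner_word_op_eigen:
  fixes X :: "('h::chilbert_space \<Rightarrow>\<^sub>L 'h) ^ 'n::finite"
  assumes "\<And>i y. cinner ((X $ i) y) v = \<mu> $ i * cinner y v"
  shows "cinner (word_op X \<alpha> y) v = wsc \<mu> \<alpha> * cinner y v"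
  by (induction \<alpha>) (auto simp: assms)

text \<open>The first hypothesis says that \<open>v\<close> is a joint eigenvector of the adjoints
  of the \<open>X $ i\<close>, with eigenvalues the conjugates of the \<open>\<mu> $ i\<close>.
  Stated through inner products it passes to words, to homogeneous parts and to the limit without
  any computation of adjoints.\<close>

lemma cinner_ev_eigen:
  fixes X :: "('h::chilbert_space \<Rightarrow>\<^sub>L 'h) ^ 'n::finite"
  assumes "\<And>i y. cinner ((X $ i) y) v = \<mu> $ i * cinner y v"
    and c: "hol_coeffs c" and "norm \<mu> < 1" "X \<in> nc_ball"
  shows "cinner (ev c X y) v = sev c \<mu> * cinner y v"
proof -
  have "(\<lambda>k. cinner (homog c X k y) v) sums cinner (ev c X y) v"
    by (intro bounded_linear.sums[OF bounded_linear_cinner_left] ev_apply_sums assms)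
  moreover have "cinner (homog c X k y) v = (\<Sum>\<alpha>\<in>words k. c \<alpha> * wsc \<mu> \<alpha>) * cinner y v" for k
    by (simp add: homog_apply cinner_sum_left cinner_scaleC_left cinner_word_op_eigen[OF assms(1)]
        sum_distrib_right mult.assoc)
  ultimately show ?thesis
    using sums_unique2 sums_mult2[OF sev_sums[OF c \<open>norm \<mu> < 1\<close>], of "cinner y v"] by force
qed

definition lin :: "complex ^ 'n \<Rightarrow> ('h::chilbert_space \<Rightarrow>\<^sub>L 'h) ^ 'n::finite \<Rightarrow> ('h \<Rightarrow>\<^sub>L 'h)" where
  "lin \<nu> X = (\<Sum>i\<in>UNIV. \<nu> $ i *\<^sub>C (X $ i))"

lemma lin_apply: "lin \<nu> X h = (\<Sum>i\<in>UNIV. \<nu> $ i *\<^sub>C (X $ i) h)"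
  by (simp add: lin_def blinfun.sum_left scaleC_blinfun.rep_eq)

lemma lin_bounded_ops: "(\<And>i. X $ i \<in> bounded_ops) \<Longrightarrow> lin \<nu> X \<in> bounded_ops"
  unfolding lin_def by (intro bounded_ops_sum bounded_ops_scaleC)

lemma homog_wsc_Suc:
  assumes "\<And>i. X $ i \<in> bounded_ops"
  shows "homog (wsc \<nu>) X (Suc k) = lin \<nu> X o\<^sub>L homog (wsc \<nu>) X k"
  by (intro blinfun_eqI)
    (simp add: homog_Suc[OF assms] homog_scale lin_apply blinfun.sum_left scaleC_blinfun.rep_eq
      bounded_opsD[OF assms])

lemma homog_wsc_Suc':
  assumes "\<And>i. X $ i \<in> bounded_ops"
  shows "homog (wsc \<nu>) X (Suc k) = homog (wsc \<nu>) X k o\<^sub>L lin \<nu> X"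
proof (induction k)
  case 0
  show ?case unfolding homog_wsc_Suc[OF assms]
    by (intro blinfun_eqI) (simp add: homog_apply scaleC_one)
next
  case (Suc k)
  have "homog (wsc \<nu>) X (Suc (Suc k)) = lin \<nu> X o\<^sub>L (homog (wsc \<nu>) X k o\<^sub>L lin \<nu> X)"
    by (subst homog_wsc_Suc[OF assms]) (simp only: Suc)
  also have "\<dots> = homog (wsc \<nu>) X (Suc k) o\<^sub>L lin \<nu> X"
    by (subst homog_wsc_Suc[OF assms]) (intro blinfun_eqI, simp)
  finally show ?case .
qed

text \<open>Geometric series: passing to the next degree composes with \<open>lin \<nu> X\<close> on
  either side. Together the two equations say that \<open>ev (wsc \<nu>) X\<close> inverts the
  identity minus \<open>lin \<nu> X\<close>.\<close>

lemma resolvent: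
  assumes "norm \<nu> < 1" "X \<in> nc_ball"
  shows resolvent_left: "ev (wsc \<nu>) X h = h + lin \<nu> X (ev (wsc \<nu>) X h)"
    and resolvent_right: "ev (wsc \<nu>) X h = h + ev (wsc \<nu>) X (lin \<nu> X h)"
proof -
  have s: "(\<lambda>k. homog (wsc \<nu>) X k h) sums ev (wsc \<nu>) X h" for h
    by (intro ev_apply_sums hol_coeffs_wsc assms)
  have z: "homog (wsc \<nu>) X 0 h = h" by (simp add: homog_apply scaleC_one)
  have "(\<lambda>k. homog (wsc \<nu>) X (Suc k) h) sums (ev (wsc \<nu>) X h - h)"
    using s[of h] z by (subst sums_Suc_iff) simp
  moreover have "(\<lambda>k. homog (wsc \<nu>) X (Suc k) h) sums lin \<nu> X (ev (wsc \<nu>) X h)"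
    using bounded_linear.sums[OF blinfun.bounded_linear_right s, of "lin \<nu> X" h]
    by (simp add: homog_wsc_Suc[OF nc_ball_ops[OF assms(2)]])
  moreover have "(\<lambda>k. homog (wsc \<nu>) X (Suc k) h) sums ev (wsc \<nu>) X (lin \<nu> X h)"
    using s[of "lin \<nu> X h"] by (simp add: homog_wsc_Suc'[OF nc_ball_ops[OF assms(2)]])
  ultimately show "ev (wsc \<nu>) X h = h + lin \<nu> X (ev (wsc \<nu>) X h)"
    and "ev (wsc \<nu>) X h = h + ev (wsc \<nu>) X (lin \<nu> X h)"
    by (metis add.commute diff_add_cancel sums_unique2)+
qed

definition unit_coeff :: "'n list \<Rightarrow> complex" where
  "unit_coeff \<alpha> = (if \<alpha> = [] then 1 else 0)"

lemma level_unit_coeff: "level unit_coeff k = (if k = 0 then 1 else 0)"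
  by (auto simp: level_def unit_coeff_def L2_set_def words_def finite_words[unfolded words_def] intro!: sum.neutral)

lemma hol_coeffs_unit: "hol_coeffs unit_coeff"
proof (rule hol_coeffs_bounded)
  fix r :: real assume "0 < r" "r < 1"
  then have "r ^ k * level unit_coeff k \<le> 1" for k :: nat
    by (simp add: level_unit_coeff)
  then show "\<exists>C. \<forall>k. r ^ k * level unit_coeff k \<le> C" by blast
qed

lemma ev_unit: "ev unit_coeff X = id_blinfun"
proof -
  have "homog unit_coeff X k = (if k = 0 then id_blinfun else 0)" for k
  proof (cases "k = 0")
    case True
    then show ?thesis by (simp add: homog_def unit_coeff_def scaleC_one)
  next
    case False
    then have "unit_coeff \<alpha> = 0" if "\<alpha> \<in> words k" for \<alpha> using that by (auto simp: unit_coeff_def words_def)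
    then show ?thesis using False by (auto simp: homog_def intro!: sum.neutral)
  qed
  then have "homog unit_coeff X = (\<lambda>k. if k = 0 then id_blinfun else 0)" by (rule ext)
  then show ?thesis unfolding ev_def using sums_single[of 0 "\<lambda>_. id_blinfun"] by (simp add: sums_iff)
qed

lemma hol_coeffs_zero: "hol_coeffs (\<lambda>_. 0)"
  using hol_coeffs_scale[OF hol_coeffs_unit, of 0] by simp

lemma ev_zero: "ev (\<lambda>_. 0) X = 0"
  by (simp add: ev_def homog_def)

lemma hol_coeffs_sum:
  assumes "\<And>j. j \<in> A \<Longrightarrow> hol_coeffs (f j)"
  shows "hol_coeffs (\<lambda>\<alpha>. \<Sum>j\<in>A. f j \<alpha>)"
  using assms by (induction A rule: infinite_finite_induct) (auto intro: hol_coeffs_add hol_coeffs_zero)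

lemma ev_sum:
  assumes "X \<in> nc_ball" "\<And>j. j \<in> A \<Longrightarrow> hol_coeffs (f j)"
  shows "ev (\<lambda>\<alpha>. \<Sum>j\<in>A. f j \<alpha>) X = (\<Sum>j\<in>A. ev (f j) X)"
  using assms(2)
  by (induction A rule: infinite_finite_induct) (simp_all add: ev_zero ev_add[OF _ hol_coeffs_sum assms(1)])

section \<open>Composition\<close>

definition self_map_coeffs ::
  "(('h::chilbert_space \<Rightarrow>\<^sub>L 'h) ^ 'n::finite \<Rightarrow> ('h \<Rightarrow>\<^sub>L 'h) ^ 'n) \<Rightarrow> ('n \<Rightarrow> 'n list \<Rightarrow> complex) \<Rightarrow> bool"
  where "self_map_coeffs \<phi> c \<longleftrightarrow> (\<forall>i. hol_coeffs (c i)) \<and>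
    (\<forall>X\<in>nc_ball. \<phi> X \<in> nc_ball \<and> (\<forall>i. \<phi> X $ i = ev (c i) X))"

lemma self_map_iff: "free_holomorphic_self_map \<phi> \<longleftrightarrow> (\<exists>c. self_map_coeffs \<phi> c)"
proof
  assume "free_holomorphic_self_map \<phi>"
  then have "\<forall>i. \<exists>a. has_coeffs (\<lambda>X. \<phi> X $ i) a" and *: "\<forall>X\<in>nc_ball. \<phi> X \<in> nc_ball"
    by (auto simp: free_holomorphic_self_map_def free_holomorphic_def)
  then obtain c where "\<And>i. has_coeffs (\<lambda>X. \<phi> X $ i) (c i)" by metis
  with * show "\<exists>c. self_map_coeffs \<phi> c"
    unfolding self_map_coeffs_def has_coeffs_iff by blast
next
  assume "\<exists>c. self_map_coeffs \<phi> c"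
  then show "free_holomorphic_self_map \<phi>"
    unfolding free_holomorphic_self_map_def free_holomorphic_def has_coeffs_iff self_map_coeffs_def
    by metis
qed

fun word_coeff :: "('n \<Rightarrow> 'n list \<Rightarrow> complex) \<Rightarrow> 'n list \<Rightarrow> 'n list \<Rightarrow> complex" where
  "word_coeff c [] = unit_coeff"
| "word_coeff c (i # \<alpha>) = conv (c i) (word_coeff c \<alpha>)"

definition comp_part :: "('n::finite \<Rightarrow> 'n list \<Rightarrow> complex) \<Rightarrow> ('n list \<Rightarrow> complex) \<Rightarrow> nat \<Rightarrow> 'n list \<Rightarrow> complex"
  where "comp_part c a k \<beta> = (\<Sum>\<alpha>\<in>words k. a \<alpha> * word_coeff c \<alpha> \<beta>)"

text \<open>An infinite series in general: if the inner map does not vanish at 0, words of every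
  length \<open>k\<close> of the outer series contribute to a given coefficient.\<close>

definition comp_coeff :: "('n::finite \<Rightarrow> 'n list \<Rightarrow> complex) \<Rightarrow> ('n list \<Rightarrow> complex) \<Rightarrow> 'n list \<Rightarrow> complex"
  where "comp_coeff c a \<beta> = (\<Sum>k. comp_part c a k \<beta>)"

context fock
begin

lemma word_coeff:
  assumes "self_map_coeffs \<phi> c"
  shows hol_coeffs_word_coeff: "hol_coeffs (word_coeff c \<alpha>)"
    and ev_word_coeff: "(X :: ('h \<Rightarrow>\<^sub>L 'h) ^ 'n) \<in> nc_ball \<Longrightarrow> ev (word_coeff c \<alpha>) X = word_op (\<phi> X) \<alpha>"
proof (induction \<alpha>)
  case Nil
  { case 1 show ?case by (simp add: hol_coeffs_unit) }
  { case 2 show ?case by (simp add: ev_unit) }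
next
  case (Cons i \<alpha>)
  have c: "hol_coeffs (c i)" using assms by (simp add: self_map_coeffs_def)
  { case 1 show ?case using Cons c by (simp add: hol_coeffs_conv) }
  { case 2 then show ?case using Cons c assms by (simp add: ev_conv self_map_coeffs_def) }
qed

lemma comp_part:
  fixes \<phi> :: "('h \<Rightarrow>\<^sub>L 'h) ^ 'n \<Rightarrow> ('h \<Rightarrow>\<^sub>L 'h) ^ 'n"
  assumes "self_map_coeffs \<phi> c"
  shows hol_coeffs_comp_part: "hol_coeffs (comp_part c a k)"
    and ev_comp_part: "X \<in> nc_ball \<Longrightarrow> ev (comp_part c a k) X = homog a (\<phi> X) k"
proof -
  have eq: "comp_part c a k = (\<lambda>\<beta>. \<Sum>\<alpha>\<in>words k. a \<alpha> * word_coeff c \<alpha> \<beta>)"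
    by (simp add: comp_part_def[abs_def])
  show "hol_coeffs (comp_part c a k)" unfolding eq
    by (intro hol_coeffs_sum hol_coeffs_scale hol_coeffs_word_coeff[OF assms])
  assume X: "X \<in> nc_ball"
  have "ev (comp_part c a k) X = (\<Sum>\<alpha>\<in>words k. ev (\<lambda>\<beta>. a \<alpha> * word_coeff c \<alpha> \<beta>) X)"
    unfolding eq using X by (intro ev_sum hol_coeffs_scale hol_coeffs_word_coeff[OF assms])
  then show "ev (comp_part c a k) X = homog a (\<phi> X) k"
    using X by (simp add: homog_def ev_scale[OF hol_coeffs_word_coeff[OF assms]] ev_word_coeff[OF assms])
qed

text \<open>A Cauchy estimate, with Bessel's inequality on the words of length \<open>m\<close> in
  place of an integral formula.\<close>

lemma level_le_ev_shifts:
  assumes "hol_coeffs a" "0 \<le> r" "r < 1"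
  shows "r ^ m * level a m \<le> norm (ev a (shifts r) (e []))"
proof (rule power2_le_imp_le)
  have "(r ^ m * level a m)\<^sup>2 = (\<Sum>\<alpha>\<in>words m. (cmod (of_real (r ^ m) * a \<alpha>))\<^sup>2)"
    using assms(2) by (simp add: power_mult_distrib level_sq sum_distrib_left norm_mult norm_power)
  also have "\<dots> = (\<Sum>\<alpha>\<in>words m. (cmod (cinner (ev a (shifts r) (e [])) (e \<alpha>)))\<^sup>2)"
    by (intro sum.cong) (auto simp: cinner_ev_shifts[OF assms] words_def)
  also have "\<dots> \<le> (norm (ev a (shifts r) (e [])))\<^sup>2"
    by (rule bessel[OF orthonormal_e finite_words])
  finally show "(r ^ m * level a m)\<^sup>2 \<le> (norm (ev a (shifts r) (e [])))\<^sup>2" .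
qed simp

text \<open>Cauchy estimates at \<open>shifts r\<close> involve only the size of
  \<open>\<phi> (shifts r)\<close>, which has a row bound \<rho> < 1. Hence
  \<open>\<rho> ^ k * level a k\<close> bounds the part coming from degree \<open>k\<close>
  uniformly in the output degree \<open>m\<close>.\<close>

lemma comp_part_bound:
  fixes \<phi> :: "('h \<Rightarrow>\<^sub>L 'h) ^ 'n \<Rightarrow> ('h \<Rightarrow>\<^sub>L 'h) ^ 'n"
  assumes \<phi>: "self_map_coeffs \<phi> c" and a: "hol_coeffs a" and r: "0 < r" "r < 1"
  obtains B where "summable B" "\<And>k. 0 \<le> B k" "\<And>m k. r ^ m * level (comp_part c a k) m \<le> B k"
proof -
  have X: "shifts r \<in> nc_ball" using r by (simp add: shifts_nc_ball)
  then have Y: "\<phi> (shifts r) \<in> nc_ball" using \<phi> by (simp add: self_map_coeffs_def)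
  then obtain \<rho> where \<rho>: "0 \<le> \<rho>" "\<rho> < 1" "row_bound (\<phi> (shifts r)) \<rho>" by (rule nc_ball_row_bound)
  show thesis
  proof (rule that[of "\<lambda>k. \<rho> ^ k * level a k"])
    show "summable (\<lambda>k. \<rho> ^ k * level a k)" using a \<rho> by (simp add: hol_coeffs_def)
    fix k m
    show "0 \<le> \<rho> ^ k * level a k" using \<rho> by simp
    have "r ^ m * level (comp_part c a k) m \<le> norm (ev (comp_part c a k) (shifts r) (e []))"
      using r by (intro level_le_ev_shifts hol_coeffs_comp_part[OF \<phi>]) auto
    also have "\<dots> \<le> norm (homog a (\<phi> (shifts r)) k)"
      using norm_blinfun[of "homog a (\<phi> (shifts r)) k" "e []"] by (simp add: ev_comp_part[OF \<phi> X])
    also have "\<dots> \<le> \<rho> ^ k * level a k"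
      by (rule norm_homog_le[OF nc_ball_ops[OF Y] \<rho>(3,1)])
    finally show "r ^ m * level (comp_part c a k) m \<le> \<rho> ^ k * level a k" .
  qed
qed

lemma comp_coeff_sums:
  fixes \<phi> :: "('h \<Rightarrow>\<^sub>L 'h) ^ 'n \<Rightarrow> ('h \<Rightarrow>\<^sub>L 'h) ^ 'n"
  assumes "self_map_coeffs \<phi> c" "hol_coeffs a"
  shows "(\<lambda>k. comp_part c a k \<beta>) sums comp_coeff c a \<beta>"
proof -
  obtain B where B: "summable B" "\<And>k. 0 \<le> B k" "\<And>m k. (1/2) ^ m * level (comp_part c a k) m \<le> B k"
  proof (rule comp_part_bound[OF assms])
    show "0 < (1/2::real)" "(1/2::real) < 1" by simp_all
  qed (rule that)
  have "norm (comp_part c a k \<beta>) \<le> 2 ^ length \<beta> * B k" for k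
    using norm_le_level[of "comp_part c a k" \<beta>] B(3)[of "length \<beta>" k] by (simp add: field_simps)
  then show ?thesis
    unfolding comp_coeff_def
    by (intro summable_sums summable_comparison_test'[OF summable_mult[OF B(1), of "2 ^ length \<beta>"]])
qed

lemma hol_coeffs_comp:
  fixes \<phi> :: "('h \<Rightarrow>\<^sub>L 'h) ^ 'n \<Rightarrow> ('h \<Rightarrow>\<^sub>L 'h) ^ 'n"
  assumes "self_map_coeffs \<phi> c" "hol_coeffs a"
  shows "hol_coeffs (comp_coeff c a)"
proof (rule hol_coeffs_bounded)
  fix r :: real assume r: "0 < r" "r < 1"
  obtain B where B: "summable B" "\<And>k. 0 \<le> B k" "\<And>m k. r ^ m * level (comp_part c a k) m \<le> B k"
    using comp_part_bound[OF assms r] by blast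
  have "r ^ m * level (comp_coeff c a) m \<le> suminf B" for m
  proof -
    have lev: "r ^ m * level (\<lambda>\<beta>. \<Sum>k<K. comp_part c a k \<beta>) m \<le> (\<Sum>k<K. B k)" for K
    proof (induction K)
      case 0
      then show ?case by (simp add: level_def L2_set_def)
    next
      case (Suc K)
      have "r ^ m * level (\<lambda>\<beta>. \<Sum>k<Suc K. comp_part c a k \<beta>) m
          \<le> r ^ m * (level (\<lambda>\<beta>. \<Sum>k<K. comp_part c a k \<beta>) m + level (comp_part c a K) m)"
        using r by (intro mult_left_mono) (auto simp: level_add_le)
      then show ?case using Suc B(3)[of m K] by (simp add: distrib_left)
    qed
    have "(\<lambda>K. r ^ m * level (\<lambda>\<beta>. \<Sum>k<K. comp_part c a k \<beta>) m) \<longlonglongrightarrow> r ^ m * level (comp_coeff c a) m"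
      unfolding level_def L2_set_def
      by (intro tendsto_intros comp_coeff_sums[OF assms, unfolded sums_def])
    then show ?thesis
    proof (rule LIMSEQ_le_const2, intro exI allI impI)
      fix K
      show "r ^ m * level (\<lambda>\<beta>. \<Sum>k<K. comp_part c a k \<beta>) m \<le> suminf B"
        using lev[of K] sum_le_suminf[OF B(1), of "{..<K}"] B(2) by force
    qed
  qed
  then show "\<exists>C. \<forall>k. r ^ k * level (comp_coeff c a) k \<le> C" by blast
qed

lemma ev_comp:
  fixes \<phi> :: "('h \<Rightarrow>\<^sub>L 'h) ^ 'n \<Rightarrow> ('h \<Rightarrow>\<^sub>L 'h) ^ 'n"
  assumes \<phi>: "self_map_coeffs \<phi> c" and a: "hol_coeffs a" and X: "X \<in> nc_ball"
  shows "ev (comp_coeff c a) X = ev a (\<phi> X)"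
proof -
  obtain \<rho> where \<rho>: "0 \<le> \<rho>" "\<rho> < 1" "row_bound X \<rho>" using X by (rule nc_ball_row_bound)
  \<comment> \<open>A radius strictly between the row bound of \<open>X\<close> and 1: the surplus
    provides the geometric factor \<open>(\<rho> / r) ^ m\<close>, so the double series is dominated
    by a product.\<close>
  obtain r where r: "\<rho> < r" "r < 1" using \<rho> dense by blast
  with \<rho> have "0 < r" by simp
  obtain B where B: "summable B" "\<And>k. 0 \<le> B k" "\<And>m k. r ^ m * level (comp_part c a k) m \<le> B k"
    using comp_part_bound[OF \<phi> a \<open>0 < r\<close> \<open>r < 1\<close>] by blast
  define F where "F m k = homog (comp_part c a k) X m" for m k
  have F: "norm (F m k) \<le> (\<rho> / r) ^ m * B k" for m k
  proof -
    have "norm (F m k) \<le> \<rho> ^ m * level (comp_part c a k) m"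
      unfolding F_def by (rule norm_homog_le[OF nc_ball_ops[OF X] \<rho>(3,1)])
    also have "\<dots> = (\<rho> / r) ^ m * (r ^ m * level (comp_part c a k) m)"
      using \<open>0 < r\<close> by (simp add: power_divide)
    also have "\<dots> \<le> (\<rho> / r) ^ m * B k"
      using \<rho> \<open>0 < r\<close> by (intro mult_left_mono B) auto
    finally show ?thesis .
  qed
  have g: "summable (\<lambda>m. (\<rho> / r) ^ m)" "\<And>m. 0 \<le> (\<rho> / r) ^ m"
    using \<rho> r \<open>0 < r\<close> by (auto intro!: summable_geometric)
  have "(\<lambda>m. \<Sum>k. F m k) sums (\<Sum>m. \<Sum>k. F m k)"
    by (rule sums_rows[OF F g B(1,2)])
  moreover have "(\<Sum>k. F m k) = homog (comp_coeff c a) X m" for m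
  proof -
    have "(\<lambda>k. \<Sum>\<beta>\<in>words m. comp_part c a k \<beta> *\<^sub>C word_op X \<beta>) sums homog (comp_coeff c a) X m"
      unfolding homog_def
      by (intro sums_sum bounded_linear.sums[OF bounded_linear_scaleC_left] comp_coeff_sums[OF \<phi> a])
    then show ?thesis by (simp add: F_def homog_def sums_iff)
  qed
  moreover have "(\<lambda>k. \<Sum>m. F m k) sums (\<Sum>m. \<Sum>k. F m k)"
    by (rule sums_columns[OF F g B(1,2)])
  moreover have "(\<Sum>m. F m k) = homog a (\<phi> X) k" for k
    using ev_comp_part[OF \<phi> X, of a k] by (simp add: F_def ev_def)
  ultimately show ?thesis
    unfolding ev_def by (simp add: sums_iff)
qed

end

lemma norm_add_sq: "(norm (x + y :: 'a::complex_inner))\<^sup>2 = (norm x)\<^sup>2 + 2 * Re (cinner x y) + (norm y)\<^sup>2"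
  by (simp add: power2_norm_eq_inner inner_simps inner_commute flip: inner_eq_Re_cinner)

lemma norm_diff_sq: "(norm (x - y :: 'a::complex_inner))\<^sup>2 = (norm x)\<^sup>2 - 2 * Re (cinner x y) + (norm y)\<^sup>2"
  using norm_add_sq[of x "- y"] by simp

section \<open>Row contractions with a wandering vector\<close>

lemma level_Suc_sq: "(level a (Suc k))\<^sup>2 = (\<Sum>i\<in>UNIV. (level (\<lambda>\<alpha>. a (i # \<alpha>)) k)\<^sup>2)"
  by (simp add: level_sq sum_words_Suc)

text \<open>Splitting off the first letter writes the vector as \<open>a [] *\<^sub>C v + w\<close>
  with \<open>w\<close> in the sum of the ranges of the \<open>Z $ i\<close>, hence orthogonal to
  \<open>v\<close>. Pythagoras treats the first term; row contractivity and the induction hypothesis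
  for the translated coefficients treat \<open>w\<close>. The vector \<open>v\<close> stays the same
  throughout.\<close>

lemma wandering_bound:
  fixes Z :: "('h::chilbert_space \<Rightarrow>\<^sub>L 'h) ^ 'n::finite"
  assumes Z: "\<And>i. Z $ i \<in> bounded_ops" "row_bound Z 1"
    and v: "\<And>i y. cinner ((Z $ i) y) v = 0"
  shows "(norm (\<Sum>k<K. homog a Z k v))\<^sup>2 \<le> (\<Sum>k<K. (level a k)\<^sup>2) * (norm v)\<^sup>2"
proof (induction K arbitrary: a)
  case (Suc K)
  define y where "y i = (\<Sum>k<K. homog (\<lambda>\<alpha>. a (i # \<alpha>)) Z k v)" for i
  define w where "w = (\<Sum>i\<in>UNIV. (Z $ i) (y i))"
  have "(\<Sum>k<K. homog a Z (Suc k) v) = w"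
    by (simp add: homog_Suc[OF Z(1)] w_def y_def blinfun.sum_left blinfun.sum_right, rule sum.swap)
  then have "(\<Sum>k<Suc K. homog a Z k v) = a [] *\<^sub>C v + w"
    by (simp add: sum.lessThan_Suc_shift homog_apply[of a Z 0] del: sum.lessThan_Suc)
  moreover have "cinner w v = 0" by (simp add: w_def cinner_sum_left v)
  then have "cinner v w = 0" "cinner w v = 0" by (metis cinner_commute complex_cnj_zero)+
  ultimately have "(norm (\<Sum>k<Suc K. homog a Z k v))\<^sup>2 = (cmod (a []))\<^sup>2 * (norm v)\<^sup>2 + (norm w)\<^sup>2"
    by (simp only: norm_add_sq cinner_scaleC_left norm_scaleC power_mult_distrib) simp
  also have "(norm w)\<^sup>2 \<le> (\<Sum>i\<in>UNIV. (norm (y i))\<^sup>2)"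
    using row_boundD[OF Z(2), of y] by (simp add: w_def)
  also have "\<dots> \<le> (\<Sum>i\<in>UNIV. (\<Sum>k<K. (level (\<lambda>\<alpha>. a (i # \<alpha>)) k)\<^sup>2) * (norm v)\<^sup>2)"
    unfolding y_def by (intro sum_mono Suc.IH)
  also have "\<dots> = (\<Sum>k<K. (level a (Suc k))\<^sup>2) * (norm v)\<^sup>2"
    unfolding level_Suc_sq sum_distrib_right[symmetric] by (subst sum.swap) simp
  also have "(cmod (a []))\<^sup>2 * (norm v)\<^sup>2 + \<dots> = (\<Sum>k<Suc K. (level a k)\<^sup>2) * (norm v)\<^sup>2"
    by (simp add: sum.lessThan_Suc_shift level_sq[of a 0] distrib_right del: sum.lessThan_Suc)
  finally show ?case by simp
qed simp

lemma level_sum_le: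
  assumes "l2_le a C"
  shows "(\<Sum>k<K. (level a k)\<^sup>2) \<le> C"
  unfolding level_sq sum_words_less using assms by (rule l2_leD) simp

lemma l2_le_hol_coeffs:
  assumes "l2_le a C"
  shows "hol_coeffs a"
proof (rule hol_coeffs_bounded)
  fix r :: real assume r: "0 < r" "r < 1"
  have "r ^ k * level a k \<le> sqrt C" for k
  proof -
    have "(level a k)\<^sup>2 \<le> C" unfolding level_sq using assms by (rule l2_leD) simp
    then have "level a k \<le> sqrt C" by (simp add: real_le_rsqrt)
    moreover have "r ^ k * level a k \<le> 1 * level a k" using r by (intro mult_right_mono power_le_one) auto
    ultimately show ?thesis by simp
  qed
  then show "\<exists>C. \<forall>k. r ^ k * level a k \<le> C" by blast
qed

lemma wandering_ev_bound:
  fixes Z :: "('h::chilbert_space \<Rightarrow>\<^sub>L 'h) ^ 'n::finite"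
  assumes Z: "Z \<in> nc_ball" and v: "\<And>i y. cinner ((Z $ i) y) v = 0" and a: "l2_le a C"
  shows "(norm (ev a Z v))\<^sup>2 \<le> C * (norm v)\<^sup>2"
proof -
  obtain \<rho> where \<rho>: "0 \<le> \<rho>" "\<rho> < 1" "row_bound Z \<rho>" using Z by (rule nc_ball_row_bound)
  have "row_bound Z 1"
    unfolding row_bound_def
  proof
    fix y :: "'n \<Rightarrow> 'h"
    have "\<rho>\<^sup>2 * (\<Sum>i\<in>UNIV. (norm (y i))\<^sup>2) \<le> 1\<^sup>2 * (\<Sum>i\<in>UNIV. (norm (y i))\<^sup>2)"
      using \<rho> by (intro mult_right_mono power_mono sum_nonneg) auto
    then show "(norm (\<Sum>i\<in>UNIV. (Z $ i) (y i)))\<^sup>2 \<le> 1\<^sup>2 * (\<Sum>i\<in>UNIV. (norm (y i))\<^sup>2)"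
      using row_boundD[OF \<rho>(3), of y] by linarith
  qed
  have "(\<lambda>K. (norm (\<Sum>k<K. homog a Z k v))\<^sup>2) \<longlonglongrightarrow> (norm (ev a Z v))\<^sup>2"
    using ev_apply_sums[OF l2_le_hol_coeffs[OF a] Z, of v] unfolding sums_def by (intro tendsto_intros)
  moreover have "(norm (\<Sum>k<K. homog a Z k v))\<^sup>2 \<le> C * (norm v)\<^sup>2" for K
    using wandering_bound[OF nc_ball_ops[OF Z] \<open>row_bound Z 1\<close> v, where K = K and a = a]
      mult_right_mono[OF level_sum_le[OF a, of K], of "(norm v)\<^sup>2"] by simp
  ultimately show ?thesis by (intro LIMSEQ_le_const2) auto
qed

section \<open>Involutive automorphisms of the noncommutative ball\<close>

definition vcnj :: "complex ^ 'n::finite \<Rightarrow> complex ^ 'n" where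
  "vcnj \<mu> = (\<chi> i. cnj (\<mu> $ i))"

lemma vcnj_nth [simp]: "vcnj \<mu> $ i = cnj (\<mu> $ i)"
  by (simp add: vcnj_def)

lemma norm_vcnj [simp]: "norm (vcnj \<mu>) = norm \<mu>"
  by (simp add: norm_vec_def)

definition var_coeff :: "'n \<Rightarrow> 'n list \<Rightarrow> complex" where
  "var_coeff j \<alpha> = (if \<alpha> = [j] then 1 else 0)"

lemma homog_var:
  fixes X :: "('h::chilbert_space \<Rightarrow>\<^sub>L 'h) ^ 'n::finite"
  shows "homog (var_coeff j) X = (\<lambda>k. if k = 1 then X $ j else 0)"
proof
  fix k
  show "homog (var_coeff j) X k = (if k = 1 then X $ j else 0)"
  proof (cases "k = 1")
    case True
    have "homog (var_coeff j) X (Suc 0) = (\<Sum>i\<in>UNIV. if i = j then X $ i else 0)"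
      unfolding homog_def sum_words_Suc
      by (intro sum.cong) (auto simp: var_coeff_def scaleC_one intro!: blinfun_eqI)
    with True show ?thesis by simp
  next
    case False
    then have "var_coeff j \<alpha> = 0" if "\<alpha> \<in> words k" for \<alpha> using that by (auto simp: var_coeff_def words_def)
    then show ?thesis using False by (auto simp: homog_def intro!: sum.neutral)
  qed
qed

lemma hol_coeffs_var: "hol_coeffs (var_coeff j)"
proof (rule l2_le_hol_coeffs)
  show "l2_le (var_coeff j) 1"
    unfolding l2_le_def
  proof (intro allI impI)
    fix F :: "'a list set" assume "finite F"
    then have "(\<Sum>\<alpha>\<in>F. (cmod (var_coeff j \<alpha>))\<^sup>2) = (\<Sum>\<alpha>\<in>F. if \<alpha> = [j] then 1 else 0)"
      by (intro sum.cong) (auto simp: var_coeff_def)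
    with \<open>finite F\<close> show "(\<Sum>\<alpha>\<in>F. (cmod (var_coeff j \<alpha>))\<^sup>2) \<le> 1" by simp
  qed
qed

lemma ev_var:
  fixes X :: "('h::chilbert_space \<Rightarrow>\<^sub>L 'h) ^ 'n::finite"
  shows "ev (var_coeff j) X = X $ j"
  unfolding ev_def homog_var using sums_single[of 1 "\<lambda>_. X $ j"] by (simp add: sums_iff)

definition defect :: "complex ^ 'n::finite \<Rightarrow> real" where
  "defect \<mu> = sqrt (1 - (norm \<mu>)\<^sup>2)"

lemma defect:
  assumes "norm \<mu> < 1"
  shows "0 < defect \<mu>" "(defect \<mu>)\<^sup>2 = 1 - (norm \<mu>)\<^sup>2"
  using assms by (auto simp: defect_def power_less_one_iff abs_square_less_1 less_imp_le)

text \<open>The coefficients of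
  \<open>(I - \<Sum>\<^sub>j cnj \<mu>\<^sub>j X\<^sub>j)\<^sup>-\<^sup>1 (\<mu>\<^sub>i - s X\<^sub>i - \<mu>\<^sub>i (\<Sum>\<^sub>j cnj \<mu>\<^sub>j X\<^sub>j) / (1 + s))\<close> with \<open>s\<^sup>2 = 1 - |\<mu>|\<^sup>2\<close>.
  This is the usual \<open>\<mu> - \<Delta>\<^sub>\<mu> (I - X \<mu>\<^sup>*)\<^sup>-\<^sup>1 X \<Delta>\<^bsub>\<mu>*\<^esub>\<close>, with the square root of the
  rank one perturbation \<open>I - \<mu>\<^sup>* \<mu>\<close> written out.\<close>

definition aut_num :: "complex ^ 'n::finite \<Rightarrow> 'n \<Rightarrow> 'n list \<Rightarrow> complex" where
  "aut_num \<mu> i = (\<lambda>\<alpha>. \<mu> $ i * unit_coeff \<alpha> + (- complex_of_real (defect \<mu>) * var_coeff i \<alpha>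
     + (- (\<mu> $ i / (1 + of_real (defect \<mu>)))) * (\<Sum>j\<in>UNIV. vcnj \<mu> $ j * var_coeff j \<alpha>)))"

definition aut_coeff :: "complex ^ 'n::finite \<Rightarrow> 'n \<Rightarrow> 'n list \<Rightarrow> complex" where
  "aut_coeff \<mu> i = conv (wsc (vcnj \<mu>)) (aut_num \<mu> i)"

definition aut :: "complex ^ 'n::finite \<Rightarrow> ('h::chilbert_space \<Rightarrow>\<^sub>L 'h) ^ 'n \<Rightarrow> ('h \<Rightarrow>\<^sub>L 'h) ^ 'n" where
  "aut \<mu> X = (\<chi> i. ev (aut_coeff \<mu> i) X)"

lemma hol_coeffs_aut_num: "hol_coeffs (aut_num \<mu> i)"
  unfolding aut_num_def
  by (intro hol_coeffs_add hol_coeffs_scale hol_coeffs_sum hol_coeffs_unit hol_coeffs_var)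

lemma ev_aut_num:
  assumes "X \<in> nc_ball"
  shows "ev (aut_num \<mu> i) X h = \<mu> $ i *\<^sub>C h - complex_of_real (defect \<mu>) *\<^sub>C (X $ i) h
    - (\<mu> $ i / (1 + of_real (defect \<mu>))) *\<^sub>C lin (vcnj \<mu>) X h"
proof -
  have "ev (\<lambda>\<alpha>. \<Sum>j\<in>UNIV. vcnj \<mu> $ j * var_coeff j \<alpha>) X = lin (vcnj \<mu>) X"
    using assms by (subst ev_sum) (simp_all only: hol_coeffs_scale hol_coeffs_var ev_scale ev_var lin_def)
  moreover have "hol_coeffs (\<lambda>\<alpha>. \<Sum>j\<in>UNIV. vcnj \<mu> $ j * var_coeff j \<alpha>)"
    by (intro hol_coeffs_sum hol_coeffs_scale hol_coeffs_var)
  ultimately show ?thesis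
    using assms unfolding aut_num_def
    by (simp only: ev_add ev_scale ev_unit ev_var hol_coeffs_add hol_coeffs_scale hol_coeffs_unit
        hol_coeffs_var)
      (simp add: blinfun.add_left blinfun.diff_left blinfun.minus_left scaleC_blinfun.rep_eq)
qed

lemma aut_apply:
  assumes "norm \<mu> < 1" "X \<in> nc_ball"
  shows "(aut \<mu> X $ i) h = ev (wsc (vcnj \<mu>)) X (\<mu> $ i *\<^sub>C h - complex_of_real (defect \<mu>) *\<^sub>C (X $ i) h
    - (\<mu> $ i / (1 + of_real (defect \<mu>))) *\<^sub>C lin (vcnj \<mu>) X h)"
  using assms
  by (simp add: aut_def aut_coeff_def ev_conv hol_coeffs_wsc hol_coeffs_aut_num ev_aut_num del: vcnj_nth)

text \<open>To be read with \<open>v\<close> the adjoint resolvent applied to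
  \<open>h = v - w\<close>, and \<open>x i\<close> the adjoint of \<open>X $ i\<close> applied to
  \<open>v\<close>. The summands on the left are then the adjoint components of the automorphism at
  \<open>h\<close>, and the identity factors the defect of the automorphism through the defect of
  \<open>X\<close>.\<close>

lemma aut_defect_identity:
  fixes v :: "'h::complex_inner" and x :: "'n::finite \<Rightarrow> 'h"
  assumes s: "s > 0" "s\<^sup>2 = 1 - (norm \<mu>)\<^sup>2" and w: "w = (\<Sum>i\<in>UNIV. \<mu> $ i *\<^sub>C x i)"
  shows "(\<Sum>i\<in>UNIV. (norm (cnj (\<mu> $ i) *\<^sub>C v - complex_of_real s *\<^sub>C x i
      - cnj (\<mu> $ i / (1 + of_real s)) *\<^sub>C w))\<^sup>2)
    = (norm (v - w))\<^sup>2 - s\<^sup>2 * ((norm v)\<^sup>2 - (\<Sum>i\<in>UNIV. (norm (x i))\<^sup>2))"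
proof -
  \<comment> \<open>Absorbs the correction by \<open>w\<close>, so that each summand becomes a
    difference of only two vectors.\<close>
  define z where "z = v - complex_of_real (1 / (1 + s)) *\<^sub>C w"
  have "cnj (\<mu> $ i) *\<^sub>C v - complex_of_real s *\<^sub>C x i - cnj (\<mu> $ i / (1 + of_real s)) *\<^sub>C w
      = cnj (\<mu> $ i) *\<^sub>C z - complex_of_real s *\<^sub>C x i" for i
    by (simp add: z_def scaleC_diff_right scaleC_scaleC algebra_simps)
  then have "(\<Sum>i\<in>UNIV. (norm (cnj (\<mu> $ i) *\<^sub>C v - complex_of_real s *\<^sub>C x i
        - cnj (\<mu> $ i / (1 + of_real s)) *\<^sub>C w))\<^sup>2)
      = (\<Sum>i\<in>UNIV. (cmod (\<mu> $ i))\<^sup>2 * (norm z)\<^sup>2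
          - 2 * s * Re (cnj (\<mu> $ i) * cinner z (x i)) + s\<^sup>2 * (norm (x i))\<^sup>2)"
    by (simp only: norm_diff_sq norm_scaleC power_mult_distrib cinner_scaleC_left cinner_scaleC_right)
      (simp add: algebra_simps)
  also have "\<dots> = (norm \<mu>)\<^sup>2 * (norm z)\<^sup>2 - 2 * s * Re (\<Sum>i\<in>UNIV. cnj (\<mu> $ i) * cinner z (x i))
      + s\<^sup>2 * (\<Sum>i\<in>UNIV. (norm (x i))\<^sup>2)"
    by (simp only: sum.distrib sum_subtractf sum_distrib_left sum_distrib_right norm_vec_sq Re_sum)
  also have "(\<Sum>i\<in>UNIV. cnj (\<mu> $ i) * cinner z (x i)) = cinner z w"
    by (simp add: w cinner_sum_right cinner_scaleC_right)
  finally have *: "(\<Sum>i\<in>UNIV. (norm (cnj (\<mu> $ i) *\<^sub>C v - complex_of_real s *\<^sub>C x i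
        - cnj (\<mu> $ i / (1 + of_real s)) *\<^sub>C w))\<^sup>2)
      = (1 - s\<^sup>2) * (norm z)\<^sup>2 - 2 * s * Re (cinner z w) + s\<^sup>2 * (\<Sum>i\<in>UNIV. (norm (x i))\<^sup>2)"
    using s(2) by simp
  define p where "p = Re (cinner v w)"
  define q where "q = (norm w)\<^sup>2"
  \<comment> \<open>Kept as a variable subject to \<open>t * (1 + s) = 1\<close>, which makes the
    remaining computation polynomial.\<close>
  define t where "t = 1 / (1 + s)"
  have t: "t * (1 + s) = 1" using s(1) by (simp add: t_def)
  have zt: "z = v - complex_of_real t *\<^sub>C w" by (simp only: z_def t_def)
  have z1: "(norm z)\<^sup>2 = (norm v)\<^sup>2 - 2 * t * p + t\<^sup>2 * q"
    by (simp add: zt norm_diff_sq norm_scaleC power_mult_distrib cinner_simps p_def q_def)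
  have z2: "Re (cinner z w) = p - t * q"
    by (simp add: zt cinner_simps cinner_self p_def q_def)
  have z3: "(norm (v - w))\<^sup>2 = (norm v)\<^sup>2 - 2 * p + q"
    by (simp add: norm_diff_sq p_def q_def)
  have "(1 - s\<^sup>2) * (norm z)\<^sup>2 - 2 * s * Re (cinner z w)
      = (1 - s\<^sup>2) * (norm v)\<^sup>2 - 2 * ((1 - s) * (t * (1 + s)) + s) * p
        + ((1 - s) * (t * (1 + s)) * t + 2 * s * t) * q"
    unfolding z1 z2 by (simp add: algebra_simps power2_eq_square)
  also have "(1 - s) * (t * (1 + s)) * t + 2 * s * t = t * (1 + s)"
    by (simp only: t) (use t in \<open>simp add: algebra_simps\<close>)
  also have "(1 - s\<^sup>2) * (norm v)\<^sup>2 - 2 * ((1 - s) * (t * (1 + s)) + s) * p + (t * (1 + s)) * q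
      = (norm (v - w))\<^sup>2 - s\<^sup>2 * (norm v)\<^sup>2"
    unfolding t z3 by (simp add: algebra_simps)
  finally show ?thesis unfolding * by (simp add: algebra_simps)
qed

lemma aut_nc_ball:
  fixes X :: "('h::chilbert_space \<Rightarrow>\<^sub>L 'h) ^ 'n::finite"
  assumes \<mu>: "norm \<mu> < 1" and X: "X \<in> nc_ball"
  shows "aut \<mu> X \<in> nc_ball"
proof -
  define s where "s = defect \<mu>"
  note s = defect[OF \<mu>, folded s_def]
  obtain \<rho> where \<rho>: "0 \<le> \<rho>" "\<rho> < 1" "row_bound X \<rho>" using X by (rule nc_ball_row_bound)
  note Xops = nc_ball_ops[OF X]
  define R where "R = ev (wsc (vcnj \<mu>)) X"
  have R: "R \<in> bounded_ops"
    unfolding R_def by (intro ev_bounded_ops hol_coeffs_wsc X) (simp add: \<mu>)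
  have ops: "aut \<mu> X $ i \<in> bounded_ops" for i
    unfolding bounded_ops_def
    by (simp add: aut_apply[OF \<mu> X] R_def[symmetric] bounded_opsD[OF R, symmetric]
        bounded_opsD[OF Xops] bounded_opsD[OF lin_bounded_ops[OF Xops]] scaleC_diff_right scaleC_scaleC mult.commute)
  have \<rho>2: "\<rho>\<^sup>2 < 1" "0 \<le> \<rho>\<^sup>2" using \<rho> by (auto simp: power_less_one_iff)
  \<comment> \<open>The defect identity bounds the column by \<open>(norm h)\<^sup>2 - s\<^sup>2 *
    (1 - \<rho>\<^sup>2) * (norm v)\<^sup>2\<close>. Since \<open>norm h \<le> 2 * norm v\<close>, a
    quarter of the gain survives in terms of \<open>norm h\<close>, and this makes the bound
    strict.\<close>
  define \<sigma> where "\<sigma> = 1 - s\<^sup>2 * (1 - \<rho>\<^sup>2) / 4"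
  have s2: "0 < s\<^sup>2" "s\<^sup>2 \<le> 1" using s(1) by (simp, simp add: s(2))
  have "0 < s\<^sup>2 * (1 - \<rho>\<^sup>2)" using s2 \<rho>2 by simp
  moreover have "s\<^sup>2 * (1 - \<rho>\<^sup>2) \<le> 1" using s2 \<rho>2 by (intro mult_le_one) auto
  ultimately have \<sigma>: "0 \<le> \<sigma>" "\<sigma> < 1" by (auto simp: \<sigma>_def)
  have "row_bound (aut \<mu> X) (sqrt \<sigma>)"
  proof (rule row_bound_dual[OF ops])
    fix h
    define v where "v = adj R h"
    define x where "x i = adj (X $ i) v" for i
    define w where "w = (\<Sum>i\<in>UNIV. \<mu> $ i *\<^sub>C x i)"
    have cR: "cinner (R y) h = cinner y v" for y by (simp add: v_def cinner_adj[OF R])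
    have cX: "cinner ((X $ i) y) v = cinner y (x i)" for i y by (simp add: x_def cinner_adj[OF Xops])
    have cu: "cinner (lin (vcnj \<mu>) X y) v = cinner y w" for y
      by (simp add: lin_apply w_def cinner_sum_left cinner_sum_right cinner_scaleC_left cinner_scaleC_right cX)
    have h: "h = v - w"
    proof (rule cinner_right_eqI)
      fix y
      have "y = R (y - lin (vcnj \<mu>) X y)"
        using resolvent_right[of "vcnj \<mu>" X y] \<mu> X by (simp add: R_def blinfun.diff_right)
      then have "cinner y h = cinner (R (y - lin (vcnj \<mu>) X y)) h" by simp
      also have "\<dots> = cinner y (v - w)" by (simp add: cR cu cinner_diff_left cinner_diff_right)
      finally show "cinner y h = cinner y (v - w)" .
    qed
    have "adj (aut \<mu> X $ i) h = cnj (\<mu> $ i) *\<^sub>C v - complex_of_real s *\<^sub>C x i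
        - cnj (\<mu> $ i / (1 + of_real s)) *\<^sub>C w" for i
    proof (rule cinner_right_eqI)
      fix y
      show "cinner y (adj (aut \<mu> X $ i) h) = cinner y (cnj (\<mu> $ i) *\<^sub>C v - complex_of_real s *\<^sub>C x i
        - cnj (\<mu> $ i / (1 + of_real s)) *\<^sub>C w)"
        by (simp add: cinner_adj[OF ops, symmetric] aut_apply[OF \<mu> X] R_def[symmetric] cR s_def[symmetric]
            cinner_simps cX cu)
    qed
    then have "(\<Sum>i\<in>UNIV. (norm (adj (aut \<mu> X $ i) h))\<^sup>2)
        = (norm h)\<^sup>2 - s\<^sup>2 * ((norm v)\<^sup>2 - (\<Sum>i\<in>UNIV. (norm (x i))\<^sup>2))"
      using aut_defect_identity[OF s w_def, of v] by (simp only: h)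
    also have "\<dots> \<le> \<sigma> * (norm h)\<^sup>2"
    proof -
      have xs: "(\<Sum>i\<in>UNIV. (norm (x i))\<^sup>2) \<le> \<rho>\<^sup>2 * (norm v)\<^sup>2"
        unfolding x_def by (rule row_bound_adj[OF Xops \<rho>(3)])
      have "norm w \<le> (\<Sum>i\<in>UNIV. cmod (\<mu> $ i) * norm (x i))"
        unfolding w_def by (intro sum_norm_le) (simp add: norm_scaleC)
      then have "(norm w)\<^sup>2 \<le> (\<Sum>i\<in>UNIV. cmod (\<mu> $ i) * norm (x i))\<^sup>2"
        by (rule power_mono) simp
      also have "\<dots> \<le> (norm \<mu>)\<^sup>2 * (\<Sum>i\<in>UNIV. (norm (x i))\<^sup>2)"
        unfolding norm_vec_sq by (rule Cauchy_Schwarz_ineq_sum)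
      also have "\<dots> \<le> 1 * (1 * (norm v)\<^sup>2)"
        using xs \<mu> \<rho>2 by (intro mult_mono order_trans[OF xs] mult_right_mono) (auto simp: power_le_one sum_nonneg)
      finally have "norm w \<le> norm v" by simp
      then have "norm h \<le> 2 * norm v" using norm_triangle_ineq4[of v w] h by simp
      then have "(norm h)\<^sup>2 \<le> (2 * norm v)\<^sup>2" by (rule power_mono) simp
      then have "(norm h)\<^sup>2 / 4 \<le> (norm v)\<^sup>2" by (simp add: power_mult_distrib)
      then have "s\<^sup>2 * ((1 - \<rho>\<^sup>2) * ((norm h)\<^sup>2 / 4)) \<le> s\<^sup>2 * ((1 - \<rho>\<^sup>2) * (norm v)\<^sup>2)"
        using \<rho>2 by (intro mult_left_mono) auto
      also have "\<dots> \<le> s\<^sup>2 * ((norm v)\<^sup>2 - (\<Sum>i\<in>UNIV. (norm (x i))\<^sup>2))"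
        using xs by (intro mult_left_mono) (auto simp: algebra_simps)
      finally show ?thesis by (simp add: \<sigma>_def algebra_simps)
    qed
    finally show "(\<Sum>i\<in>UNIV. (norm (adj (aut \<mu> X $ i) h))\<^sup>2) \<le> (sqrt \<sigma>)\<^sup>2 * (norm h)\<^sup>2"
      using \<sigma> by simp
  qed
  then show ?thesis using \<sigma> by (intro nc_ballI[OF ops, of "sqrt \<sigma>"]) auto
qed

text \<open>Everything rests on \<open>y - t y = s\<^sup>2 *\<^sub>C R y\<close>: the denominator at
  the image point \<open>Y\<close> is, up to a scalar, the resolvent \<open>R\<close> at
  \<open>X\<close>, so the resolvent \<open>Q\<close> at \<open>Y\<close> cancels it.\<close>

lemma aut_involution:
  fixes X :: "('h::chilbert_space \<Rightarrow>\<^sub>L 'h) ^ 'n::finite"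
  assumes \<mu>: "norm \<mu> < 1" and X: "X \<in> nc_ball"
  shows "aut \<mu> (aut \<mu> X) = X"
proof -
  define s where "s = complex_of_real (defect \<mu>)"
  have s: "1 + s \<noteq> 0" "s \<noteq> 0" "s\<^sup>2 = 1 - (\<Sum>i\<in>UNIV. cnj (\<mu> $ i) * \<mu> $ i)"
  proof -
    have "complex_of_real (1 + defect \<mu>) \<noteq> 0" "complex_of_real (defect \<mu>) \<noteq> 0"
      using defect(1)[OF \<mu>] unfolding of_real_eq_0_iff by linarith+
    then show "1 + s \<noteq> 0" "s \<noteq> 0" by (simp_all add: s_def)
    have "s\<^sup>2 = complex_of_real (1 - (\<Sum>i\<in>UNIV. (cmod (\<mu> $ i))\<^sup>2))"
      unfolding s_def of_real_power[symmetric] defect(2)[OF \<mu>] norm_vec_sq ..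
    then show "s\<^sup>2 = 1 - (\<Sum>i\<in>UNIV. cnj (\<mu> $ i) * \<mu> $ i)"
      by (simp add: complex_norm_square mult.commute del: of_real_power)
  qed
  define Y where "Y = aut \<mu> X"
  have Y: "Y \<in> nc_ball" unfolding Y_def by (rule aut_nc_ball[OF assms])
  define R where "R = ev (wsc (vcnj \<mu>)) X"
  define Q where "Q = ev (wsc (vcnj \<mu>)) Y"
  define u where "u = lin (vcnj \<mu>) X"
  define t where "t = lin (vcnj \<mu>) Y"
  have R: "R (c *\<^sub>C y) = c *\<^sub>C R y" for c y
    unfolding R_def by (intro bounded_opsD ev_bounded_ops hol_coeffs_wsc X) (simp add: \<mu>)
  have Q: "Q (c *\<^sub>C y) = c *\<^sub>C Q y" for c y
    unfolding Q_def by (intro bounded_opsD ev_bounded_ops hol_coeffs_wsc Y) (simp add: \<mu>)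
  have Ru: "R (u y) = R y - y" for y
    using resolvent_right[of "vcnj \<mu>" X y] \<mu> X by (simp add: R_def u_def)
  have Qt: "Q (y - t y) = y" for y
    using resolvent_right[of "vcnj \<mu>" Y y] \<mu> Y by (simp add: Q_def t_def blinfun.diff_right)
  have Yi: "(Y $ i) y = \<mu> $ i *\<^sub>C R y - s *\<^sub>C R ((X $ i) y) - (\<mu> $ i / (1 + s)) *\<^sub>C (R y - y)" for i y
    by (simp add: Y_def aut_apply[OF assms] R_def[symmetric] u_def[symmetric] s_def[symmetric]
        blinfun.diff_right R Ru)
  have t: "y - t y = s\<^sup>2 *\<^sub>C R y" for y
  proof -
    have "t y = (\<Sum>i\<in>UNIV. (cnj (\<mu> $ i) * \<mu> $ i) *\<^sub>C R y - s *\<^sub>C R (cnj (\<mu> $ i) *\<^sub>C (X $ i) y)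
        - (cnj (\<mu> $ i) * \<mu> $ i / (1 + s)) *\<^sub>C (R y - y))"
      unfolding t_def lin_apply
      by (intro sum.cong) (simp_all add: Yi scaleC_diff_right scaleC_scaleC R mult.commute mult.left_commute)
    also have "\<dots> = (1 - s\<^sup>2) *\<^sub>C R y - s *\<^sub>C R (u y) - ((1 - s\<^sup>2) / (1 + s)) *\<^sub>C (R y - y)"
      by (simp add: sum_subtractf scaleC_sum_left[symmetric] scaleC_sum_right[symmetric] s(3)
          sum_divide_distrib[symmetric] u_def lin_apply blinfun.sum_right)
    also have "(1 - s\<^sup>2) / (1 + s) = 1 - s" using s(1) by (simp add: field_simps power2_eq_square)
    also have "(1 - s\<^sup>2) *\<^sub>C R y - s *\<^sub>C R (u y) - (1 - s) *\<^sub>C (R y - y) = y - s\<^sup>2 *\<^sub>C R y"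
      by (simp add: Ru scaleC_diff_left scaleC_diff_right scaleC_one algebra_simps)
    finally show ?thesis by simp
  qed
  have "(aut \<mu> Y $ i) y = (X $ i) y" for i y
  proof -
    \<comment> \<open>With \<open>\<mu> $ i = \<kappa> * (1 + s)\<close> the coefficients of
      \<open>y\<close> and of \<open>R y\<close> vanish as polynomials in \<kappa> and
      \<open>s\<close>; only the term containing \<open>X $ i\<close> remains.\<close>
    define \<kappa> where "\<kappa> = \<mu> $ i / (1 + s)"
    have \<kappa>: "\<mu> $ i = \<kappa> * (1 + s)" using s(1) by (simp add: \<kappa>_def)
    have ty: "t y = y - s\<^sup>2 *\<^sub>C R y" using t[of y] by (simp add: algebra_simps)
    have "\<mu> $ i *\<^sub>C y - s *\<^sub>C (Y $ i) y - \<kappa> *\<^sub>C t y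
        = (\<mu> $ i - s * \<kappa> - \<kappa>) *\<^sub>C y
          + (s * \<kappa> + \<kappa> * s\<^sup>2 - s * \<mu> $ i) *\<^sub>C R y + s\<^sup>2 *\<^sub>C R ((X $ i) y)"
      by (simp add: Yi ty \<kappa>_def[symmetric] scaleC_diff_left scaleC_diff_right scaleC_add_left scaleC_scaleC
          power2_eq_square)
    also have "\<mu> $ i - s * \<kappa> - \<kappa> = 0"
      unfolding \<kappa> by (simp add: algebra_simps)
    also have "s * \<kappa> + \<kappa> * s\<^sup>2 - s * \<mu> $ i = 0"
      unfolding \<kappa> by (simp add: algebra_simps power2_eq_square)
    finally have "\<mu> $ i *\<^sub>C y - s *\<^sub>C (Y $ i) y - \<kappa> *\<^sub>C t y = s\<^sup>2 *\<^sub>C R ((X $ i) y)" by simp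
    then have "(aut \<mu> Y $ i) y = Q (s\<^sup>2 *\<^sub>C R ((X $ i) y))"
      by (simp add: aut_apply[OF \<mu> Y] Q_def[symmetric] t_def[symmetric] s_def[symmetric] \<kappa>_def[symmetric])
    also have "\<dots> = (X $ i) y"
      using Qt[of "(X $ i) y"] unfolding t .
    finally show ?thesis .
  qed
  then show ?thesis
    unfolding Y_def by (simp add: vec_eq_iff blinfun_eqI)
qed

lemma aut_center:
  assumes \<mu>: "norm \<mu> < 1"
  shows "aut \<mu> (scalar_tuple \<mu>) = (scalar_tuple 0 :: ('h::chilbert_space \<Rightarrow>\<^sub>L 'h) ^ 'n::finite)"
proof -
  let ?X = "scalar_tuple \<mu> :: ('h \<Rightarrow>\<^sub>L 'h) ^ 'n"
  have X: "?X \<in> nc_ball" by (rule scalar_tuple_nc_ball[OF \<mu>])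
  define s where "s = defect \<mu>"
  note s = defect[OF \<mu>, folded s_def]
  have s1: "1 + complex_of_real s \<noteq> 0"
    using s(1) by (metis add_pos_pos less_irrefl of_real_1 of_real_add of_real_eq_0_iff zero_less_one)
  have l: "lin (vcnj \<mu>) ?X h = of_real (1 - s\<^sup>2) *\<^sub>C h" for h
  proof -
    have "lin (vcnj \<mu>) ?X h = (\<Sum>i\<in>UNIV. cnj (\<mu> $ i) * \<mu> $ i) *\<^sub>C h"
      by (simp add: lin_apply scaleC_scaleC scaleC_sum_left)
    also have "(\<Sum>i\<in>UNIV. cnj (\<mu> $ i) * \<mu> $ i) = complex_of_real ((norm \<mu>)\<^sup>2)"
      by (simp add: norm_vec_sq complex_norm_square mult.commute del: of_real_power)
    finally show ?thesis using s(2) by simp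
  qed
  have "\<mu> $ i *\<^sub>C h - complex_of_real s *\<^sub>C \<mu> $ i *\<^sub>C h
      - (\<mu> $ i / (1 + of_real s)) *\<^sub>C of_real (1 - s\<^sup>2) *\<^sub>C h = 0" for i and h :: 'h
  proof -
    have "\<mu> $ i - of_real s * \<mu> $ i - \<mu> $ i / (1 + of_real s) * of_real (1 - s\<^sup>2) = 0"
      using s1 by (simp add: field_simps power2_eq_square)
    then have "(\<mu> $ i - of_real s * \<mu> $ i - \<mu> $ i / (1 + of_real s) * of_real (1 - s\<^sup>2)) *\<^sub>C h = 0"
      by simp
    then show ?thesis by (simp only: scaleC_diff_left scaleC_scaleC)
  qed
  then have "(aut \<mu> ?X $ i) h = 0" for i h
    by (simp add: aut_apply[OF \<mu> X] l s_def[symmetric] del: of_real_diff)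
  then show ?thesis by (simp add: vec_eq_iff blinfun_eqI scalar_tuple_def)
qed

section \<open>The Hardy space and its composition operators\<close>

definition ball_fun :: "('n::finite list \<Rightarrow> complex) \<Rightarrow> ('h::chilbert_space \<Rightarrow>\<^sub>L 'h) ^ 'n \<Rightarrow> ('h \<Rightarrow>\<^sub>L 'h)" where
  "ball_fun a X = (if X \<in> nc_ball then ev a X else 0)"

lemma self_map_coeffs_nc_ball: "self_map_coeffs \<phi> c \<Longrightarrow> X \<in> nc_ball \<Longrightarrow> \<phi> X \<in> nc_ball"
  by (simp add: self_map_coeffs_def)

section \<open>Coefficient sequences: removal of the last letter and of the dilation\<close>

lemma conv_snoc: "conv c d (\<gamma> @ [j]) = c (\<gamma> @ [j]) * d [] + conv c (\<lambda>\<beta>. d (\<beta> @ [j])) \<gamma>"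
  by (induction \<gamma> arbitrary: c) (simp_all add: algebra_simps)

lemma conv_scale_right: "conv c (\<lambda>\<beta>. d \<beta> * z) \<gamma> = conv c d \<gamma> * z"
  by (induction \<gamma> arbitrary: c) (simp_all add: algebra_simps)

text \<open>Solved for \<open>b\<close>, this undoes right multiplication by a resolvent: a
  coefficient of \<open>b\<close> is the coefficient of the product at the same word minus a
  multiple of the one at the word without its last letter.\<close>

lemma conv_wsc_snoc: "conv b (wsc \<nu>) (\<gamma> @ [j]) = b (\<gamma> @ [j]) + conv b (wsc \<nu>) \<gamma> * \<nu> $ j"
  by (simp add: conv_snoc wsc_append conv_scale_right)

text \<open>A word is the \<open>butlast\<close> of exactly \<open>CARD('n)\<close> nonempty words,
  whence the factor.\<close>

lemma l2_le_butlast: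
  fixes t :: "'n::finite list \<Rightarrow> complex"
  assumes "l2_le t C"
  shows "l2_le (\<lambda>\<gamma>. if \<gamma> = [] then 0 else t (butlast \<gamma>)) (real CARD('n) * C)"
  unfolding l2_le_def
proof (intro allI impI)
  fix F :: "'n list set" assume F: "finite F"
  let ?f = "\<lambda>\<gamma>. (cmod (if \<gamma> = [] then 0 else t (butlast \<gamma>)))\<^sup>2"
  let ?G = "(\<lambda>(\<gamma>, j). \<gamma> @ [j]) ` ((butlast ` F) \<times> (UNIV :: 'n set))"
  have fin: "finite ((butlast ` F) \<times> (UNIV :: 'n set))" using F by simp
  have "(\<Sum>\<gamma>\<in>F. ?f \<gamma>) = (\<Sum>\<gamma>\<in>F - {[]}. ?f \<gamma>)"
    using F by (intro sum.mono_neutral_right) auto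
  also have "\<dots> \<le> (\<Sum>\<gamma>\<in>?G. ?f \<gamma>)"
  proof (rule sum_mono2)
    show "F - {[]} \<subseteq> ?G"
    proof
      fix \<gamma> assume "\<gamma> \<in> F - {[]}"
      then have "\<gamma> = (\<lambda>(\<gamma>, j). \<gamma> @ [j]) (butlast \<gamma>, last \<gamma>)" "(butlast \<gamma>, last \<gamma>) \<in> (butlast ` F) \<times> UNIV"
        by auto
      then show "\<gamma> \<in> ?G" by (rule image_eqI)
    qed
  qed (use fin in auto)
  also have "\<dots> = (\<Sum>(\<gamma>, j)\<in>(butlast ` F) \<times> (UNIV :: 'n set). (cmod (t \<gamma>))\<^sup>2)"
    by (subst sum.reindex) (auto simp: inj_on_def case_prod_unfold)
  also have "\<dots> = real CARD('n) * (\<Sum>\<gamma>\<in>butlast ` F. (cmod (t \<gamma>))\<^sup>2)"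
    by (simp add: sum.cartesian_product[symmetric] sum_distrib_left)
  also have "\<dots> \<le> real CARD('n) * C"
    using F by (intro mult_left_mono l2_leD[OF assms]) auto
  finally show "(\<Sum>\<gamma>\<in>F. ?f \<gamma>) \<le> real CARD('n) * C" .
qed

lemma l2_le_add:
  assumes "l2_le a A" "l2_le b B" "\<And>\<gamma>. cmod (d \<gamma>) \<le> cmod (a \<gamma>) + cmod (b \<gamma>)"
  shows "l2_le d (2 * A + 2 * B)"
  unfolding l2_le_def
proof (intro allI impI)
  fix F :: "'a set" assume F: "finite F"
  have "(\<Sum>\<gamma>\<in>F. (cmod (d \<gamma>))\<^sup>2) \<le> (\<Sum>\<gamma>\<in>F. 2 * (cmod (a \<gamma>))\<^sup>2 + 2 * (cmod (b \<gamma>))\<^sup>2)"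
  proof (rule sum_mono)
    fix \<gamma>
    have "(cmod (d \<gamma>))\<^sup>2 \<le> (cmod (a \<gamma>) + cmod (b \<gamma>))\<^sup>2" by (intro power_mono assms) auto
    also have "\<dots> \<le> 2 * (cmod (a \<gamma>))\<^sup>2 + 2 * (cmod (b \<gamma>))\<^sup>2"
      using sum_squares_bound[of "cmod (a \<gamma>)" "cmod (b \<gamma>)"] by (simp add: power2_sum)
    finally show "(cmod (d \<gamma>))\<^sup>2 \<le> 2 * (cmod (a \<gamma>))\<^sup>2 + 2 * (cmod (b \<gamma>))\<^sup>2" .
  qed
  also have "\<dots> = 2 * (\<Sum>\<gamma>\<in>F. (cmod (a \<gamma>))\<^sup>2) + 2 * (\<Sum>\<gamma>\<in>F. (cmod (b \<gamma>))\<^sup>2)"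
    by (simp add: sum.distrib sum_distrib_left)
  also have "\<dots> \<le> 2 * A + 2 * B"
    by (intro add_mono mult_left_mono l2_leD[OF assms(1) F] l2_leD[OF assms(2) F]) auto
  finally show "(\<Sum>\<gamma>\<in>F. (cmod (d \<gamma>))\<^sup>2) \<le> 2 * A + 2 * B" .
qed

lemma l2_le_dilation_limit:
  assumes r0: "r0 < 1" and b: "\<And>r. r0 < r \<Longrightarrow> 0 < r \<Longrightarrow> r < 1 \<Longrightarrow> l2_le (\<lambda>\<gamma>. of_real (r ^ length \<gamma>) * b \<gamma>) C"
  shows "l2_le b C"
proof (rule l2_le_limit)
  define q where "q = max r0 0"
  \<comment> \<open>The denominators start at 2 so that already \<open>r 0\<close> exceeds
    \<open>q\<close> strictly; starting at 1 would give \<open>r 0 = q\<close>.\<close>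
  define r where "r k = 1 - (1 - q) * inverse (real (Suc (Suc k)))" for k
  have q: "0 \<le> q" "q < 1" "r0 \<le> q" using r0 by (auto simp: q_def)
  have "q < r k \<and> r k < 1" for k
  proof -
    have "inverse (real (Suc (Suc k))) < 1" "0 < inverse (real (Suc (Suc k)))"
      by (auto simp: inverse_less_1_iff)
    then have "(1 - q) * inverse (real (Suc (Suc k))) < (1 - q) * 1" "0 < (1 - q) * inverse (real (Suc (Suc k)))"
      using q by (auto intro!: mult_strict_left_mono)
    then show ?thesis by (simp add: r_def)
  qed
  with q show "l2_le (\<lambda>\<gamma>. of_real (r k ^ length \<gamma>) * b \<gamma>) C" for k
    by (intro b) (meson order_le_less_trans)+
  have "(\<lambda>k. inverse (real (Suc (Suc k)))) \<longlonglongrightarrow> 0"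
    by (rule LIMSEQ_Suc[OF LIMSEQ_inverse_real_of_nat])
  then have "r \<longlonglongrightarrow> 1 - (1 - q) * 0"
    unfolding r_def by (intro tendsto_intros)
  then have "(\<lambda>k. of_real (r k ^ length \<gamma>) * b \<gamma>) \<longlonglongrightarrow> of_real (1 ^ length \<gamma>) * b \<gamma>" for \<gamma>
    by (intro tendsto_mult tendsto_of_real tendsto_power tendsto_const) simp
  then show "(\<lambda>k. of_real (r k ^ length \<gamma>) * b \<gamma>) \<longlonglongrightarrow> b \<gamma>" for \<gamma> by simp
qed

context fock
begin

section \<open>The Hardy space as the space of square summable coefficient sequences\<close>

lemma ball_fun_has_coeffs: "hol_coeffs a \<Longrightarrow> has_coeffs (ball_fun a :: ('h \<Rightarrow>\<^sub>L 'h) ^ 'n \<Rightarrow> _) a"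
  by (simp add: has_coeffs_iff ball_fun_def)

lemma free_coeff_ball_fun: "hol_coeffs a \<Longrightarrow> free_coeff (ball_fun a :: ('h \<Rightarrow>\<^sub>L 'h) ^ 'n \<Rightarrow> _) = a"
  by (rule free_coeff_eq[OF ball_fun_has_coeffs])

lemma ball_fun_H2:
  assumes "l2_le a C"
  shows "(ball_fun a :: ('h \<Rightarrow>\<^sub>L 'h) ^ 'n \<Rightarrow> _) \<in> H2_ball"
    and "H2_norm (ball_fun a :: ('h \<Rightarrow>\<^sub>L 'h) ^ 'n \<Rightarrow> _) \<le> sqrt C"
  using ball_fun_has_coeffs[OF l2_le_hol_coeffs[OF assms]] l2_le_summable[OF assms] l2_le_infsum[OF assms]
  by (auto simp: H2_ball_def free_holomorphic_def free_coeff_ball_fun[OF l2_le_hol_coeffs[OF assms]]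
      ball_fun_def H2_norm_def)

lemma H2_ballD:
  assumes "(f :: ('h \<Rightarrow>\<^sub>L 'h) ^ 'n \<Rightarrow> _) \<in> H2_ball"
  shows H2_ball_eq: "f = ball_fun (free_coeff f)"
    and H2_ball_l2_le: "l2_le (free_coeff f) ((H2_norm f)\<^sup>2)"
proof -
  have f: "has_coeffs f (free_coeff f)" "\<And>X. X \<notin> nc_ball \<Longrightarrow> f X = 0"
    and s: "(\<lambda>\<alpha>. (cmod (free_coeff f \<alpha>))\<^sup>2) summable_on UNIV"
    using assms has_coeffs_free_coeff by (auto simp: H2_ball_def)
  show "f = ball_fun (free_coeff f)"
    using f by (auto simp: ball_fun_def has_coeffs_iff)
  have "(H2_norm f)\<^sup>2 = (\<Sum>\<^sub>\<infinity>\<alpha>. (cmod (free_coeff f \<alpha>))\<^sup>2)"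
    unfolding H2_norm_def by (intro real_sqrt_pow2 infsum_nonneg) simp
  then show "l2_le (free_coeff f) ((H2_norm f)\<^sup>2)" using summable_l2_le[OF s] by simp
qed

lemma H2_norm_nonneg [simp]: "0 \<le> H2_norm f"
  by (simp add: H2_norm_def infsum_nonneg)

lemma H2_ball_hol_coeffs:
  "(f :: ('h \<Rightarrow>\<^sub>L 'h) ^ 'n \<Rightarrow> _) \<in> H2_ball \<Longrightarrow> hol_coeffs (free_coeff f)"
  using l2_le_hol_coeffs[OF H2_ball_l2_le] .

lemma comp_op_apply:
  fixes \<phi> :: "('h \<Rightarrow>\<^sub>L 'h) ^ 'n \<Rightarrow> ('h \<Rightarrow>\<^sub>L 'h) ^ 'n"
  assumes "self_map_coeffs \<phi> c" "f \<in> H2_ball"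
  shows "comp_op \<phi> f X = (if X \<in> nc_ball then f (\<phi> X) else 0)"
  using assms(2) comp_op_eq[of f \<phi> X] assms(1) has_coeffs_free_coeff[of f] self_map_iff[of \<phi>]
  by (auto simp: comp_op_def H2_ball_def)

lemma comp_op_ball_fun:
  fixes \<phi> :: "('h \<Rightarrow>\<^sub>L 'h) ^ 'n \<Rightarrow> ('h \<Rightarrow>\<^sub>L 'h) ^ 'n"
  assumes "self_map_coeffs \<phi> c" "f \<in> H2_ball"
  shows "comp_op \<phi> f = ball_fun (comp_coeff c (free_coeff f))"
proof
  fix X
  show "comp_op \<phi> f X = ball_fun (comp_coeff c (free_coeff f)) X"
    using comp_op_apply[OF assms, of X] H2_ball_eq[OF assms(2)] self_map_coeffs_nc_ball[OF assms(1)]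
      ev_comp[OF assms(1) H2_ball_hol_coeffs[OF assms(2)], of X]
    by (metis ball_fun_def)
qed

lemma H2_ball_add:
  assumes "(f :: ('h \<Rightarrow>\<^sub>L 'h) ^ 'n \<Rightarrow> _) \<in> H2_ball" "g \<in> H2_ball"
  shows "(\<lambda>X. f X + g X) \<in> H2_ball" "free_coeff (\<lambda>X. f X + g X) = (\<lambda>\<alpha>. free_coeff f \<alpha> + free_coeff g \<alpha>)"
proof -
  let ?c = "\<lambda>\<alpha>. free_coeff f \<alpha> + free_coeff g \<alpha>"
  note hf = H2_ball_hol_coeffs[OF assms(1)] and hg = H2_ball_hol_coeffs[OF assms(2)]
  have eq: "(\<lambda>X. f X + g X) = ball_fun ?c"
    by (subst H2_ball_eq[OF assms(1)], subst H2_ball_eq[OF assms(2)])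
      (auto simp: ball_fun_def ev_add[OF hf hg])
  have "l2_le ?c (2 * (H2_norm f)\<^sup>2 + 2 * (H2_norm g)\<^sup>2)"
    by (rule l2_le_add[OF H2_ball_l2_le[OF assms(1)] H2_ball_l2_le[OF assms(2)]]) (rule norm_triangle_ineq)
  then show "(\<lambda>X. f X + g X) \<in> H2_ball" unfolding eq by (rule ball_fun_H2)
  show "free_coeff (\<lambda>X. f X + g X) = ?c"
    unfolding eq by (rule free_coeff_ball_fun[OF hol_coeffs_add[OF hf hg]])
qed

lemma H2_ball_scale:
  assumes "(f :: ('h \<Rightarrow>\<^sub>L 'h) ^ 'n \<Rightarrow> _) \<in> H2_ball"
  shows "(\<lambda>X. z *\<^sub>C f X) \<in> H2_ball" "free_coeff (\<lambda>X. z *\<^sub>C f X) = (\<lambda>\<alpha>. z * free_coeff f \<alpha>)"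
proof -
  let ?c = "\<lambda>\<alpha>. z * free_coeff f \<alpha>"
  note hf = H2_ball_hol_coeffs[OF assms]
  have eq: "(\<lambda>X. z *\<^sub>C f X) = ball_fun ?c"
    by (subst H2_ball_eq[OF assms]) (auto simp: ball_fun_def ev_scale[OF hf])
  have "l2_le ?c ((cmod z)\<^sup>2 * (H2_norm f)\<^sup>2)"
    using l2_leD[OF H2_ball_l2_le[OF assms]]
    by (auto simp: l2_le_def norm_mult power_mult_distrib sum_distrib_left[symmetric] intro!: mult_left_mono)
  then show "(\<lambda>X. z *\<^sub>C f X) \<in> H2_ball" unfolding eq by (rule ball_fun_H2)
  show "free_coeff (\<lambda>X. z *\<^sub>C f X) = ?c"
    unfolding eq by (rule free_coeff_ball_fun[OF hol_coeffs_scale[OF hf]])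
qed

lemma H2_ball_zero: "((\<lambda>X. 0) :: ('h \<Rightarrow>\<^sub>L 'h) ^ 'n \<Rightarrow> _) \<in> H2_ball" "H2_norm ((\<lambda>X. 0) :: ('h \<Rightarrow>\<^sub>L 'h) ^ 'n \<Rightarrow> _) = 0"
proof -
  have "l2_le (\<lambda>_ :: 'n list. 0) 0" by (simp add: l2_le_def)
  moreover have "(ball_fun (\<lambda>_. 0) :: ('h \<Rightarrow>\<^sub>L 'h) ^ 'n \<Rightarrow> _) = (\<lambda>X. 0)"
    by (auto simp: ball_fun_def ev_zero)
  ultimately show "((\<lambda>X. 0) :: ('h \<Rightarrow>\<^sub>L 'h) ^ 'n \<Rightarrow> _) \<in> H2_ball"
    "H2_norm ((\<lambda>X. 0) :: ('h \<Rightarrow>\<^sub>L 'h) ^ 'n \<Rightarrow> _) = 0"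
    using ball_fun_H2[of "\<lambda>_. 0" 0] H2_norm_nonneg[of "(\<lambda>X. 0) :: ('h \<Rightarrow>\<^sub>L 'h) ^ 'n \<Rightarrow> _"] by auto
qed

lemma H2_norm_scale:
  assumes "(f :: ('h \<Rightarrow>\<^sub>L 'h) ^ 'n \<Rightarrow> _) \<in> H2_ball"
  shows "H2_norm (\<lambda>X. z *\<^sub>C f X) = cmod z * H2_norm f"
  unfolding H2_norm_def H2_ball_scale(2)[OF assms] norm_mult power_mult_distrib
  by (simp add: infsum_cmult_right' real_sqrt_mult)

text \<open>Estimates for composition are proved on coefficient sequences and carried over here;
  \<open>K\<close> scales squared norms, hence the square root.\<close>

lemma comp_op_bounded:
  fixes \<phi> :: "('h \<Rightarrow>\<^sub>L 'h) ^ 'n \<Rightarrow> ('h \<Rightarrow>\<^sub>L 'h) ^ 'n"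
  assumes \<phi>: "self_map_coeffs \<phi> c" and K: "\<And>a C. l2_le a C \<Longrightarrow> l2_le (comp_coeff c a) (K * C)"
  shows "bounded_op_on H2_ball H2_norm (comp_op \<phi>)"
    and "f \<in> H2_ball \<Longrightarrow> H2_norm (comp_op \<phi> f) \<le> sqrt K * H2_norm f"
proof -
  have *: "comp_op \<phi> f \<in> H2_ball \<and> H2_norm (comp_op \<phi> f) \<le> sqrt K * H2_norm f" if "f \<in> H2_ball" for f
    unfolding comp_op_ball_fun[OF \<phi> that]
    using ball_fun_H2[OF K[OF H2_ball_l2_le[OF that]]] by (simp add: real_sqrt_mult)
  then show "f \<in> H2_ball \<Longrightarrow> H2_norm (comp_op \<phi> f) \<le> sqrt K * H2_norm f" by blast
  show "bounded_op_on H2_ball H2_norm (comp_op \<phi>)"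
    unfolding bounded_op_on_def
    using * by (auto simp: fun_eq_iff comp_op_apply[OF \<phi>] H2_ball_add H2_ball_scale)
qed

text \<open>The inner products of the evaluated vector with the \<open>e \<gamma>\<close> are the
  dilated coefficients, so Bessel's inequality bounds these and the limit r \<rightarrow> 1 removes
  the dilation.\<close>

lemma ev_shifts_bound_l2_le:
  assumes "hol_coeffs b" "r0 < 1"
    and "\<And>r. r0 < r \<Longrightarrow> 0 < r \<Longrightarrow> r < 1 \<Longrightarrow> (norm (ev b (shifts r) (e [])))\<^sup>2 \<le> C"
  shows "l2_le b C"
proof (rule l2_le_dilation_limit[OF assms(2)])
  fix r :: real assume r: "r0 < r" "0 < r" "r < 1"
  have "l2_le (\<lambda>\<gamma>. cinner (ev b (shifts r) (e [])) (e \<gamma>)) C"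
    using l2_le_e l2_le_mono assms(3)[OF r] by blast
  then show "l2_le (\<lambda>\<gamma>. of_real (r ^ length \<gamma>) * b \<gamma>) C"
    using cinner_ev_shifts[OF assms(1)] r by simp
qed

text \<open>The adjoints of the components of \<open>\<phi> X\<close> act on the joint eigenvector
  \<open>v\<close> by the conjugated values of the scalar map at \<mu>. If that map sends \<mu> to
  0, then \<open>v\<close> is wandering for \<open>\<phi> X\<close>.\<close>

lemma comp_coeff_wandering:
  fixes \<phi> :: "('h \<Rightarrow>\<^sub>L 'h) ^ 'n \<Rightarrow> ('h \<Rightarrow>\<^sub>L 'h) ^ 'n" and X :: "('h \<Rightarrow>\<^sub>L 'h) ^ 'n"
  assumes \<phi>: "self_map_coeffs \<phi> c" and a: "l2_le a C" and X: "X \<in> nc_ball"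
    and v: "\<And>i y. cinner ((X $ i) y) v = \<mu> $ i * cinner y v" and \<mu>: "norm \<mu> < 1"
    and zero: "\<And>i. sev (c i) \<mu> = 0"
  shows "(norm (ev (comp_coeff c a) X v))\<^sup>2 \<le> C * (norm v)\<^sup>2"
  unfolding ev_comp[OF \<phi> l2_le_hol_coeffs[OF a] X]
proof (rule wandering_ev_bound[OF self_map_coeffs_nc_ball[OF \<phi> X] _ a])
  fix i y
  have "\<phi> X $ i = ev (c i) X" "hol_coeffs (c i)" using \<phi> X by (auto simp: self_map_coeffs_def)
  then show "cinner ((\<phi> X $ i) y) v = 0"
    using cinner_ev_eigen[OF v _ \<mu> X, of "c i" y] zero by simp
qed

lemma littlewood_subordination:
  fixes \<phi> :: "('h \<Rightarrow>\<^sub>L 'h) ^ 'n \<Rightarrow> ('h \<Rightarrow>\<^sub>L 'h) ^ 'n"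
  assumes \<phi>: "self_map_coeffs \<phi> c" and zero: "\<And>i. sev (c i) 0 = 0" and a: "l2_le a C"
  shows "l2_le (comp_coeff c a) C"
proof (rule ev_shifts_bound_l2_le[of _ 0])
  show "hol_coeffs (comp_coeff c a)" by (rule hol_coeffs_comp[OF \<phi> l2_le_hol_coeffs[OF a]])
  fix r :: real assume "0 < r" "r < 1"
  then have "(norm (ev (comp_coeff c a) (shifts r) (e [])))\<^sup>2 \<le> C * (norm (e []))\<^sup>2"
    by (intro comp_coeff_wandering[OF \<phi> a _ _ _ zero] shifts_nc_ball)
      (auto simp: scaleC_blinfun.rep_eq cinner_scaleC_left cinner_shift_Nil)
  then show "(norm (ev (comp_coeff c a) (shifts r) (e [])))\<^sup>2 \<le> C" by simp
qed simp

lemma self_map_coeffs_compose: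
  fixes \<phi> \<psi> :: "('h \<Rightarrow>\<^sub>L 'h) ^ 'n \<Rightarrow> ('h \<Rightarrow>\<^sub>L 'h) ^ 'n"
  assumes "self_map_coeffs \<phi> c" "self_map_coeffs \<psi> d"
  shows "self_map_coeffs (\<psi> \<circ> \<phi>) (\<lambda>i. comp_coeff c (d i))"
  using assms hol_coeffs_comp[OF assms(1)] ev_comp[OF assms(1)] by (simp add: self_map_coeffs_def)

lemma self_map_coeffs_aut:
  assumes "norm \<mu> < 1"
  shows "self_map_coeffs (aut \<mu> :: ('h \<Rightarrow>\<^sub>L 'h) ^ 'n \<Rightarrow> _) (aut_coeff \<mu>)"
  using assms unfolding self_map_coeffs_def
  by (auto simp: aut_nc_ball aut_coeff_def intro!: hol_coeffs_conv hol_coeffs_wsc hol_coeffs_aut_num)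
    (simp add: aut_def aut_coeff_def)

lemma sev_self_map:
  fixes \<phi> :: "('h \<Rightarrow>\<^sub>L 'h) ^ 'n \<Rightarrow> ('h \<Rightarrow>\<^sub>L 'h) ^ 'n"
  assumes "self_map_coeffs \<phi> c" "norm \<mu> < 1"
  shows "\<phi> (scalar_tuple \<mu>) = scalar_tuple (\<chi> i. sev (c i) \<mu>)"
proof (rule vec_eq_iff[THEN iffD2], rule allI)
  fix i
  have "hol_coeffs (c i)" and "\<phi> (scalar_tuple \<mu>) $ i = ev (c i) (scalar_tuple \<mu>)"
    using assms scalar_tuple_nc_ball[OF assms(2)] by (auto simp: self_map_coeffs_def)
  then show "\<phi> (scalar_tuple \<mu>) $ i = scalar_tuple (\<chi> i. sev (c i) \<mu>) $ i"
    by (simp add: ev_scalar_tuple[OF _ assms(2)] scalar_tuple_def[of "\<chi> i. sev (c i) \<mu>"])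
qed

lemma scalar_tuple_inject:
  assumes "(scalar_tuple \<mu> :: ('h \<Rightarrow>\<^sub>L 'h) ^ 'n) = scalar_tuple \<nu>"
  shows "\<mu> = \<nu>"
proof -
  have "\<mu> $ i = \<nu> $ i" for i
  proof -
    have "cinner ((scalar_tuple \<mu> $ i) (e [])) (e []) = cinner ((scalar_tuple \<nu> $ i) (e [])) (e [])"
      by (simp only: assms)
    then show ?thesis by (simp add: cinner_scaleC_left cinner_e)
  qed
  then show ?thesis by (simp add: vec_eq_iff)
qed

text \<open>\<open>shift i\<close> is isometric only on the closed span of the family
  \<open>e\<close>. Evaluations at the vacuum are limits of finite combinations of the
  \<open>e \<alpha>\<close>, so one argument of that kind suffices.\<close>

lemma cinner_shift_shift_same:
  assumes "hol_coeffs a" "0 \<le> r" "r < 1"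
  shows "cinner (shift i y) (shift i (ev a (shifts r) (e []))) = cinner y (ev a (shifts r) (e []))"
proof -
  have s: "(\<lambda>k. homog a (shifts r) k (e [])) sums ev a (shifts r) (e [])"
    by (rule ev_apply_sums[OF assms(1) shifts_nc_ball[OF assms(2,3)]])
  have "(\<lambda>k. cinner y (homog a (shifts r) k (e []))) sums cinner y (ev a (shifts r) (e []))"
    by (rule bounded_linear.sums[OF bounded_linear_cinner_right s])
  moreover have "(\<lambda>k. cinner (shift i y) (shift i (homog a (shifts r) k (e []))))
      sums cinner (shift i y) (shift i (ev a (shifts r) (e [])))"
    by (rule bounded_linear.sums[OF bounded_linear_cinner_right
          bounded_linear.sums[OF blinfun.bounded_linear_right s]])
  moreover have "cinner (shift i y) (shift i (homog a (shifts r) k (e [])))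
      = cinner y (homog a (shifts r) k (e []))" for k
    by (simp add: homog_shifts blinfun.sum_right bounded_opsD[OF shift_bounded_ops] cinner_sum_right
        cinner_scaleC_right cinner_shift_same)
  ultimately show ?thesis using sums_unique2 by simp blast
qed

text \<open>The reproducing kernel vector adapted to the dilated shifts. The adjoint of
  \<open>shifts r $ i\<close> multiplies the resolvent vector with parameter \<nu> by
  \<open>r\<^sup>2 * \<nu> $ i\<close>; asking for the eigenvalue \<open>cnj (\<mu> $ i)\<close>
  forces the scaling by \<open>1 / r\<^sup>2\<close> and the condition
  \<open>norm \<mu> < r\<^sup>2\<close>.\<close>

definition kern :: "real \<Rightarrow> complex ^ 'n \<Rightarrow> 'h" where
  "kern r \<mu> = ev (wsc (of_real (1 / r\<^sup>2) *s vcnj \<mu>)) (shifts r) (e [])"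

lemma norm_kern_arg: "norm (of_real (1 / r\<^sup>2) *s vcnj \<mu>) = norm \<mu> / r\<^sup>2"
proof -
  have "(norm (of_real (1 / r\<^sup>2) *s vcnj \<mu>))\<^sup>2 = (norm \<mu> / r\<^sup>2)\<^sup>2"
    by (simp only: norm_vec_sq power_divide)
      (simp add: norm_mult norm_divide norm_power power_mult_distrib power_divide sum_divide_distrib)
  then show ?thesis by (simp add: power2_eq_iff_nonneg)
qed

lemma kern:
  assumes r: "0 < r" "r < 1" and \<mu>: "norm \<mu> < r\<^sup>2"
  shows cinner_shifts_kern: "cinner ((shifts r $ i) y) (kern r \<mu>) = \<mu> $ i * cinner y (kern r \<mu>)"
    and cinner_e_kern: "cinner (e []) (kern r \<mu>) = 1"
    and kern_fixpoint: "kern r \<mu> = e [] + (\<Sum>i\<in>UNIV. (cnj (\<mu> $ i) / of_real (r\<^sup>2)) *\<^sub>C (shifts r $ i) (kern r \<mu>))"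
    and norm_kern_le: "(norm (kern r \<mu>))\<^sup>2 \<le> 1 / (1 - (norm \<mu> / r\<^sup>2)\<^sup>2)"
proof -
  define \<nu> where "\<nu> = of_real (1 / r\<^sup>2) *s vcnj \<mu>"
  have \<nu>1: "norm \<nu> < 1" using r \<mu> unfolding \<nu>_def norm_kern_arg by simp
  have X: "shifts r \<in> nc_ball" using r by (simp add: shifts_nc_ball)
  have k: "kern r \<mu> = ev (wsc \<nu>) (shifts r) (e [])" by (simp add: kern_def \<nu>_def)
  have \<nu>i: "\<nu> $ i = cnj (\<mu> $ i) / of_real (r\<^sup>2)" for i by (simp add: \<nu>_def)
  show fp: "kern r \<mu> = e [] + (\<Sum>i\<in>UNIV. (cnj (\<mu> $ i) / of_real (r\<^sup>2)) *\<^sub>C (shifts r $ i) (kern r \<mu>))"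
    using resolvent_left[OF \<nu>1 X, of "e []"] unfolding k lin_apply \<nu>i .
  have "cinner (kern r \<mu>) (e []) = 1"
    unfolding k using cinner_ev_shifts[OF hol_coeffs_wsc[OF \<nu>1], of r "[]"] r by simp
  then show "cinner (e []) (kern r \<mu>) = 1"
    by (metis cinner_commute complex_cnj_one)
  have same: "cinner (shift i y) (shift i (kern r \<mu>)) = cinner y (kern r \<mu>)"
    unfolding k using r by (intro cinner_shift_shift_same hol_coeffs_wsc \<nu>1) auto
  \<comment> \<open>The vacuum term of the fixed point equation is orthogonal to the range of
    \<open>shift i\<close>, and orthogonality of the ranges leaves only the summand
    \<open>j = i\<close>.\<close>
  have "cinner (shift i y) (kern r \<mu>)
      = (\<Sum>j\<in>UNIV. cinner (shift i y) ((cnj (\<mu> $ j) / of_real (r\<^sup>2)) *\<^sub>C (shifts r $ j) (kern r \<mu>)))"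
    using arg_cong[OF fp, of "cinner (shift i y)"]
    by (simp only: cinner_add_right cinner_sum_right cinner_shift_Nil add_0_left)
  also have "\<dots> = (\<Sum>j\<in>UNIV. if j = i then \<mu> $ j / of_real (r\<^sup>2) * (of_real r * cinner y (kern r \<mu>)) else 0)"
  proof (intro sum.cong refl)
    fix j
    show "cinner (shift i y) ((cnj (\<mu> $ j) / of_real (r\<^sup>2)) *\<^sub>C (shifts r $ j) (kern r \<mu>))
        = (if j = i then \<mu> $ j / of_real (r\<^sup>2) * (of_real r * cinner y (kern r \<mu>)) else 0)"
      using same cinner_shift_shift[of i j y "kern r \<mu>"]
      by (auto simp: cinner_scaleC_right scaleC_blinfun.rep_eq)
  qed
  also have "\<dots> = \<mu> $ i / of_real (r\<^sup>2) * (of_real r * cinner y (kern r \<mu>))" by simp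
  finally have "cinner ((shifts r $ i) y) (kern r \<mu>)
      = of_real r * (\<mu> $ i / of_real (r\<^sup>2) * (of_real r * cinner y (kern r \<mu>)))"
    by (simp add: scaleC_blinfun.rep_eq cinner_scaleC_left)
  also have "\<dots> = \<mu> $ i * cinner y (kern r \<mu>)"
    using r by (simp add: power2_eq_square)
  finally show "cinner ((shifts r $ i) y) (kern r \<mu>) = \<mu> $ i * cinner y (kern r \<mu>)" .
  have "(norm (kern r \<mu>))\<^sup>2 \<le> 1 / (1 - (norm \<nu>)\<^sup>2)"
    unfolding k using r by (intro norm_ev_shifts_le hol_coeffs_wsc l2_le_wsc \<nu>1) auto
  then show "(norm (kern r \<mu>))\<^sup>2 \<le> 1 / (1 - (norm \<mu> / r\<^sup>2)\<^sup>2)"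
    unfolding \<nu>_def norm_kern_arg .
qed

text \<open>The vector \<open>kern r \<mu>\<close> is wandering for \<open>aut \<mu> (shifts r)\<close>, which bounds the convolution of
  the coefficients of \<open>f \<circ> aut \<mu>\<close> with those of a resolvent; the resolvent is then divided out
  from the right by comparing a word with the word without its last letter.\<close>

lemma comp_coeff_aut_bounded:
  fixes \<mu> :: "complex ^ 'n"
  assumes \<mu>: "norm \<mu> < 1"
  obtains K where "\<And>a C. l2_le a C \<Longrightarrow> l2_le (comp_coeff (aut_coeff \<mu>) a) (K * C)"
proof -
  \<comment> \<open>A number strictly between \<open>norm \<mu>\<close> and 1. For \<open>r\<close>
    beyond \<open>r0\<close> the parameter of the kernel has norm below \<open>q\<close>, so
    \<open>B\<close> bounds the squared norms of the kernel vectors uniformly in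
    \<open>r\<close>.\<close>
  define q where "q = (1 + norm \<mu>) / 2"
  have q: "0 < q" "q < 1" "norm \<mu> < q" using \<mu> by (auto simp: q_def add_pos_nonneg)
  define r0 where "r0 = sqrt (norm \<mu> / q)"
  have r0: "r0 < 1" using q by (simp add: r0_def)
  define B where "B = 1 / (1 - q\<^sup>2)"
  define K where "K = (2 + 2 * real CARD('n)) * B"
  show thesis
  proof (rule that[of K])
    fix a :: "'n list \<Rightarrow> complex" and C assume a: "l2_le a C"
    define b where "b = comp_coeff (aut_coeff \<mu>) a"
    note \<phi> = self_map_coeffs_aut[OF \<mu>]
    have C0: "0 \<le> C" by (rule l2_le_nonneg[OF a])
    have b: "hol_coeffs b" unfolding b_def by (rule hol_coeffs_comp[OF \<phi> l2_le_hol_coeffs[OF a]])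
    have zero: "sev (aut_coeff \<mu> i) \<mu> = 0" for i
    proof -
      have "(\<chi> i. sev (aut_coeff \<mu> i) \<mu>) = 0"
        using scalar_tuple_inject sev_self_map[OF \<phi> \<mu>] aut_center[OF \<mu>] by metis
      then show ?thesis by (simp add: vec_eq_iff)
    qed
    show "l2_le b (K * C)"
    proof (rule l2_le_dilation_limit[OF r0])
      fix r :: real assume r: "r0 < r" "0 < r" "r < 1"
      define \<nu> where "\<nu> = of_real (1 / r\<^sup>2) *s vcnj \<mu>"
      have "norm \<mu> / q < r\<^sup>2"
      proof -
        have "r0\<^sup>2 < r\<^sup>2" using r q by (intro power_strict_mono) (auto simp: r0_def)
        then show ?thesis using q by (simp add: r0_def)
      qed
      then have \<mu>q: "norm \<mu> / r\<^sup>2 < q" using q r by (simp add: field_simps)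
      have \<mu>r: "norm \<mu> < r\<^sup>2"
      proof -
        have "norm \<mu> / r\<^sup>2 < 1" using \<mu>q q by linarith
        then show ?thesis using r by simp
      qed
      have \<nu>q: "norm \<nu> < q" using \<mu>q unfolding \<nu>_def norm_kern_arg .
      then have \<nu>1: "norm \<nu> < 1" using q by simp
      define F where "F = ev b (shifts r)"
      \<comment> \<open>The dilated coefficients of the product of \<open>b\<close> with the
        resolvent. Their square sum is controlled because the kernel vector is wandering.\<close>
      define t where "t \<gamma> = cinner (F (kern r \<mu>)) (e \<gamma>)" for \<gamma>
      have X: "shifts r \<in> nc_ball" using r by (simp add: shifts_nc_ball)
      have "F (kern r \<mu>) = ev (conv b (wsc \<nu>)) (shifts r) (e [])"
        by (simp only: F_def kern_def \<nu>_def[symmetric] ev_conv[OF b hol_coeffs_wsc[OF \<nu>1] X]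
            blinfun_apply_blinfun_compose)
      then have t: "t \<gamma> = of_real (r ^ length \<gamma>) * conv b (wsc \<nu>) \<gamma>" for \<gamma>
        using cinner_ev_shifts[OF hol_coeffs_conv[OF b hol_coeffs_wsc[OF \<nu>1]], of r \<gamma>] r by (simp add: t_def)
      have "(norm (kern r \<mu>))\<^sup>2 \<le> B"
      proof -
        have "(norm \<mu> / r\<^sup>2)\<^sup>2 \<le> q\<^sup>2" using \<mu>q q by (intro power_mono) auto
        moreover have "q\<^sup>2 < 1" using q by (simp add: power_less_one_iff)
        ultimately have "1 / (1 - (norm \<mu> / r\<^sup>2)\<^sup>2) \<le> B" unfolding B_def by (intro divide_left_mono) auto
        then show ?thesis using norm_kern_le[OF r(2,3) \<mu>r] by linarith
      qed
      moreover have "(norm (F (kern r \<mu>)))\<^sup>2 \<le> C * (norm (kern r \<mu>))\<^sup>2"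
        unfolding F_def b_def
        by (rule comp_coeff_wandering[OF \<phi> a X cinner_shifts_kern[OF r(2,3) \<mu>r] \<mu> zero])
      ultimately have "(norm (F (kern r \<mu>)))\<^sup>2 \<le> C * B"
        using C0 by (meson mult_left_mono order_trans)
      then have tl: "l2_le t (C * B)"
        unfolding t_def using l2_le_mono[OF l2_le_e] by blast
      have "l2_le (\<lambda>\<gamma>. of_real (r ^ length \<gamma>) * b \<gamma>) (2 * (C * B) + 2 * (real CARD('n) * (C * B)))"
      proof (rule l2_le_add[OF tl l2_le_butlast[OF tl]])
        fix \<gamma> :: "'n list"
        show "cmod (of_real (r ^ length \<gamma>) * b \<gamma>) \<le> cmod (t \<gamma>) + cmod (if \<gamma> = [] then 0 else t (butlast \<gamma>))"
        proof (cases \<gamma> rule: rev_cases)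
          case Nil
          then show ?thesis by (simp add: t)
        next
          case (snoc \<beta> j)
          have "cmod (of_real r * \<nu> $ j) \<le> 1"
            using r \<nu>1 Finite_Cartesian_Product.norm_nth_le[of \<nu> j] by (auto simp: norm_mult intro!: mult_le_one)
          then have "cmod (t \<beta> * (of_real r * \<nu> $ j)) \<le> cmod (t \<beta>)"
            using mult_left_mono[OF _ norm_ge_zero[of "t \<beta>"]] by (simp only: norm_mult[of "t \<beta>"]) fastforce
          moreover have "of_real (r ^ length \<gamma>) * b \<gamma> = t \<gamma> - t \<beta> * (of_real r * \<nu> $ j)"
            by (simp add: snoc t conv_wsc_snoc algebra_simps)
          ultimately show ?thesis
            using norm_triangle_ineq4[of "t \<gamma>" "t \<beta> * (of_real r * \<nu> $ j)"] snoc by simp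
        qed
      qed
      then show "l2_le (\<lambda>\<gamma>. of_real (r ^ length \<gamma>) * b \<gamma>) (K * C)"
        by (simp add: K_def algebra_simps)
    qed
  qed
qed

text \<open>The automorphism is an involution, so \<open>?V\<close> is its own inverse and also
  serves as \<open>W\<close>. The bound for \<open>comp_op \<phi>\<close> is obtained from the
  factorisation, since similarity includes boundedness.\<close>

lemma fixpoint_imp_similar:
  fixes \<phi> :: "('h \<Rightarrow>\<^sub>L 'h) ^ 'n \<Rightarrow> ('h \<Rightarrow>\<^sub>L 'h) ^ 'n"
  assumes \<phi>: "self_map_coeffs \<phi> c" and \<xi>: "norm \<xi> < 1" "\<phi> (scalar_tuple \<xi>) = scalar_tuple \<xi>"
  shows "similar_to_contraction_on H2_ball H2_norm (comp_op \<phi>)"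
proof -
  let ?\<Phi> = "aut \<xi> :: ('h \<Rightarrow>\<^sub>L 'h) ^ 'n \<Rightarrow> _"
  define \<psi> where "\<psi> = ?\<Phi> \<circ> (\<phi> \<circ> ?\<Phi>)"
  note \<Phi> = self_map_coeffs_aut[OF \<xi>(1)]
  obtain d where \<psi>: "self_map_coeffs \<psi> d"
    using self_map_coeffs_compose[OF self_map_coeffs_compose[OF \<Phi> \<phi>] \<Phi>] unfolding \<psi>_def by blast
  have inv: "?\<Phi> (?\<Phi> X) = X" if "X \<in> nc_ball" for X by (rule aut_involution[OF \<xi>(1) that])
  have \<Phi>0: "?\<Phi> (scalar_tuple 0) = scalar_tuple \<xi>"
    using inv[OF scalar_tuple_nc_ball[OF \<xi>(1)]] by (simp add: aut_center[OF \<xi>(1)])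
  have "\<psi> (scalar_tuple 0) = scalar_tuple 0"
    by (simp add: \<psi>_def \<Phi>0 \<xi>(2) aut_center[OF \<xi>(1)])
  then have "scalar_tuple (\<chi> i. sev (d i) 0) = (scalar_tuple 0 :: ('h \<Rightarrow>\<^sub>L 'h) ^ 'n)"
    using sev_self_map[OF \<psi>, of 0] by simp
  then have "sev (d i) 0 = 0" for i
    using scalar_tuple_inject by (fastforce simp: vec_eq_iff)
  then have dl: "l2_le a C \<Longrightarrow> l2_le (comp_coeff d a) (1 * C)" for a C
    using littlewood_subordination[OF \<psi>] by simp
  obtain K where K: "\<And>a C. l2_le a C \<Longrightarrow> l2_le (comp_coeff (aut_coeff \<xi>) a) (K * C)"
    using comp_coeff_aut_bounded[OF \<xi>(1)] by blast
  let ?V = "comp_op ?\<Phi>" and ?A = "comp_op \<psi>"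
  have V: "bounded_op_on H2_ball H2_norm ?V" by (rule comp_op_bounded[OF \<Phi> K])
  have A: "bounded_op_on H2_ball H2_norm ?A" by (rule comp_op_bounded[OF \<psi> dl])
  have A1: "H2_norm (?A f) \<le> H2_norm f" if "f \<in> H2_ball" for f
    using comp_op_bounded(2)[OF \<psi> dl that] by simp
  have VH: "?V f \<in> H2_ball" if "f \<in> H2_ball" for f using V that by (simp add: bounded_op_on_def)
  have AH: "?A f \<in> H2_ball" if "f \<in> H2_ball" for f using A that by (simp add: bounded_op_on_def)
  have \<Phi>b: "X \<in> nc_ball \<Longrightarrow> ?\<Phi> X \<in> nc_ball" for X by (rule self_map_coeffs_nc_ball[OF \<Phi>])
  have \<phi>b: "X \<in> nc_ball \<Longrightarrow> \<phi> X \<in> nc_ball" for X by (rule self_map_coeffs_nc_ball[OF \<phi>])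
  have out: "f X = 0" if "f \<in> H2_ball" "X \<notin> nc_ball" for f and X :: "('h \<Rightarrow>\<^sub>L 'h) ^ 'n"
    using that by (simp add: H2_ball_def)
  have VV: "?V (?V f) = f" if "f \<in> H2_ball" for f
    using that VH[OF that] by (auto simp: fun_eq_iff comp_op_apply[OF \<Phi>] \<Phi>b inv out)
  have \<psi>X: "\<psi> X = ?\<Phi> (\<phi> (?\<Phi> X))" for X by (simp add: \<psi>_def)
  have T: "comp_op \<phi> f = ?V (?A (?V f))" if "f \<in> H2_ball" for f
    using that VH[OF that] AH[OF VH[OF that]]
    by (auto simp: fun_eq_iff comp_op_apply[OF \<Phi>] comp_op_apply[OF \<psi>] comp_op_apply[OF \<phi>] \<Phi>b \<phi>b inv \<psi>X)
  obtain MV where MV: "\<And>f. f \<in> H2_ball \<Longrightarrow> H2_norm (?V f) \<le> MV * H2_norm f"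
    using V unfolding bounded_op_on_def by blast
  \<comment> \<open>The constant in \<open>bounded_op_on\<close> carries no sign; chaining the
    inequalities needs a nonnegative one.\<close>
  have MV': "H2_norm (?V f) \<le> \<bar>MV\<bar> * H2_norm f" if "f \<in> H2_ball" for f
    using MV[OF that] mult_right_mono[OF abs_ge_self H2_norm_nonneg, of MV f] by linarith
  have "bounded_op_on H2_ball H2_norm (comp_op \<phi>)"
    unfolding bounded_op_on_def
  proof (intro conjI ballI allI exI)
    fix f assume f: "f \<in> (H2_ball :: (('h \<Rightarrow>\<^sub>L 'h) ^ 'n \<Rightarrow> _) set)"
    show "comp_op \<phi> f \<in> H2_ball" using T[OF f] VH AH f by simp
    have "H2_norm (comp_op \<phi> f) \<le> \<bar>MV\<bar> * H2_norm (?A (?V f))"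
      using T[OF f] MV'[OF AH[OF VH[OF f]]] by simp
    also have "\<dots> \<le> \<bar>MV\<bar> * (\<bar>MV\<bar> * H2_norm f)"
      using A1[OF VH[OF f]] MV'[OF f] by (intro mult_left_mono) auto
    finally show "H2_norm (comp_op \<phi> f) \<le> (\<bar>MV\<bar> * \<bar>MV\<bar>) * H2_norm f" by simp
  qed (auto simp: fun_eq_iff comp_op_apply[OF \<phi>] H2_ball_add H2_ball_scale)
  moreover have "op_norm_on H2_ball H2_norm ?A \<le> 1"
    unfolding op_norm_on_def
  proof (rule cSUP_least)
    show "{f \<in> (H2_ball :: (('h \<Rightarrow>\<^sub>L 'h) ^ 'n \<Rightarrow> _) set). H2_norm f \<le> 1} \<noteq> {}"
      using H2_ball_zero by force
  qed (use A1 in force)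
  ultimately show ?thesis
    unfolding similar_to_contraction_on_def using V A VV T by blast
qed

end

section \<open>Von Neumann's inequality\<close>

text \<open>Sums over these roots replace integrals over the circle, so the harmonic analysis in von
  Neumann's inequality stays finite.\<close>

definition unity_roots :: "nat \<Rightarrow> complex set" where
  "unity_roots m = {z. z ^ m = 1}"

lemma unity_roots_norm: "m > 0 \<Longrightarrow> z \<in> unity_roots m \<Longrightarrow> cmod z = 1"
  using power_eq_iff_eq_base[of m "cmod z" 1] by (simp add: unity_roots_def flip: norm_power)

lemma unity_roots_orthogonal:
  assumes "k < m" "l < m"
  shows "(\<Sum>z\<in>unity_roots m. z ^ k * cnj (z ^ l)) = (if k = l then of_nat m else 0)"
proof -
  have m: "m > 0" using assms by simp
  have c1: "z ^ j * cnj (z ^ j) = 1" if "z \<in> unity_roots m" for z j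
    using unity_roots_norm[OF m that]
    by (simp only: complex_norm_square[symmetric] norm_power) simp
  show ?thesis
  proof (cases "k = l")
    case True
    then show ?thesis
      using c1 card_roots_unity_eq[OF m] by (simp add: unity_roots_def[symmetric])
  next
    case False
    \<comment> \<open>Multiplication by the primitive root permutes the roots of unity and scales
      the sum by \<open>\<zeta> ^ k * cnj (\<zeta> ^ l)\<close>. This differs from 1 for distinct
      exponents below \<open>m\<close>, so the sum vanishes.\<close>
    define \<zeta> where "\<zeta> = cis (2 * pi / real m)"
    have pow: "\<zeta> ^ j = cis (2 * pi * real j / real m)" for j
      by (simp add: \<zeta>_def Complex.DeMoivre mult_ac)
    have \<zeta>: "\<zeta> \<in> unity_roots m" using m by (simp add: unity_roots_def pow)
    have "\<zeta> ^ k \<noteq> \<zeta> ^ l"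
      using bij_betw_imp_inj_on[OF Complex.bij_betw_roots_unity[OF m]] assms False
      unfolding pow inj_on_def by fastforce
    then have ne: "\<zeta> ^ k * cnj (\<zeta> ^ l) \<noteq> 1"
      using c1[OF \<zeta>, of l] by (metis mult_cancel_right mult_zero_right zero_neq_one)
    have \<zeta>0: "\<zeta> \<noteq> 0" using unity_roots_norm[OF m \<zeta>] by auto
    define S where "S = (\<Sum>z\<in>unity_roots m. z ^ k * cnj (z ^ l))"
    have "bij_betw (\<lambda>z. \<zeta> * z) (unity_roots m) (unity_roots m)"
      using \<zeta> \<zeta>0
      by (intro bij_betw_byWitness[where f' = "\<lambda>z. z / \<zeta>"])
        (auto simp: unity_roots_def power_mult_distrib power_divide)
    then have "S = (\<Sum>z\<in>unity_roots m. (\<zeta> * z) ^ k * cnj ((\<zeta> * z) ^ l))"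
      unfolding S_def by (rule sum.reindex_bij_betw[symmetric])
    also have "\<dots> = (\<zeta> ^ k * cnj (\<zeta> ^ l)) * S"
      unfolding S_def sum_distrib_left by (intro sum.cong) (simp_all add: power_mult_distrib)
    finally have "S = 0" using ne by (metis mult_cancel_right1)
    with False show ?thesis by (simp add: S_def)
  qed
qed

lemma unity_roots_parseval:
  fixes W :: "nat \<Rightarrow> 'h::complex_inner"
  assumes "m > 0"
  shows "(\<Sum>z\<in>unity_roots m. (norm (\<Sum>k<m. z ^ k *\<^sub>C W k))\<^sup>2) = real m * (\<Sum>k<m. (norm (W k))\<^sup>2)"
proof -
  have "complex_of_real (\<Sum>z\<in>unity_roots m. (norm (\<Sum>k<m. z ^ k *\<^sub>C W k))\<^sup>2)
      = (\<Sum>z\<in>unity_roots m. \<Sum>k<m. \<Sum>l<m. (z ^ k * cnj (z ^ l)) * cinner (W k) (W l))"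
    unfolding of_real_sum cinner_self[symmetric] cinner_sum_left
    by (simp only: cinner_sum_right cinner_scaleC_left cinner_scaleC_right mult_ac)
  also have "\<dots> = (\<Sum>k<m. \<Sum>l<m. (\<Sum>z\<in>unity_roots m. z ^ k * cnj (z ^ l)) * cinner (W k) (W l))"
    unfolding sum_distrib_right by (subst sum.swap, intro sum.cong refl, subst sum.swap, rule refl)
  also have "\<dots> = (\<Sum>k<m. \<Sum>l<m. if k = l then of_nat m * cinner (W k) (W l) else 0)"
    by (intro sum.cong refl) (simp add: unity_roots_orthogonal del: complex_cnj_power)
  also have "\<dots> = complex_of_real (real m * (\<Sum>k<m. (norm (W k))\<^sup>2))"
    by (simp add: cinner_self sum_distrib_left)
  finally show ?thesis by (simp only: of_real_eq_iff)
qed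

text \<open>The finite Fourier transform diagonalises cyclic shifts: a shift by \<open>j\<close>
  becomes multiplication by \<open>cnj z ^ j\<close>, hence a polynomial in the shift becomes
  multiplication by its value at \<open>cnj z\<close>.\<close>

lemma cyclic_shift_transform:
  fixes y :: "nat \<Rightarrow> 'h::complex_inner"
  assumes m: "m > 0" and z: "z \<in> unity_roots m"
  shows "(\<Sum>k<m. z ^ k *\<^sub>C (\<Sum>j\<le>d. p j *\<^sub>C y ((k + j) mod m)))
    = (\<Sum>j\<le>d. p j * cnj z ^ j) *\<^sub>C (\<Sum>k<m. z ^ k *\<^sub>C y k)"
proof -
  have z1: "z * cnj z = 1" using unity_roots_norm[OF m z] by (simp add: complex_norm_square[symmetric])
  have zm: "z ^ (k mod m) = z ^ k" for k
  proof -
    have "z ^ k = z ^ (m * (k div m) + k mod m)" by simp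
    also have "\<dots> = z ^ (k mod m)"
      using z unfolding power_add power_mult by (simp add: unity_roots_def)
    finally show ?thesis ..
  qed
  have shift: "(\<Sum>k<m. z ^ k *\<^sub>C y ((k + j) mod m)) = cnj z ^ j *\<^sub>C (\<Sum>k<m. z ^ k *\<^sub>C y k)" for j
  proof -
    have eq: "z ^ k = cnj z ^ j * z ^ ((k + j) mod m)" for k
    proof -
      have "cnj z ^ j * z ^ (k + j) = z ^ k * (z * cnj z) ^ j"
        by (simp only: power_add power_mult_distrib) (simp only: mult_ac)
      then show ?thesis using z1 by (simp add: zm)
    qed
    have "bij_betw (\<lambda>k. (k + j) mod m) {..<m} {..<m}"
    proof -
      \<comment> \<open>The shift by \<open>l\<close> is inverse to the shift by \<open>j\<close>
        modulo \<open>m\<close>.\<close>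
      define l where "l = m - j mod m"
      have "j mod m \<le> m" using m by (simp add: less_imp_le)
      then have "j + l = m * (j div m) + m"
        using mult_div_mod_eq[of m j] unfolding l_def by linarith
      then have l: "(k + j + l) mod m = k mod m" for k
        by (metis add.assoc mod_add_self2 mod_mult_self2)
      show ?thesis
        using m l
        by (intro bij_betw_byWitness[where f' = "\<lambda>k. (k + l) mod m"])
          (auto simp: mod_add_left_eq, simp add: add.commute add.left_commute)
    qed
    then have "(\<Sum>k<m. z ^ k *\<^sub>C y k) = (\<Sum>k<m. z ^ ((k + j) mod m) *\<^sub>C y ((k + j) mod m))"
      by (rule sum.reindex_bij_betw[symmetric])
    then show ?thesis
      by (simp only: scaleC_sum_right scaleC_scaleC eq[symmetric])
  qed
  have "(\<Sum>k<m. z ^ k *\<^sub>C (\<Sum>j\<le>d. p j *\<^sub>C y ((k + j) mod m)))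
      = (\<Sum>j\<le>d. p j *\<^sub>C (\<Sum>k<m. z ^ k *\<^sub>C y ((k + j) mod m)))"
    unfolding scaleC_sum_right scaleC_scaleC by (subst sum.swap) (simp only: mult.commute)
  also have "\<dots> = (\<Sum>j\<le>d. p j * cnj z ^ j) *\<^sub>C (\<Sum>k<m. z ^ k *\<^sub>C y k)"
    by (simp only: shift scaleC_scaleC scaleC_sum_left)
  finally show ?thesis .
qed

text \<open>The orbit \<open>x\<^sub>k = A\<^sup>k x\<^sub>0\<close> of a contraction \<open>A\<close>, without reference to \<open>A\<close>.  The quadratic form
  \<open>\<parallel>v\<parallel>\<^sup>2 - \<parallel>A v\<parallel>\<^sup>2\<close> is positive, so Parseval's identity on the cyclic group of order \<open>N + d\<close>
  bounds its sum over the vectors \<open>p(A) A\<^sup>k x\<^sub>0\<close>, which telescopes.\<close>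

lemma von_neumann_truncated:
  fixes y :: "nat \<Rightarrow> 'h::complex_inner"
  assumes contr: "\<And>m c. norm (\<Sum>k<m. c k *\<^sub>C y (Suc k)) \<le> norm (\<Sum>k<m. c k *\<^sub>C y k)"
    and S: "\<And>z. cmod z \<le> 1 \<Longrightarrow> cmod (\<Sum>j\<le>d. p j * z ^ j) \<le> S"
  shows "(norm (\<Sum>j\<le>d. p j *\<^sub>C y j))\<^sup>2
    \<le> S\<^sup>2 * (norm (y 0))\<^sup>2 + (norm (\<Sum>j\<le>d. p j *\<^sub>C y (N + j)))\<^sup>2"
proof -
  \<comment> \<open>For \<open>k < N\<close> and \<open>j \<le> d\<close> the index
    \<open>k + j\<close> stays below \<open>m\<close>, so \<open>W\<close> and \<open>V\<close>
    agree there; the successor keeps \<open>m\<close> positive also for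
    \<open>N = d = 0\<close>.\<close>
  define m where "m = Suc (N + d)"
  have m: "m > 0" by (simp add: m_def)
  define V where "V k = (\<Sum>j\<le>d. p j *\<^sub>C y (k + j))" for k
  define W where "W k = (\<Sum>j\<le>d. p j *\<^sub>C y ((k + j) mod m))" for k
  define W' where "W' k = (\<Sum>j\<le>d. p j *\<^sub>C y (Suc ((k + j) mod m)))" for k
  have WW: "norm (W' k) \<le> norm (W k)" for k
  proof -
    \<comment> \<open>The coefficients falling on index \<open>i\<close> after wrapping, which puts
      \<open>W k\<close> and \<open>W' k\<close> into the form required by
      \<open>contr\<close>.\<close>
    define c where "c i = (\<Sum>j\<in>{j\<in>{..d}. (k + j) mod m = i}. p j)" for i
    have group: "(\<Sum>j\<le>d. p j *\<^sub>C u ((k + j) mod m)) = (\<Sum>i<m. c i *\<^sub>C u i)" for u :: "nat \<Rightarrow> 'h"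
    proof -
      have "(\<Sum>i<m. c i *\<^sub>C u i)
          = (\<Sum>i<m. \<Sum>j\<in>{j\<in>{..d}. (k + j) mod m = i}. p j *\<^sub>C u ((k + j) mod m))"
        unfolding c_def scaleC_sum_left by (intro sum.cong) auto
      also have "\<dots> = (\<Sum>j\<le>d. p j *\<^sub>C u ((k + j) mod m))"
        using m by (intro sum.group) auto
      finally show ?thesis ..
    qed
    show ?thesis
      unfolding W_def W'_def using contr[where m = m and c = c] group[of y] group[of "\<lambda>i. y (Suc i)"] by simp
  qed
  have V: "W k = V k" "W' k = V (Suc k)" if "k < N" for k
    using that by (auto simp: W_def W'_def V_def m_def intro!: sum.cong)
  define Z where "Z z = (\<Sum>k<m. z ^ k *\<^sub>C y k)" for z
  define Z' where "Z' z = (\<Sum>k<m. z ^ k *\<^sub>C y (Suc k))" for z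
  define P where "P z = (\<Sum>j\<le>d. p j * cnj z ^ j)" for z
  have "(norm (V 0))\<^sup>2 - (norm (V N))\<^sup>2 = (\<Sum>k<N. (norm (V k))\<^sup>2 - (norm (V (Suc k)))\<^sup>2)"
    using sum_lessThan_telescope'[of "\<lambda>k. (norm (V k))\<^sup>2" N] by simp
  also have "\<dots> = (\<Sum>k<N. (norm (W k))\<^sup>2 - (norm (W' k))\<^sup>2)"
    by (intro sum.cong) (auto simp: V)
  \<comment> \<open>Indices from \<open>N\<close> on are affected by wrapping, but they contribute
    nonnegative terms and may be added to reach the full cyclic group.\<close>
  also have "\<dots> \<le> (\<Sum>k<m. (norm (W k))\<^sup>2 - (norm (W' k))\<^sup>2)"
    using WW by (intro sum_mono2) (auto simp: m_def intro!: power_mono)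
  finally have "real m * ((norm (V 0))\<^sup>2 - (norm (V N))\<^sup>2)
      \<le> real m * (\<Sum>k<m. (norm (W k))\<^sup>2 - (norm (W' k))\<^sup>2)"
    by (intro mult_left_mono) auto
  also have "\<dots> = (\<Sum>z\<in>unity_roots m. (norm (\<Sum>k<m. z ^ k *\<^sub>C W k))\<^sup>2)
      - (\<Sum>z\<in>unity_roots m. (norm (\<Sum>k<m. z ^ k *\<^sub>C W' k))\<^sup>2)"
    by (simp only: unity_roots_parseval[OF m] sum_subtractf right_diff_distrib)
  also have "\<dots> = (\<Sum>z\<in>unity_roots m. (cmod (P z))\<^sup>2 * ((norm (Z z))\<^sup>2 - (norm (Z' z))\<^sup>2))"
    unfolding sum_subtractf[symmetric]
  proof (intro sum.cong refl)
    fix z assume z: "z \<in> unity_roots m"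
    have "(\<Sum>k<m. z ^ k *\<^sub>C W k) = P z *\<^sub>C Z z"
      unfolding W_def P_def Z_def by (rule cyclic_shift_transform[OF m z])
    moreover have "(\<Sum>k<m. z ^ k *\<^sub>C W' k) = P z *\<^sub>C Z' z"
      unfolding W'_def P_def Z'_def by (rule cyclic_shift_transform[OF m z, where y = "\<lambda>k. y (Suc k)"])
    ultimately show "(norm (\<Sum>k<m. z ^ k *\<^sub>C W k))\<^sup>2 - (norm (\<Sum>k<m. z ^ k *\<^sub>C W' k))\<^sup>2
        = (cmod (P z))\<^sup>2 * ((norm (Z z))\<^sup>2 - (norm (Z' z))\<^sup>2)"
      by (simp add: norm_scaleC power_mult_distrib right_diff_distrib)
  qed
  also have "\<dots> \<le> (\<Sum>z\<in>unity_roots m. S\<^sup>2 * ((norm (Z z))\<^sup>2 - (norm (Z' z))\<^sup>2))"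
  proof (intro sum_mono mult_right_mono power_mono)
    fix z assume z: "z \<in> unity_roots m"
    show "cmod (P z) \<le> S" unfolding P_def using unity_roots_norm[OF m z] by (intro S) simp
    have "(norm (Z' z))\<^sup>2 \<le> (norm (Z z))\<^sup>2"
      unfolding Z_def Z'_def by (intro power_mono contr) simp
    then show "0 \<le> (norm (Z z))\<^sup>2 - (norm (Z' z))\<^sup>2" by simp
  qed simp
  also have "\<dots> = S\<^sup>2 * ((\<Sum>z\<in>unity_roots m. (norm (Z z))\<^sup>2) - (\<Sum>z\<in>unity_roots m. (norm (Z' z))\<^sup>2))"
    by (simp only: sum_distrib_left[symmetric] sum_subtractf)
  also have "\<dots> = S\<^sup>2 * (real m * (\<Sum>k<m. (norm (y k))\<^sup>2 - (norm (y (Suc k)))\<^sup>2))"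
    unfolding Z_def Z'_def by (simp only: unity_roots_parseval[OF m] sum_subtractf right_diff_distrib)
  also have "(\<Sum>k<m. (norm (y k))\<^sup>2 - (norm (y (Suc k)))\<^sup>2) = (norm (y 0))\<^sup>2 - (norm (y m))\<^sup>2"
    using sum_lessThan_telescope'[of "\<lambda>k. (norm (y k))\<^sup>2" m] by simp
  also have "S\<^sup>2 * (real m * ((norm (y 0))\<^sup>2 - (norm (y m))\<^sup>2)) \<le> real m * (S\<^sup>2 * (norm (y 0))\<^sup>2)"
    by (simp add: mult_left_mono mult.left_commute[of "S\<^sup>2"])
  finally have "(norm (V 0))\<^sup>2 - (norm (V N))\<^sup>2 \<le> S\<^sup>2 * (norm (y 0))\<^sup>2"
    using m by simp
  then show ?thesis by (simp add: V_def)
qed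

text \<open>The truncated estimate leaves a remainder far out on the orbit. Replacing
  \<open>x k\<close> by \<open>r ^ k\<close> times it, r < 1, preserves the contraction hypothesis
  and sends the remainder to 0 as \<open>N\<close> grows; afterwards r tends to 1.\<close>

lemma von_neumann_inequality:
  fixes x :: "nat \<Rightarrow> 'h::complex_inner"
  assumes contr: "\<And>m c. norm (\<Sum>k<m. c k *\<^sub>C x (Suc k)) \<le> norm (\<Sum>k<m. c k *\<^sub>C x k)"
    and S: "\<And>z. cmod z \<le> 1 \<Longrightarrow> cmod (\<Sum>j\<le>d. p j * z ^ j) \<le> S"
  shows "norm (\<Sum>j\<le>d. p j *\<^sub>C x j) \<le> S * norm (x 0)"
proof -
  have S0: "0 \<le> S" using S[of 0] norm_ge_zero order_trans by (metis norm_zero zero_le_one)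
  have xk: "norm (x k) \<le> norm (x 0)" for k
  proof (induction k)
    case (Suc k)
    have "norm (\<Sum>i<Suc k. (if i = k then 1 else 0) *\<^sub>C x (Suc i))
        \<le> norm (\<Sum>i<Suc k. (if i = k then 1 else 0) *\<^sub>C x i)" by (rule contr)
    then show ?case using Suc by (simp add: scaleC_one)
  qed simp
  have main: "(norm (\<Sum>j\<le>d. p j *\<^sub>C (of_real (r ^ j) *\<^sub>C x j)))\<^sup>2 \<le> S\<^sup>2 * (norm (x 0))\<^sup>2"
    if r: "0 \<le> r" "r < 1" for r :: real
  proof -
    define y where "y k = complex_of_real (r ^ k) *\<^sub>C x k" for k
    have cy: "norm (\<Sum>k<m. c k *\<^sub>C y (Suc k)) \<le> norm (\<Sum>k<m. c k *\<^sub>C y k)" for m c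
    proof -
      have "(\<Sum>k<m. c k *\<^sub>C y (Suc k)) = of_real r *\<^sub>C (\<Sum>k<m. (c k * of_real (r ^ k)) *\<^sub>C x (Suc k))"
        by (simp add: y_def scaleC_sum_right scaleC_scaleC mult_ac)
      then have "norm (\<Sum>k<m. c k *\<^sub>C y (Suc k)) = r * norm (\<Sum>k<m. (c k * of_real (r ^ k)) *\<^sub>C x (Suc k))"
        using r by (simp add: norm_scaleC)
      also have "\<dots> \<le> 1 * norm (\<Sum>k<m. (c k * of_real (r ^ k)) *\<^sub>C x k)"
        using r by (intro mult_mono contr) auto
      also have "\<dots> = norm (\<Sum>k<m. c k *\<^sub>C y k)" by (simp add: y_def scaleC_scaleC)
      finally show ?thesis .
    qed
    have "(\<lambda>N. S\<^sup>2 * (norm (y 0))\<^sup>2 + (norm (\<Sum>j\<le>d. p j *\<^sub>C y (N + j)))\<^sup>2)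
        \<longlonglongrightarrow> S\<^sup>2 * (norm (y 0))\<^sup>2 + (norm (\<Sum>j\<le>d. p j *\<^sub>C (0::'h)))\<^sup>2"
    proof (intro tendsto_intros bounded_linear.tendsto[OF bounded_linear_scaleC_right])
      fix j
      have "y \<longlonglongrightarrow> 0"
      proof (rule Lim_null_comparison[OF always_eventually])
        show "\<forall>k. norm (y k) \<le> r ^ k * norm (x 0)"
          using r xk by (auto simp: y_def norm_scaleC norm_power intro!: mult_left_mono)
        show "(\<lambda>k. r ^ k * norm (x 0)) \<longlonglongrightarrow> 0"
          using r by (intro tendsto_mult_left_zero LIMSEQ_power_zero) simp
      qed
      then show "(\<lambda>N. y (N + j)) \<longlonglongrightarrow> 0" by (rule LIMSEQ_ignore_initial_segment)
    qed
    then have "(norm (\<Sum>j\<le>d. p j *\<^sub>C y j))\<^sup>2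
        \<le> S\<^sup>2 * (norm (y 0))\<^sup>2 + (norm (\<Sum>j\<le>d. p j *\<^sub>C (0::'h)))\<^sup>2"
      by (rule LIMSEQ_le_const) (use von_neumann_truncated[OF cy S] in blast)
    then show ?thesis by (simp add: y_def scaleC_one)
  qed
  define r where "r k = 1 - inverse (real (Suc k))" for k
  have "r \<longlonglongrightarrow> 1 - 0"
    unfolding r_def by (intro tendsto_diff tendsto_const LIMSEQ_inverse_real_of_nat)
  then have "(\<lambda>k. (norm (\<Sum>j\<le>d. p j *\<^sub>C (complex_of_real (r k ^ j) *\<^sub>C x j)))\<^sup>2)
      \<longlonglongrightarrow> (norm (\<Sum>j\<le>d. p j *\<^sub>C (complex_of_real ((1 - 0) ^ j) *\<^sub>C x j)))\<^sup>2"
    by (intro tendsto_power tendsto_norm tendsto_sum bounded_linear.tendsto[OF bounded_linear_scaleC_right]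
        bounded_linear.tendsto[OF bounded_linear_scaleC_left] tendsto_of_real)
  moreover have "0 \<le> r k" "r k < 1" for k by (simp_all add: r_def inverse_le_1_iff)
  ultimately have "(norm (\<Sum>j\<le>d. p j *\<^sub>C x j))\<^sup>2 \<le> S\<^sup>2 * (norm (x 0))\<^sup>2"
    using main by (intro LIMSEQ_le_const2) (auto simp: scaleC_one)
  then have "(norm (\<Sum>j\<le>d. p j *\<^sub>C x j))\<^sup>2 \<le> (S * norm (x 0))\<^sup>2" by (simp add: power_mult_distrib)
  then show ?thesis by (rule power2_le_imp_le) (simp add: S0)
qed

section \<open>Holomorphic self-maps of the Euclidean ball\<close>

definition cdot :: "complex ^ 'n::finite \<Rightarrow> complex ^ 'n \<Rightarrow> complex" where
  "cdot z w = (\<Sum>i\<in>UNIV. z $ i * cnj (w $ i))"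

lemma cdot_self: "cdot z z = of_real ((norm z)\<^sup>2)"
  by (simp add: cdot_def norm_vec_sq complex_norm_square del: of_real_power)

lemma cdot_commute: "cdot z w = cnj (cdot w z)"
  by (simp add: cdot_def mult.commute)

lemma cdot_add_left: "cdot (x + y) z = cdot x z + cdot y z"
  by (simp add: cdot_def distrib_right sum.distrib)

lemma cdot_scaleR_left: "cdot (r *\<^sub>R x) z = of_real r * cdot x z"
  unfolding cdot_def vector_scaleR_component scaleR_conv_of_real[of r "_ $ _"]
  by (simp only: sum_distrib_left mult.assoc)

lemma norm_cdot_le: "cmod (cdot z w) \<le> norm z * norm w"
proof -
  have "cmod (cdot z w) \<le> (\<Sum>i\<in>UNIV. \<bar>cmod (z $ i)\<bar> * \<bar>cmod (w $ i)\<bar>)"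
    unfolding cdot_def by (intro sum_norm_le) (simp add: norm_mult)
  also have "\<dots> \<le> norm z * norm w" unfolding norm_vec_def by (rule L2_set_mult_ineq)
  finally show ?thesis .
qed

lemma convex_norm_sq:
  fixes x y :: "'a::real_normed_vector"
  assumes "0 \<le> u" "0 \<le> v" "u + v = 1"
  shows "(norm (u *\<^sub>R x + v *\<^sub>R y))\<^sup>2 \<le> u * (norm x)\<^sup>2 + v * (norm y)\<^sup>2"
proof -
  define a b where "a = norm x" and "b = norm y"
  have "norm (u *\<^sub>R x + v *\<^sub>R y) \<le> u * a + v * b"
    using norm_triangle_ineq[of "u *\<^sub>R x" "v *\<^sub>R y"] assms by (simp add: a_def b_def)
  then have "(norm (u *\<^sub>R x + v *\<^sub>R y))\<^sup>2 \<le> (u * a + v * b)\<^sup>2" by (rule power_mono) simp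
  also have "\<dots> = u * a\<^sup>2 + v * b\<^sup>2 - u * v * (a - b)\<^sup>2"
  proof -
    have v: "v = 1 - u" using assms by simp
    show ?thesis unfolding v by (simp add: power2_eq_square algebra_simps)
  qed
  also have "\<dots> \<le> u * a\<^sup>2 + v * b\<^sup>2" using assms by simp
  finally show ?thesis by (simp add: a_def b_def)
qed

text \<open>By the Schwarz--Pick inequality \<open>g\<close> contracts the pseudohyperbolic distance, whose closed balls
  around the points of a bounded orbit are convex.  The increasing union of the intersections over the
  tails of the orbit is invariant under \<open>g\<close>.\<close>

lemma bounded_orbit_fixpoint:
  fixes g :: "complex ^ 'n::finite \<Rightarrow> complex ^ 'n"
  assumes ball: "\<And>z. norm z < 1 \<Longrightarrow> norm (g z) < 1"
    and cont: "\<And>r. r < 1 \<Longrightarrow> continuous_on (cball 0 r) g"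
    and pick: "\<And>z w. norm z < 1 \<Longrightarrow> norm w < 1 \<Longrightarrow>
      (cmod (1 - cdot (g z) (g w)))\<^sup>2 * ((1 - (norm z)\<^sup>2) * (1 - (norm w)\<^sup>2))
        \<le> (cmod (1 - cdot z w))\<^sup>2 * ((1 - (norm (g z))\<^sup>2) * (1 - (norm (g w))\<^sup>2))"
    and K: "\<And>k. 1 \<le> K * (1 - (norm ((g ^^ k) 0))\<^sup>2)"
  obtains \<xi> where "norm \<xi> < 1" "g \<xi> = \<xi>"
proof -
  define z where "z k = (g ^^ k) 0" for k
  have z1: "norm (z k) < 1" for k by (induction k) (auto simp: z_def ball)
  have zK: "1 \<le> K * (1 - (norm (z k))\<^sup>2)" for k using K by (simp add: z_def)
  have zpos: "0 < 1 - (norm (z k))\<^sup>2" for k using z1[of k] by (simp add: power_less_one_iff)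
  have K1: "1 \<le> K" using zK[of 0] by (simp add: z_def)
  \<comment> \<open>A rearrangement of \<open>(cmod (1 - cdot w (z k)))\<^sup>2 \<le> K * (1 - (norm
    (z k))\<^sup>2) * (1 - (norm w)\<^sup>2)\<close>, a closed pseudohyperbolic ball around
    \<open>z k\<close>. With all terms in \<open>w\<close> on the left, a convex function is bounded
    by a constant, which gives convexity.\<close>
  define D where "D N = {w. \<forall>k\<ge>N. (cmod (1 - cdot w (z k)))\<^sup>2 + K * (1 - (norm (z k))\<^sup>2) * (norm w)\<^sup>2
      \<le> K * (1 - (norm (z k))\<^sup>2)}" for N :: nat
  \<comment> \<open>Since \<open>1 - (norm (z N))\<^sup>2 \<ge> 1 / K\<close>, the left side of the
    ball inequality has \<open>cmod (1 - cdot w (z N)) \<ge> 1 / (2 * K)\<close>; the right side is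
    at most \<open>K * (1 - (norm w)\<^sup>2)\<close>. Dividing gives this margin, the same for all
    \<open>N\<close>.\<close>
  define \<eta> where "\<eta> = 1 / (4 * K ^ 3)"
  have \<eta>: "0 < \<eta>" using K1 by (simp add: \<eta>_def)
  have Dle: "(norm w)\<^sup>2 \<le> 1 - \<eta>" if "w \<in> D N" for w N
  proof -
    define b where "b = 1 - (norm (z N))\<^sup>2"
    have b: "0 < b" "b \<le> 1" "1 \<le> K * b" using zpos[of N] zK[of N] by (auto simp: b_def)
    have w: "(cmod (1 - cdot w (z N)))\<^sup>2 + K * b * (norm w)\<^sup>2 \<le> K * b"
      using that by (auto simp: D_def b_def)
    have "K * b * (norm w)\<^sup>2 \<le> K * b * 1"
      using w zero_le_power2[of "cmod (1 - cdot w (z N))"] by linarith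
    then have w1: "norm w \<le> 1" using b K1 by (simp add: power_le_one_iff)
    have "b / 2 \<le> 1 - norm (z N)"
    proof -
      have "b = (1 - norm (z N)) * (1 + norm (z N))" by (simp add: b_def power2_eq_square algebra_simps)
      also have "\<dots> \<le> (1 - norm (z N)) * 2" using z1[of N] by (intro mult_left_mono) auto
      finally show ?thesis by simp
    qed
    also have "\<dots> \<le> 1 - norm w * norm (z N)" using w1 by (simp add: mult_left_le_one_le)
    also have "\<dots> \<le> cmod (1 - cdot w (z N))"
      using norm_triangle_ineq2[of 1 "cdot w (z N)"] norm_cdot_le[of w "z N"] by simp
    finally have "(b / 2)\<^sup>2 \<le> (cmod (1 - cdot w (z N)))\<^sup>2" using b by (intro power_mono) auto
    moreover have "(1 / (2 * K))\<^sup>2 \<le> (b / 2)\<^sup>2"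
      using b K1 by (intro power_mono) (auto simp: field_simps)
    moreover have "K * b * (1 - (norm w)\<^sup>2) \<le> K * 1 * (1 - (norm w)\<^sup>2)"
      using b K1 w1 by (intro mult_right_mono mult_left_mono) (auto simp: power_le_one_iff)
    ultimately have "(1 / (2 * K))\<^sup>2 \<le> K * (1 - (norm w)\<^sup>2)" using w by (simp add: algebra_simps)
    then have "\<eta> \<le> 1 - (norm w)\<^sup>2" using K1 by (simp add: \<eta>_def field_simps power2_eq_square power3_eq_cube)
    then show ?thesis by simp
  qed
  have Dball: "norm w < 1" if "w \<in> D N" for w N
    using Dle[OF that] \<eta> by (smt (verit) norm_ge_zero one_le_power)
  have D0: "0 \<in> D N" for N using zK by (auto simp: D_def cdot_def)
  have Dmono: "D N \<subseteq> D M" if "N \<le> M" for N M using that by (auto simp: D_def)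
  have Dg: "g w \<in> D (Suc N)" if w: "w \<in> D N" for w N
    unfolding D_def
  proof (intro CollectI allI impI)
    fix k assume "Suc N \<le> k"
    then obtain l where k: "k = Suc l" "N \<le> l" by (cases k) auto
    have zk: "z k = g (z l)" by (simp add: z_def k)
    define p where "p = (1 - (norm w)\<^sup>2) * (1 - (norm (z l))\<^sup>2)"
    define p' where "p' = (1 - (norm (g w))\<^sup>2) * (1 - (norm (z k))\<^sup>2)"
    have p: "0 < p" "0 < p'"
      using zpos[of l] zpos[of k] Dball[OF w] ball[OF Dball[OF w]] by (auto simp: p_def p'_def power_less_one_iff)
    have "(cmod (1 - cdot w (z l)))\<^sup>2 + K * (1 - (norm (z l))\<^sup>2) * (norm w)\<^sup>2 \<le> K * (1 - (norm (z l))\<^sup>2)"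
      using w k by (auto simp: D_def)
    then have "(cmod (1 - cdot w (z l)))\<^sup>2 \<le> K * p" by (simp add: p_def algebra_simps)
    then have "(cmod (1 - cdot w (z l)))\<^sup>2 * p' \<le> K * p * p'" using p by (intro mult_right_mono) auto
    moreover have "(cmod (1 - cdot (g w) (z k)))\<^sup>2 * p \<le> (cmod (1 - cdot w (z l)))\<^sup>2 * p'"
      using pick[OF Dball[OF w] z1[of l]] by (simp add: p_def p'_def zk)
    ultimately have "(cmod (1 - cdot (g w) (z k)))\<^sup>2 * p \<le> (K * p') * p" by (simp add: mult_ac)
    then have "(cmod (1 - cdot (g w) (z k)))\<^sup>2 \<le> K * p'" using p by simp
    then show "(cmod (1 - cdot (g w) (z k)))\<^sup>2 + K * (1 - (norm (z k))\<^sup>2) * (norm (g w))\<^sup>2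
        \<le> K * (1 - (norm (z k))\<^sup>2)" by (simp add: p'_def algebra_simps)
  qed
  have Dconvex: "convex (D N)" for N
  proof (rule convexI)
    fix x y :: "complex ^ 'n" and u v :: real
    assume xy: "x \<in> D N" "y \<in> D N" and uv: "0 \<le> u" "0 \<le> v" "u + v = 1"
    show "u *\<^sub>R x + v *\<^sub>R y \<in> D N"
      unfolding D_def
    proof (intro CollectI allI impI)
      fix k assume "N \<le> k"
      define b where "b = K * (1 - (norm (z k))\<^sup>2)"
      define f where "f w = 1 - cdot w (z k)" for w
      have b: "0 \<le> b" using K1 zpos[of k] by (simp add: b_def)
      have x: "(cmod (f x))\<^sup>2 + b * (norm x)\<^sup>2 \<le> b" and y: "(cmod (f y))\<^sup>2 + b * (norm y)\<^sup>2 \<le> b"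
        using xy \<open>N \<le> k\<close> by (auto simp: D_def b_def f_def)
      have "f (u *\<^sub>R x + v *\<^sub>R y)
          = complex_of_real u * f x + complex_of_real v * f y + (1 - complex_of_real (u + v))"
        by (simp only: f_def cdot_add_left cdot_scaleR_left of_real_add) (simp add: algebra_simps)
      then have "f (u *\<^sub>R x + v *\<^sub>R y) = u *\<^sub>R f x + v *\<^sub>R f y"
        by (simp only: uv(3) scaleR_conv_of_real[of u "f x"] scaleR_conv_of_real[of v "f y"]) simp
      then have "(cmod (f (u *\<^sub>R x + v *\<^sub>R y)))\<^sup>2 \<le> u * (cmod (f x))\<^sup>2 + v * (cmod (f y))\<^sup>2"
        using convex_norm_sq[OF uv, of "f x" "f y"] by simp
      moreover have "b * (norm (u *\<^sub>R x + v *\<^sub>R y))\<^sup>2 \<le> b * (u * (norm x)\<^sup>2 + v * (norm y)\<^sup>2)"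
        by (intro mult_left_mono convex_norm_sq uv b)
      ultimately have "(cmod (f (u *\<^sub>R x + v *\<^sub>R y)))\<^sup>2 + b * (norm (u *\<^sub>R x + v *\<^sub>R y))\<^sup>2
          \<le> u * ((cmod (f x))\<^sup>2 + b * (norm x)\<^sup>2) + v * ((cmod (f y))\<^sup>2 + b * (norm y)\<^sup>2)"
        by (simp add: algebra_simps)
      also have "\<dots> \<le> u * b + v * b" using x y uv by (intro add_mono mult_left_mono) auto
      also have "\<dots> = b" using uv by (simp flip: distrib_right)
      finally show "(cmod (1 - cdot (u *\<^sub>R x + v *\<^sub>R y) (z k)))\<^sup>2
          + K * (1 - (norm (z k))\<^sup>2) * (norm (u *\<^sub>R x + v *\<^sub>R y))\<^sup>2 \<le> K * (1 - (norm (z k))\<^sup>2)"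
        by (simp add: f_def b_def)
    qed
  qed
  define U where "U = (\<Union>N. D N)"
  define r where "r = sqrt (1 - \<eta>)"
  have r: "r < 1" using \<eta> by (simp add: r_def)
  have "U \<subseteq> cball 0 r"
    using Dle by (auto simp: U_def r_def intro!: real_le_rsqrt)
  \<comment> \<open>The uniform margin matters here: the closure of the whole union stays in a
    closed ball of radius below 1, where \<open>g\<close> is continuous.\<close>
  then have cl: "closure U \<subseteq> cball 0 r" by (rule closure_minimal) simp
  have "convex U"
  proof (rule convexI)
    fix x y :: "complex ^ 'n" and u v :: real
    assume "x \<in> U" "y \<in> U" and uv: "0 \<le> u" "0 \<le> v" "u + v = 1"
    then obtain N M where "x \<in> D N" "y \<in> D M" by (auto simp: U_def)
    then have "x \<in> D (max N M)" "y \<in> D (max N M)"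
      using Dmono[of N "max N M"] Dmono[of M "max N M"] by auto
    then show "u *\<^sub>R x + v *\<^sub>R y \<in> U"
      using Dconvex uv unfolding U_def by (blast intro: convexD)
  qed
  have c: "continuous_on (closure U) g" using cont[OF r] cl by (rule continuous_on_subset)
  have "g ` U \<subseteq> closure U"
    using Dg closure_subset[of U] by (fastforce simp: U_def)
  then have "g ` closure U \<subseteq> closure U" by (intro image_closure_subset[OF c]) auto
  moreover have "compact (closure U)" using cl by (meson bounded_cball bounded_subset closed_closure compact_eq_bounded_closed)
  moreover have "closure U \<noteq> {}" using D0 by (auto simp: U_def closure_eq_empty)
  ultimately obtain \<xi> where "\<xi> \<in> closure U" "g \<xi> = \<xi>"
    using brouwer[OF _ convex_closure[OF \<open>convex U\<close>] _ c] by (auto simp: image_subset_iff_funcset)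
  moreover have "norm \<xi> < 1" using \<open>\<xi> \<in> closure U\<close> cl r by auto
  ultimately show thesis using that by blast
qed

section \<open>The four equivalent conditions\<close>

lemma continuous_on_wsc: "continuous_on S (\<lambda>\<mu>. wsc \<mu> \<alpha>)"
  by (induction \<alpha>) (auto intro!: continuous_intros)

lemma continuous_on_sev:
  assumes c: "hol_coeffs c" and r: "r < 1"
  shows "continuous_on (cball 0 r) (sev c)"
proof (cases "0 \<le> r")
  case True
  define f where "f k \<mu> = (\<Sum>\<alpha>\<in>words k. c \<alpha> * wsc \<mu> \<alpha>)" for k and \<mu> :: "complex ^ 'a"
  have "uniform_limit (cball 0 r) (\<lambda>n \<mu>. \<Sum>k<n. f k \<mu>) (\<lambda>\<mu>. \<Sum>k. f k \<mu>) sequentially"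
  proof (rule Weierstrass_m_test)
    fix k and \<mu> :: "complex ^ 'a" assume "\<mu> \<in> cball 0 r"
    then have \<mu>: "norm \<mu> \<le> r" by simp
    have "cmod (f k \<mu>) \<le> (\<Sum>\<alpha>\<in>words k. \<bar>cmod (c \<alpha>)\<bar> * \<bar>cmod (wsc \<mu> \<alpha>)\<bar>)"
      unfolding f_def by (intro sum_norm_le) (simp add: norm_mult)
    also have "\<dots> \<le> level c k * level (wsc \<mu>) k"
      unfolding level_def by (rule L2_set_mult_ineq)
    also have "\<dots> \<le> level c k * r ^ k"
      unfolding level_wsc using \<mu> by (intro mult_left_mono power_mono) auto
    finally show "norm (f k \<mu>) \<le> r ^ k * level c k" by (simp add: mult.commute)
  qed (use hol_coeffsD[OF c True r] in simp)
  then have "continuous_on (cball 0 r) (\<lambda>\<mu>. \<Sum>k. f k \<mu>)"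
    by (rule uniform_limit_theorem[rotated])
      (auto intro!: always_eventually continuous_intros continuous_on_wsc simp: f_def)
  then show ?thesis by (simp add: sev_def[abs_def] f_def)
next
  case False
  then have "cball (0 :: complex ^ 'a) r = {}" by simp
  then show ?thesis by simp
qed

text \<open>The form is evaluated at \<open>x = - cnj W\<close>, \<open>y = P\<close>, where it
  equals \<open>P * (P * Q - (cmod W)\<^sup>2)\<close>.\<close>

lemma positive_form_discriminant:
  fixes P Q :: real and W :: complex
  assumes "0 < P"
    and pos: "\<And>x y. 0 \<le> (cmod x)\<^sup>2 * P + (cmod y)\<^sup>2 * Q + 2 * Re (x * cnj y * W)"
  shows "(cmod W)\<^sup>2 \<le> P * Q"
proof -
  have "Re (- cnj W * cnj (of_real P) * W) = - P * (cmod W)\<^sup>2"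
  proof -
    have "- cnj W * cnj (of_real P) * W = - (of_real P * (W * cnj W))" by (simp add: mult_ac)
    also have "\<dots> = complex_of_real (- P * (cmod W)\<^sup>2)"
      unfolding complex_norm_square[symmetric] by simp
    finally show ?thesis by (metis Re_complex_of_real)
  qed
  then have "0 \<le> (cmod W)\<^sup>2 * P + P\<^sup>2 * Q - 2 * (P * (cmod W)\<^sup>2)"
    using pos[of "- cnj W" "of_real P"] by simp
  then have "P * (cmod W)\<^sup>2 \<le> P * (P * Q)" by (simp add: power2_eq_square algebra_simps)
  then show ?thesis using \<open>0 < P\<close> by simp
qed

context fock
begin

section \<open>Gram matrices of kernel vectors and the Schwarz--Pick inequality\<close>

lemma scalar_tuple_nc_ballD:
  assumes "(scalar_tuple \<mu> :: ('h \<Rightarrow>\<^sub>L 'h) ^ 'n) \<in> nc_ball"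
  shows "norm \<mu> < 1"
proof -
  obtain \<rho> where \<rho>: "0 \<le> \<rho>" "\<rho> < 1" "row_bound (scalar_tuple \<mu> :: ('h \<Rightarrow>\<^sub>L 'h) ^ 'n) \<rho>"
    using assms by (rule nc_ball_row_bound)
  define q where "q = (norm \<mu>)\<^sup>2"
  \<comment> \<open>Testing the row on these vectors, proportional to the conjugated entries, makes
    Cauchy--Schwarz an equality and yields
    \<open>q\<^sup>2 \<le> \<rho>\<^sup>2 * q\<close>.\<close>
  have eq: "(\<Sum>i\<in>UNIV. (scalar_tuple \<mu> $ i) (cnj (\<mu> $ i) *\<^sub>C e [])) = of_real q *\<^sub>C e []"
    by (simp add: scaleC_scaleC scaleC_sum_left q_def norm_vec_sq complex_norm_square del: of_real_power)
  have "(\<Sum>i\<in>UNIV. (norm (cnj (\<mu> $ i) *\<^sub>C e []))\<^sup>2) = q"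
    by (simp add: norm_scaleC q_def norm_vec_sq)
  moreover have "(norm (of_real q *\<^sub>C e []))\<^sup>2 = q\<^sup>2"
    by (simp add: norm_scaleC)
  ultimately have "q\<^sup>2 \<le> \<rho>\<^sup>2 * q"
    using row_boundD[OF \<rho>(3), of "\<lambda>i. cnj (\<mu> $ i) *\<^sub>C e []"] unfolding eq by simp
  then have "q \<le> \<rho>\<^sup>2" by (cases "q = 0") (auto simp: power2_eq_square q_def)
  also have "\<dots> < 1" using \<rho> by (simp add: power_less_one_iff)
  finally show ?thesis by (simp add: q_def power_less_one_iff)
qed

text \<open>Pairing the fixed point equation of \<open>kern r a\<close> with \<open>kern r b\<close>
  and using the eigenvector property of the latter gives a linear equation for the inner
  product.\<close>

lemma cinner_kern:
  assumes "0 < r" "r < 1" "norm a < r\<^sup>2" "norm b < r\<^sup>2"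
  shows "cinner (kern r a) (kern r b) * (1 - cdot b a / of_real (r\<^sup>2)) = 1"
proof -
  have "cinner (kern r a) (kern r b)
      = 1 + (\<Sum>i\<in>UNIV. cnj (a $ i) / of_real (r\<^sup>2) * (b $ i * cinner (kern r a) (kern r b)))"
    using arg_cong[OF kern_fixpoint[OF assms(1,2,3)], of "\<lambda>x. cinner x (kern r b)"]
    by (simp only: cinner_add_left cinner_sum_left cinner_scaleC_left
        cinner_e_kern[OF assms(1,2,4)] cinner_shifts_kern[OF assms(1,2,4)])
  also have "\<dots> = 1 + cdot b a / of_real (r\<^sup>2) * cinner (kern r a) (kern r b)"
    by (simp add: cdot_def sum_divide_distrib sum_distrib_left sum_distrib_right mult_ac)
  finally show ?thesis by (simp add: algebra_simps)
qed

lemma norm_kern_sq: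
  assumes "0 < r" "r < 1" "norm a < r\<^sup>2"
  shows "(norm (kern r a))\<^sup>2 * (1 - (norm a)\<^sup>2 / r\<^sup>2) = 1"
proof -
  have "complex_of_real ((norm (kern r a))\<^sup>2 * (1 - (norm a)\<^sup>2 / r\<^sup>2)) = 1"
    using cinner_kern[OF assms(1,2,3,3)] by (simp add: cinner_self cdot_self)
  then show ?thesis by (metis of_real_eq_1_iff)
qed

text \<open>The adjoints of the components of \<open>\<phi> (shifts r)\<close> have the kernel vectors as joint
  eigenvectors, so the row contractivity of \<open>\<phi> (shifts r)\<close> on the span of two of them is a positivity
  statement for a \<open>2 \<times> 2\<close> Pick matrix.\<close>

lemma schwarz_pick_dilated:
  fixes \<phi> :: "('h \<Rightarrow>\<^sub>L 'h) ^ 'n \<Rightarrow> ('h \<Rightarrow>\<^sub>L 'h) ^ 'n"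
  assumes \<phi>: "self_map_coeffs \<phi> c" and r: "0 < r" "r < 1" and ab: "norm a < r\<^sup>2" "norm b < r\<^sup>2"
  defines "g \<equiv> \<lambda>\<mu>. \<chi> i. sev (c i) \<mu>"
  assumes g: "norm (g a) < 1" "norm (g b) < 1"
  shows "(cmod (1 - cdot (g a) (g b)))\<^sup>2 * ((1 - (norm a)\<^sup>2 / r\<^sup>2) * (1 - (norm b)\<^sup>2 / r\<^sup>2))
    \<le> (cmod (1 - cdot a b / of_real (r\<^sup>2)))\<^sup>2 * ((1 - (norm (g a))\<^sup>2) * (1 - (norm (g b))\<^sup>2))"
proof -
  have r2: "r\<^sup>2 < 1" "0 < r\<^sup>2" using r by (auto simp: power_less_one_iff)
  have X: "shifts r \<in> nc_ball" using r by (simp add: shifts_nc_ball)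
  define Z where "Z = \<phi> (shifts r)"
  have Z: "Z \<in> nc_ball" unfolding Z_def by (rule self_map_coeffs_nc_ball[OF \<phi> X])
  note Zops = nc_ball_ops[OF Z]
  obtain \<rho> where \<rho>: "0 \<le> \<rho>" "\<rho> < 1" "row_bound Z \<rho>" using Z by (rule nc_ball_row_bound)
  have eig: "adj (Z $ i) (kern r \<mu>) = cnj (g \<mu> $ i) *\<^sub>C kern r \<mu>" if "norm \<mu> < r\<^sup>2" for i \<mu>
  proof (rule cinner_right_eqI)
    fix y
    have "Z $ i = ev (c i) (shifts r)" "hol_coeffs (c i)"
      using \<phi> X by (auto simp: self_map_coeffs_def Z_def)
    then have "cinner ((Z $ i) y) (kern r \<mu>) = sev (c i) \<mu> * cinner y (kern r \<mu>)"
      using that r2 by (simp add: cinner_ev_eigen[OF cinner_shifts_kern[OF r that] _ _ X])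
    then show "cinner y (adj (Z $ i) (kern r \<mu>)) = cinner y (cnj (g \<mu> $ i) *\<^sub>C kern r \<mu>)"
      by (simp add: cinner_adj[OF Zops, symmetric] cinner_scaleC_right g_def)
  qed
  define A where "A = (norm (kern r a))\<^sup>2"
  define D where "D = (norm (kern r b))\<^sup>2"
  define B where "B = cinner (kern r a) (kern r b)"
  define ga where "ga = 1 - (norm (g a))\<^sup>2"
  define gb where "gb = 1 - (norm (g b))\<^sup>2"
  define w where "w = 1 - cdot (g b) (g a)"
  define A' where "A' = 1 - (norm a)\<^sup>2 / r\<^sup>2"
  define D' where "D' = 1 - (norm b)\<^sup>2 / r\<^sup>2"
  define B' where "B' = 1 - cdot b a / of_real (r\<^sup>2)"
  have AA: "A * A' = 1" and DD: "D * D' = 1" and BB: "B * B' = 1"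
    using norm_kern_sq[OF r ab(1)] norm_kern_sq[OF r ab(2)] cinner_kern[OF r ab]
    by (simp_all only: A_def A'_def D_def D'_def B_def B'_def)
  have A0: "0 < A" "0 < D" using AA DD by (auto simp: A_def D_def zero_less_power2)
  have A1: "0 < A'" "0 < D'" using AA DD A0 by (metis zero_less_mult_pos zero_less_one)+
  have ga: "0 < ga" "0 < gb" using g by (auto simp: ga_def gb_def power_less_one_iff)
  \<comment> \<open>The form is \<open>(norm h)\<^sup>2\<close> minus the squared norm of the
    adjoint column of \<open>Z\<close> at the combination \<open>h\<close> of the two kernel
    vectors.\<close>
  have "0 \<le> (cmod x)\<^sup>2 * (A * ga) + (cmod y)\<^sup>2 * (D * gb) + 2 * Re (x * cnj y * (B * w))" for x y
  proof -
    define h where "h = x *\<^sub>C kern r a + y *\<^sub>C kern r b"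
    have sq: "(norm (p *\<^sub>C kern r a + q *\<^sub>C kern r b))\<^sup>2
        = (cmod p)\<^sup>2 * A + (cmod q)\<^sup>2 * D + 2 * Re (p * cnj q * B)" for p q
      by (simp only: norm_add_sq norm_scaleC power_mult_distrib cinner_scaleC_left cinner_scaleC_right
          A_def D_def B_def mult_ac add_ac)
    have "adj (Z $ i) h = (x * cnj (g a $ i)) *\<^sub>C kern r a + (y * cnj (g b $ i)) *\<^sub>C kern r b" for i
    proof (rule cinner_right_eqI)
      fix u
      show "cinner u (adj (Z $ i) h)
          = cinner u ((x * cnj (g a $ i)) *\<^sub>C kern r a + (y * cnj (g b $ i)) *\<^sub>C kern r b)"
        by (simp add: cinner_adj[OF Zops, symmetric] h_def cinner_add_right cinner_scaleC_right)
          (simp add: cinner_adj[OF Zops] eig ab cinner_scaleC_right mult.assoc)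
    qed
    then have "(\<Sum>i\<in>UNIV. (norm (adj (Z $ i) h))\<^sup>2)
        = (\<Sum>i\<in>UNIV. (cmod x)\<^sup>2 * A * (cmod (g a $ i))\<^sup>2 + (cmod y)\<^sup>2 * D * (cmod (g b $ i))\<^sup>2
            + 2 * Re (x * cnj y * B * (g b $ i * cnj (g a $ i))))"
      by (simp add: sq norm_mult power_mult_distrib mult_ac)
    also have "\<dots> = (cmod x)\<^sup>2 * A * (norm (g a))\<^sup>2 + (cmod y)\<^sup>2 * D * (norm (g b))\<^sup>2
            + 2 * Re (x * cnj y * B * cdot (g b) (g a))"
      unfolding cdot_def norm_vec_sq
      by (simp only: sum.distrib sum_distrib_left Re_sum)
    finally have "(cmod x)\<^sup>2 * A * (norm (g a))\<^sup>2 + (cmod y)\<^sup>2 * D * (norm (g b))\<^sup>2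
            + 2 * Re (x * cnj y * B * cdot (g b) (g a)) \<le> \<rho>\<^sup>2 * (norm h)\<^sup>2"
      using row_bound_adj[OF Zops \<rho>(3), of h] by simp
    also have "\<dots> \<le> 1 * (norm h)\<^sup>2"
      using \<rho> by (intro mult_right_mono) (auto simp: power_le_one)
    also have "\<dots> = (cmod x)\<^sup>2 * A + (cmod y)\<^sup>2 * D + 2 * Re (x * cnj y * B)"
      by (simp add: h_def sq)
    finally show ?thesis
      by (simp add: ga_def gb_def w_def algebra_simps)
  qed
  then have "(cmod (B * w))\<^sup>2 \<le> (A * ga) * (D * gb)"
    using A0 ga by (intro positive_form_discriminant) auto
  then have "(cmod B)\<^sup>2 * (cmod w)\<^sup>2 \<le> A * D * (ga * gb)"
    by (simp add: norm_mult power_mult_distrib mult_ac)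
  \<comment> \<open>The Gram entries \<open>A\<close>, \<open>D\<close>, \<open>B\<close> are
    reciprocals of \<open>A'\<close>, \<open>D'\<close>, \<open>B'\<close>; multiplying through
    trades them for the explicit expressions.\<close>
  then have "((cmod B)\<^sup>2 * (cmod w)\<^sup>2) * ((cmod B')\<^sup>2 * (A' * D')) \<le> (A * D * (ga * gb)) * ((cmod B')\<^sup>2 * (A' * D'))"
    using A1 by (intro mult_right_mono) auto
  moreover have "(cmod B)\<^sup>2 * (cmod B')\<^sup>2 = 1"
    using BB by (metis norm_mult norm_one one_power2 power_mult_distrib)
  then have "((cmod B)\<^sup>2 * (cmod w)\<^sup>2) * ((cmod B')\<^sup>2 * (A' * D')) = (cmod w)\<^sup>2 * (A' * D')"
    by (metis (no_types, opaque_lifting) mult.commute mult.left_commute mult_1)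
  moreover have "(A * D * (ga * gb)) * ((cmod B')\<^sup>2 * (A' * D')) = (A * A') * (D * D') * ((cmod B')\<^sup>2 * (ga * gb))"
    by (simp only: mult_ac)
  ultimately have fin: "(cmod w)\<^sup>2 * (A' * D') \<le> (cmod B')\<^sup>2 * (ga * gb)"
    by (simp add: AA DD)
  have "cmod w = cmod (1 - cdot (g a) (g b))"
    unfolding w_def cdot_commute[of "g b"] by (metis complex_cnj_diff complex_cnj_one complex_mod_cnj)
  moreover have "cmod B' = cmod (1 - cdot a b / of_real (r\<^sup>2))"
  proof -
    have "B' = cnj (1 - cdot a b / of_real (r\<^sup>2))" by (simp add: B'_def cdot_commute[of b])
    then show ?thesis by (simp only: complex_mod_cnj)
  qed
  ultimately show ?thesis using fin unfolding A'_def D'_def ga_def gb_def by simp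
qed

text \<open>The dilated inequality is available once \<open>r\<^sup>2\<close> exceeds both norms,
  and both sides are continuous as r tends to 1 from the left.\<close>

lemma schwarz_pick:
  fixes \<phi> :: "('h \<Rightarrow>\<^sub>L 'h) ^ 'n \<Rightarrow> ('h \<Rightarrow>\<^sub>L 'h) ^ 'n"
  assumes \<phi>: "self_map_coeffs \<phi> c" and ab: "norm a < 1" "norm b < 1"
  defines "g \<equiv> \<lambda>\<mu>. \<chi> i. sev (c i) \<mu>"
  assumes g: "norm (g a) < 1" "norm (g b) < 1"
  shows "(cmod (1 - cdot (g a) (g b)))\<^sup>2 * ((1 - (norm a)\<^sup>2) * (1 - (norm b)\<^sup>2))
    \<le> (cmod (1 - cdot a b))\<^sup>2 * ((1 - (norm (g a))\<^sup>2) * (1 - (norm (g b))\<^sup>2))"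
proof -
  let ?L = "\<lambda>r. (cmod (1 - cdot (g a) (g b)))\<^sup>2 * ((1 - (norm a)\<^sup>2 / r\<^sup>2) * (1 - (norm b)\<^sup>2 / r\<^sup>2))"
  let ?R = "\<lambda>r. (cmod (1 - cdot a b / of_real (r\<^sup>2)))\<^sup>2 * ((1 - (norm (g a))\<^sup>2) * (1 - (norm (g b))\<^sup>2))"
  have id: "((\<lambda>r::real. r) \<longlongrightarrow> 1) (at_left 1)" by (rule tendsto_ident_at)
  have "(?L \<longlongrightarrow> ?L 1) (at_left 1)" "(?R \<longlongrightarrow> ?R 1) (at_left 1)"
    by (intro tendsto_intros id; simp)+
  moreover have "\<forall>\<^sub>F r in at_left 1. ?L r \<le> ?R r"
  proof -
    have sq: "((\<lambda>r::real. r\<^sup>2) \<longlongrightarrow> 1\<^sup>2) (at_left 1)" by (intro tendsto_intros id)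
    have "\<forall>\<^sub>F r in at_left 1. norm a < (r::real)\<^sup>2" "\<forall>\<^sub>F r in at_left 1. norm b < (r::real)\<^sup>2"
      using order_tendstoD(1)[OF sq, of "norm a"] order_tendstoD(1)[OF sq, of "norm b"] ab by auto
    moreover have "\<forall>\<^sub>F r in at_left 1. (0::real) < r" using order_tendstoD(1)[OF id, of 0] by simp
    moreover have "\<forall>\<^sub>F r in at_left 1. r < (1::real)" by (auto simp: eventually_at_filter)
    ultimately show ?thesis
    proof eventually_elim
      case (elim r)
      then show ?case using schwarz_pick_dilated[OF \<phi>, of r a b] g by (simp add: g_def)
    qed
  qed
  ultimately have "?L 1 \<le> ?R 1" by (intro tendsto_le[OF trivial_limit_at_left_real])
  then show ?thesis by simp
qed

section \<open>Bounded operators on \<open>H2_ball\<close>: powers, operator norms and finite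
  combinations\<close>

lemma bounded_op_funpow:
  assumes "bounded_op_on H2_ball H2_norm (T :: (('h \<Rightarrow>\<^sub>L 'h) ^ 'n \<Rightarrow> ('h \<Rightarrow>\<^sub>L 'h)) \<Rightarrow> _)"
  shows "bounded_op_on H2_ball H2_norm (T ^^ k)"
proof (induction k)
  case 0
  have "H2_norm ((T ^^ 0) f) \<le> 1 * H2_norm f" for f by simp
  then show ?case unfolding bounded_op_on_def by (auto intro: exI[of _ 1])
next
  case (Suc k)
  obtain M where M: "\<And>f. f \<in> H2_ball \<Longrightarrow> H2_norm (T f) \<le> M * H2_norm f"
    using assms unfolding bounded_op_on_def by blast
  obtain M' where M': "\<And>f. f \<in> H2_ball \<Longrightarrow> H2_norm ((T ^^ k) f) \<le> M' * H2_norm f"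
    using Suc unfolding bounded_op_on_def by blast
  have S: "(T ^^ k) f \<in> H2_ball" if "f \<in> H2_ball" for f using Suc that by (simp add: bounded_op_on_def)
  have "H2_norm ((T ^^ Suc k) f) \<le> (\<bar>M\<bar> * M') * H2_norm f" if f: "f \<in> H2_ball" for f
  proof -
    have "H2_norm ((T ^^ Suc k) f) \<le> M * H2_norm ((T ^^ k) f)" using M[OF S[OF f]] by simp
    also have "\<dots> \<le> \<bar>M\<bar> * H2_norm ((T ^^ k) f)" by (rule mult_right_mono[OF abs_ge_self H2_norm_nonneg])
    also have "\<dots> \<le> \<bar>M\<bar> * (M' * H2_norm f)" by (intro mult_left_mono M' f) simp
    finally show ?thesis by simp
  qed
  then show ?case using assms Suc unfolding bounded_op_on_def by (auto simp: S)
qed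

lemma op_norm_on_bound:
  fixes T :: "(('h \<Rightarrow>\<^sub>L 'h) ^ 'n \<Rightarrow> ('h \<Rightarrow>\<^sub>L 'h)) \<Rightarrow> (('h \<Rightarrow>\<^sub>L 'h) ^ 'n \<Rightarrow> ('h \<Rightarrow>\<^sub>L 'h))"
  assumes T: "bounded_op_on H2_ball H2_norm T" and f: "f \<in> H2_ball"
  shows "H2_norm (T f) \<le> op_norm_on H2_ball H2_norm T * H2_norm f"
proof -
  obtain M where M: "\<And>f. f \<in> H2_ball \<Longrightarrow> H2_norm (T f) \<le> M * H2_norm f"
    using T unfolding bounded_op_on_def by blast
  have Tf: "T f \<in> H2_ball" using T f by (simp add: bounded_op_on_def)
  show ?thesis
  proof (cases "H2_norm f = 0")
    case True
    then show ?thesis using M[OF f] by simp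
  next
    case False
    define n where "n = H2_norm f"
    have n: "0 < n" using False H2_norm_nonneg[of f] unfolding n_def by linarith
    let ?f = "\<lambda>X. complex_of_real (1 / n) *\<^sub>C f X"
    have f1: "?f \<in> H2_ball" "H2_norm ?f = 1"
      using H2_ball_scale(1)[OF f] H2_norm_scale[OF f, of "complex_of_real (1 / n)"] n
      by (auto simp: norm_divide n_def[symmetric])
    \<comment> \<open>The supremum is taken in the reals, so it dominates its members only after the
      set is known to be bounded above.\<close>
    have bdd: "bdd_above ((\<lambda>f. H2_norm (T f)) ` {f \<in> H2_ball. H2_norm f \<le> 1})"
    proof (rule bdd_aboveI2)
      fix h assume h: "h \<in> {f \<in> (H2_ball :: (('h \<Rightarrow>\<^sub>L 'h) ^ 'n \<Rightarrow> _) set). H2_norm f \<le> 1}"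
      then have "H2_norm (T h) \<le> M * H2_norm h" using M by simp
      also have "\<dots> \<le> \<bar>M\<bar> * H2_norm h" by (rule mult_right_mono[OF abs_ge_self H2_norm_nonneg])
      also have "\<dots> \<le> \<bar>M\<bar> * 1" using h by (intro mult_left_mono) auto
      finally show "H2_norm (T h) \<le> \<bar>M\<bar>" by simp
    qed
    have "H2_norm (T ?f) \<le> op_norm_on H2_ball H2_norm T"
      unfolding op_norm_on_def using f1 by (intro cSUP_upper bdd) auto
    moreover have "T ?f = (\<lambda>X. complex_of_real (1 / n) *\<^sub>C T f X)"
      using T f by (simp add: bounded_op_on_def)
    then have "H2_norm (T ?f) = H2_norm (T f) / n"
      using H2_norm_scale[OF Tf, of "complex_of_real (1 / n)"] n by (simp add: norm_divide)
    ultimately have "H2_norm (T f) / n \<le> op_norm_on H2_ball H2_norm T" by (simp only:)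
    then show ?thesis using n by (simp add: n_def[symmetric] pos_divide_le_eq)
  qed
qed

lemma op_norm_on_le:
  fixes T :: "(('h \<Rightarrow>\<^sub>L 'h) ^ 'n \<Rightarrow> ('h \<Rightarrow>\<^sub>L 'h)) \<Rightarrow> (('h \<Rightarrow>\<^sub>L 'h) ^ 'n \<Rightarrow> ('h \<Rightarrow>\<^sub>L 'h))"
  assumes "0 \<le> M" "\<And>f. f \<in> H2_ball \<Longrightarrow> H2_norm (T f) \<le> M * H2_norm f"
  shows "op_norm_on H2_ball H2_norm T \<le> M"
  unfolding op_norm_on_def
proof (rule cSUP_least)
  show "{f \<in> (H2_ball :: (('h \<Rightarrow>\<^sub>L 'h) ^ 'n \<Rightarrow> _) set). H2_norm f \<le> 1} \<noteq> {}"
    using H2_ball_zero by force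
  fix f assume f: "f \<in> {f \<in> (H2_ball :: (('h \<Rightarrow>\<^sub>L 'h) ^ 'n \<Rightarrow> _) set). H2_norm f \<le> 1}"
  then have "H2_norm (T f) \<le> M * H2_norm f" using assms by simp
  also have "\<dots> \<le> M * 1" using f assms(1) by (intro mult_left_mono) auto
  finally show "H2_norm (T f) \<le> M" by simp
qed

lemma H2_ball_sum:
  assumes "\<And>k. k \<in> F \<Longrightarrow> g k \<in> (H2_ball :: (('h \<Rightarrow>\<^sub>L 'h) ^ 'n \<Rightarrow> _) set)" "finite F"
  shows "(\<lambda>X. \<Sum>k\<in>F. c k *\<^sub>C g k X) \<in> H2_ball"
    and "free_coeff (\<lambda>X. \<Sum>k\<in>F. c k *\<^sub>C g k X) = (\<lambda>\<alpha>. \<Sum>k\<in>F. c k * free_coeff (g k) \<alpha>)"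
proof -
  have "(\<lambda>X. \<Sum>k\<in>F. c k *\<^sub>C g k X) \<in> H2_ball
    \<and> free_coeff (\<lambda>X. \<Sum>k\<in>F. c k *\<^sub>C g k X) = (\<lambda>\<alpha>. \<Sum>k\<in>F. c k * free_coeff (g k) \<alpha>)"
    using assms(2,1)
  proof (induction F)
    case empty
    have "free_coeff (\<lambda>X. 0 *\<^sub>C (0 :: 'h \<Rightarrow>\<^sub>L 'h)) = (\<lambda>\<alpha> :: 'n list. 0)"
      using H2_ball_scale(2)[OF H2_ball_zero(1), of 0] by simp
    then show ?case using H2_ball_zero(1) by simp
  next
    case (insert k F)
    then have k: "(\<lambda>X. c k *\<^sub>C g k X) \<in> H2_ball" and F: "(\<lambda>X. \<Sum>k\<in>F. c k *\<^sub>C g k X) \<in> H2_ball"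
      by (auto intro: H2_ball_scale)
    show ?case using insert H2_ball_add[OF k F] H2_ball_scale(2)[of "g k"] by simp
  qed
  then show "(\<lambda>X. \<Sum>k\<in>F. c k *\<^sub>C g k X) \<in> H2_ball"
    "free_coeff (\<lambda>X. \<Sum>k\<in>F. c k *\<^sub>C g k X) = (\<lambda>\<alpha>. \<Sum>k\<in>F. c k * free_coeff (g k) \<alpha>)" by auto
qed

lemma bounded_op_on_add:
  "bounded_op_on S N T \<Longrightarrow> f \<in> S \<Longrightarrow> g \<in> S \<Longrightarrow> T (\<lambda>x. f x + g x) = (\<lambda>x. T f x + T g x)"
  by (simp add: bounded_op_on_def)

lemma bounded_op_sum:
  assumes T: "bounded_op_on H2_ball H2_norm T"
    and "\<And>k. k \<in> F \<Longrightarrow> g k \<in> (H2_ball :: (('h \<Rightarrow>\<^sub>L 'h) ^ 'n \<Rightarrow> _) set)" "finite F"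
  shows "T (\<lambda>X. \<Sum>k\<in>F. c k *\<^sub>C g k X) = (\<lambda>X. \<Sum>k\<in>F. c k *\<^sub>C T (g k) X)"
  using assms(3,2)
proof (induction F)
  case empty
  have "\<forall>c. \<forall>f\<in>H2_ball. T (\<lambda>x. c *\<^sub>C f x) = (\<lambda>x. c *\<^sub>C T f x)"
    using T unfolding bounded_op_on_def by blast
  from this[rule_format, OF H2_ball_zero(1), of 0] show ?case by simp
next
  case (insert k F)
  then have k: "(\<lambda>X. c k *\<^sub>C g k X) \<in> H2_ball" and F: "(\<lambda>X. \<Sum>k\<in>F. c k *\<^sub>C g k X) \<in> H2_ball"
    by (auto intro: H2_ball_scale H2_ball_sum)
  have "T (\<lambda>X. c k *\<^sub>C g k X + (\<Sum>k\<in>F. c k *\<^sub>C g k X))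
      = (\<lambda>X. T (\<lambda>X. c k *\<^sub>C g k X) X + T (\<lambda>X. \<Sum>k\<in>F. c k *\<^sub>C g k X) X)"
    by (rule bounded_op_on_add[OF T k F])
  moreover have "T (\<lambda>X. c k *\<^sub>C g k X) = (\<lambda>X. c k *\<^sub>C T (g k) X)"
    using T insert.prems unfolding bounded_op_on_def by blast
  ultimately show ?case using insert by simp
qed

text \<open>An isometry of \<open>H2_ball\<close> into \<open>'h\<close>. It carries orbits of
  operators on the function space to sequences in a type of class \<open>complex_inner\<close>, to
  which von Neumann's inequality applies.\<close>

definition H2_vec :: "(('h \<Rightarrow>\<^sub>L 'h) ^ 'n \<Rightarrow> ('h \<Rightarrow>\<^sub>L 'h)) \<Rightarrow> 'h" where
  "H2_vec f = osum e (free_coeff f)"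

lemma norm_H2_vec: "f \<in> H2_ball \<Longrightarrow> norm (H2_vec f) = H2_norm f"
  using norm_osum[OF orthonormal_e H2_ball_l2_le, of f] unfolding H2_vec_def H2_norm_def
  by (metis norm_ge_zero real_sqrt_unique)

lemma H2_vec_sum:
  assumes "\<And>k. k \<in> F \<Longrightarrow> g k \<in> H2_ball" "finite F"
  shows "H2_vec (\<lambda>X. \<Sum>k\<in>F. c k *\<^sub>C g k X) = (\<Sum>k\<in>F. c k *\<^sub>C H2_vec (g k))"
proof -
  have eq: "free_coeff (\<lambda>X. \<Sum>k\<in>F. c k *\<^sub>C g k X) = (\<lambda>\<alpha>. \<Sum>k\<in>F. c k * free_coeff (g k) \<alpha>)"
    by (rule H2_ball_sum(2)[OF assms])
  have "((\<lambda>\<alpha>. \<Sum>k\<in>F. (c k * free_coeff (g k) \<alpha>) *\<^sub>C e \<alpha>) has_sum (\<Sum>k\<in>F. c k *\<^sub>C osum e (free_coeff (g k)))) UNIV"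
    using assms(2,1)
  proof (induction F)
    case (insert k F)
    have "((\<lambda>\<alpha>. (c k * free_coeff (g k) \<alpha>) *\<^sub>C e \<alpha>) has_sum c k *\<^sub>C osum e (free_coeff (g k))) UNIV"
      unfolding scaleC_scaleC[symmetric] using insert.prems
      by (intro has_sum_bounded_linear[OF bounded_linear_scaleC_right
            osum_has_sum[OF orthonormal_e H2_ball_l2_le]]) simp
    then show ?case using insert by (simp add: has_sum_add)
  qed simp
  then show ?thesis
    unfolding H2_vec_def eq osum_def by (simp add: scaleC_sum_left infsumI)
qed

text \<open>\<open>poly_op p T\<close> is \<open>p(A)\<close> conjugated by \<open>V\<close> and
  \<open>W\<close>, and at a fixed \<open>f\<close> only the orbit of \<open>V f\<close> under
  \<open>A\<close> matters. Hence von Neumann's inequality is needed for a single orbit.\<close>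

lemma similar_imp_polynomially_bounded:
  fixes T :: "(('h \<Rightarrow>\<^sub>L 'h) ^ 'n \<Rightarrow> ('h \<Rightarrow>\<^sub>L 'h)) \<Rightarrow> (('h \<Rightarrow>\<^sub>L 'h) ^ 'n \<Rightarrow> ('h \<Rightarrow>\<^sub>L 'h))"
  assumes "similar_to_contraction_on H2_ball H2_norm T"
  shows "polynomially_bounded_on H2_ball H2_norm T"
proof -
  obtain V W A where T: "bounded_op_on H2_ball H2_norm T"
    and V: "bounded_op_on H2_ball H2_norm V" and W: "bounded_op_on H2_ball H2_norm W"
    and WV: "\<And>f. f \<in> H2_ball \<Longrightarrow> W (V f) = f" and VW: "\<And>f. f \<in> H2_ball \<Longrightarrow> V (W f) = f"
    and A: "bounded_op_on H2_ball H2_norm A" "op_norm_on H2_ball H2_norm A \<le> 1"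
    and TA: "\<And>f. f \<in> H2_ball \<Longrightarrow> T f = W (A (V f))"
    using assms unfolding similar_to_contraction_on_def by blast
  obtain MV where MV: "\<And>f. f \<in> H2_ball \<Longrightarrow> H2_norm (V f) \<le> MV * H2_norm f"
    using V unfolding bounded_op_on_def by blast
  obtain MW where MW: "\<And>f. f \<in> H2_ball \<Longrightarrow> H2_norm (W f) \<le> MW * H2_norm f"
    using W unfolding bounded_op_on_def by blast
  have A1: "H2_norm (A f) \<le> H2_norm f" if "f \<in> H2_ball" for f
    using op_norm_on_bound[OF A(1) that] mult_right_mono[OF A(2) H2_norm_nonneg, of f] by simp
  have VH: "V f \<in> H2_ball" if "f \<in> H2_ball" for f using V that by (simp add: bounded_op_on_def)
  have AH: "(A ^^ k) f \<in> H2_ball" if "f \<in> H2_ball" for f k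
    using bounded_op_funpow[OF A(1)] that by (simp add: bounded_op_on_def)
  have Tk: "(T ^^ k) f = W ((A ^^ k) (V f))" if f: "f \<in> H2_ball" for f k
  proof (induction k)
    case (Suc k)
    have WA: "W ((A ^^ k) (V f)) \<in> H2_ball" using W AH[OF VH[OF f]] by (simp add: bounded_op_on_def)
    then show ?case using Suc TA[OF WA] VW[OF AH[OF VH[OF f]]] by simp
  qed (simp add: WV f)
  \<comment> \<open>The summand 1 secures \<open>M > 0\<close> even if a bound for \<open>V\<close>
    or \<open>W\<close> is 0.\<close>
  define M where "M = \<bar>MW\<bar> * \<bar>MV\<bar> + 1"
  have "op_norm_on H2_ball H2_norm (poly_op p T) \<le> M * (SUP z\<in>{z. cmod z \<le> 1}. cmod (poly p z))" for p
  proof -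
    define S where "S = (SUP z\<in>{z. cmod z \<le> 1}. cmod (poly p z))"
    have "compact ((\<lambda>z. cmod (poly p z)) ` cball 0 1)"
      by (intro compact_continuous_image continuous_intros) simp
    then have bdd: "bdd_above ((\<lambda>z. cmod (poly p z)) ` {z. cmod z \<le> 1})"
      by (simp add: bounded_imp_bdd_above compact_imp_bounded cball_def dist_norm)
    have S: "cmod (poly p z) \<le> S" if "cmod z \<le> 1" for z
      unfolding S_def using that by (intro cSUP_upper bdd) simp
    have S0: "0 \<le> S" by (rule order_trans[OF norm_ge_zero S[of 0]]) simp
    have "H2_norm (poly_op p T f) \<le> (\<bar>MW\<bar> * (S * \<bar>MV\<bar>)) * H2_norm f" if f: "f \<in> H2_ball" for f
    proof -
      define g where "g k = (A ^^ k) (V f)" for k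
      have g: "g k \<in> H2_ball" for k unfolding g_def by (rule AH[OF VH[OF f]])
      have gsum: "(\<lambda>X. \<Sum>k\<in>F. c k *\<^sub>C g k X) \<in> H2_ball" if "finite F" for F :: "nat set" and c
        by (rule H2_ball_sum(1)[OF g that])
      have "norm (\<Sum>k\<le>degree p. coeff p k *\<^sub>C H2_vec (g k)) \<le> S * norm (H2_vec (g 0))"
      proof (rule von_neumann_inequality)
        fix m and c :: "nat \<Rightarrow> complex"
        have "(\<Sum>k<m. c k *\<^sub>C H2_vec (g (Suc k))) = H2_vec (A (\<lambda>X. \<Sum>k<m. c k *\<^sub>C g k X))"
          by (simp add: bounded_op_sum[OF A(1) g] H2_vec_sum[OF g, symmetric])
            (simp add: g_def)
        moreover have "norm (H2_vec (A (\<lambda>X. \<Sum>k<m. c k *\<^sub>C g k X))) \<le> norm (H2_vec (\<lambda>X. \<Sum>k<m. c k *\<^sub>C g k X))"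
          using gsum[of "{..<m}" c] A(1) A1 by (simp add: norm_H2_vec bounded_op_on_def)
        ultimately show "norm (\<Sum>k<m. c k *\<^sub>C H2_vec (g (Suc k))) \<le> norm (\<Sum>k<m. c k *\<^sub>C H2_vec (g k))"
          by (simp add: H2_vec_sum[OF g])
      qed (use S in \<open>simp add: poly_altdef\<close>)
      then have vN: "H2_norm (\<lambda>X. \<Sum>k\<le>degree p. coeff p k *\<^sub>C g k X) \<le> S * H2_norm (V f)"
        using gsum[of "{..degree p}" "coeff p"] norm_H2_vec[OF g, of 0]
        by (simp add: H2_vec_sum[OF g, symmetric] norm_H2_vec) (simp add: g_def)
      have "poly_op p T f = W (\<lambda>X. \<Sum>k\<le>degree p. coeff p k *\<^sub>C g k X)"
        by (simp only: bounded_op_sum[OF W g finite_atMost] poly_op_def Tk[OF f] g_def[symmetric])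
      then have "H2_norm (poly_op p T f) \<le> MW * H2_norm (\<lambda>X. \<Sum>k\<le>degree p. coeff p k *\<^sub>C g k X)"
        using MW gsum by simp
      also have "\<dots> \<le> \<bar>MW\<bar> * H2_norm (\<lambda>X. \<Sum>k\<le>degree p. coeff p k *\<^sub>C g k X)"
        by (rule mult_right_mono[OF abs_ge_self H2_norm_nonneg])
      also have "\<dots> \<le> \<bar>MW\<bar> * (S * (\<bar>MV\<bar> * H2_norm f))"
      proof (intro mult_left_mono order_trans[OF vN])
        show "H2_norm (V f) \<le> \<bar>MV\<bar> * H2_norm f"
          using MV[OF f] mult_right_mono[OF abs_ge_self H2_norm_nonneg, of MV f] by linarith
      qed (use S0 in auto)
      finally show ?thesis by (simp add: mult_ac)
    qed
    then have "op_norm_on H2_ball H2_norm (poly_op p T) \<le> \<bar>MW\<bar> * (S * \<bar>MV\<bar>)"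
      using S0 by (intro op_norm_on_le) auto
    also have "\<dots> \<le> M * S" using S0 by (simp add: M_def algebra_simps)
    finally show ?thesis by (simp add: S_def)
  qed
  moreover have "M > 0" by (simp add: M_def add_nonneg_pos)
  ultimately show ?thesis using T unfolding polynomially_bounded_on_def by blast
qed

lemma polynomially_bounded_imp_power_bounded:
  fixes T :: "(('h \<Rightarrow>\<^sub>L 'h) ^ 'n \<Rightarrow> ('h \<Rightarrow>\<^sub>L 'h)) \<Rightarrow> (('h \<Rightarrow>\<^sub>L 'h) ^ 'n \<Rightarrow> ('h \<Rightarrow>\<^sub>L 'h))"
  assumes "polynomially_bounded_on H2_ball H2_norm T"
  shows "power_bounded_on H2_ball H2_norm T"
proof -
  obtain M where T: "bounded_op_on H2_ball H2_norm T" and "M > 0"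
    and M: "\<And>p. op_norm_on H2_ball H2_norm (poly_op p T) \<le> M * (SUP z\<in>{z. cmod z \<le> 1}. cmod (poly p z))"
    using assms unfolding polynomially_bounded_on_def by blast
  have "op_norm_on H2_ball H2_norm (T ^^ k) \<le> M" for k
  proof -
    let ?p = "monom (1::complex) k"
    have "poly_op ?p T f = (T ^^ k) f" for f
    proof
      fix X
      have "poly_op ?p T f X = (\<Sum>j\<le>k. if j = k then (T ^^ j) f X else 0)"
        unfolding poly_op_def by (intro sum.cong) (auto simp: degree_monom_eq scaleC_one)
      then show "poly_op ?p T f X = (T ^^ k) f X" by simp
    qed
    then have eq: "poly_op ?p T = T ^^ k" by (rule ext)
    have "(SUP z\<in>{z. cmod z \<le> 1}. cmod (poly ?p z)) \<le> 1"
      by (rule cSUP_least) (auto simp: poly_monom norm_power power_le_one intro: exI[of _ 0])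
    then have "M * (SUP z\<in>{z. cmod z \<le> 1}. cmod (poly ?p z)) \<le> M * 1"
      using \<open>M > 0\<close> by (intro mult_left_mono) auto
    then show ?thesis using M[of ?p] unfolding eq by simp
  qed
  then show ?thesis unfolding power_bounded_on_def using T by (auto simp: bdd_above_def)
qed

lemma sev_zero: "sev c 0 = c []"
proof -
  have "(\<Sum>\<alpha>\<in>words k. c \<alpha> * wsc 0 \<alpha>) = (if k = 0 then c [] else 0)" for k
  proof (cases k)
    case (Suc j)
    then show ?thesis by (simp add: sum_words_Suc)
  qed simp
  then show ?thesis unfolding sev_def using sums_single[of 0 "\<lambda>_. c []"] by (simp add: sums_iff)
qed

lemma power_bounded_imp_fixpoint:
  fixes \<phi> :: "('h \<Rightarrow>\<^sub>L 'h) ^ 'n \<Rightarrow> ('h \<Rightarrow>\<^sub>L 'h) ^ 'n"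
  assumes \<phi>: "self_map_coeffs \<phi> c" and pb: "power_bounded_on H2_ball H2_norm (comp_op \<phi>)"
  shows "\<exists>\<xi>. norm \<xi> < 1 \<and> \<phi> (scalar_tuple \<xi>) = scalar_tuple \<xi>"
proof -
  define g where "g = (\<lambda>\<mu>. \<chi> i. sev (c i) \<mu>)"
  have \<phi>g: "\<phi> (scalar_tuple \<mu>) = scalar_tuple (g \<mu>)" if "norm \<mu> < 1" for \<mu>
    unfolding g_def by (rule sev_self_map[OF \<phi> that])
  have ball: "norm (g \<mu>) < 1" if "norm \<mu> < 1" for \<mu>
    using self_map_coeffs_nc_ball[OF \<phi> scalar_tuple_nc_ball[OF that]]
    unfolding \<phi>g[OF that] by (rule scalar_tuple_nc_ballD)
  define z where "z k = (g ^^ k) 0" for k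
  have z1: "norm (z k) < 1" for k by (induction k) (auto simp: z_def ball)
  have orbit: "(\<phi> ^^ k) (scalar_tuple 0) = scalar_tuple (z k)" for k
    by (induction k) (auto simp: z_def \<phi>g z1[unfolded z_def])
  have T: "bounded_op_on H2_ball H2_norm (comp_op \<phi>)" using pb by (simp add: power_bounded_on_def)
  obtain M where M: "\<And>k. op_norm_on H2_ball H2_norm (comp_op \<phi> ^^ k) \<le> M"
    using pb unfolding power_bounded_on_def bdd_above_def by blast
  have iter: "(comp_op \<phi> ^^ k) f X = f ((\<phi> ^^ k) X)" if "f \<in> H2_ball" "X \<in> nc_ball" for f X k
    using that(2)
  proof (induction k arbitrary: X)
    case (Suc k)
    have "(comp_op \<phi> ^^ k) f \<in> H2_ball"
      using bounded_op_funpow[OF T, of k] that(1) by (simp add: bounded_op_on_def)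
    then have "(comp_op \<phi> ^^ Suc k) f X = (comp_op \<phi> ^^ k) f (\<phi> X)"
      using Suc.prems by (simp add: comp_op_apply[OF \<phi>])
    also have "\<dots> = f ((\<phi> ^^ Suc k) X)"
      using Suc.IH[OF self_map_coeffs_nc_ball[OF \<phi> Suc.prems]] by (simp add: funpow_swap1)
    finally show ?case .
  qed simp
  \<comment> \<open>With \<open>s = 1 - (norm (z k))\<^sup>2\<close> the kernel \<open>f\<close> at
    \<open>z k\<close> has norm at most \<open>s\<close> to the power -1/2 and value 1/s at
    \<open>z k\<close>. That value is also the value at 0 of the \<open>k\<close>-th iterate applied
    to \<open>f\<close>, hence its constant coefficient, which is at most its norm. So 1/s is at
    most \<open>M * H2_norm f\<close>; squaring gives the claim.\<close>
  have K: "1 \<le> M\<^sup>2 * (1 - (norm (z k))\<^sup>2)" for k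
  proof -
    define s where "s = 1 - (norm (z k))\<^sup>2"
    have s: "0 < s" using z1[of k] by (simp add: s_def power_less_one_iff)
    define a where "a = wsc (vcnj (z k))"
    have a: "hol_coeffs a" unfolding a_def by (rule hol_coeffs_wsc) (simp add: z1)
    have "l2_le a (1 / s)" using l2_le_wsc[of "vcnj (z k)"] z1[of k] by (simp add: a_def s_def)
    define f where "f = (ball_fun a :: ('h \<Rightarrow>\<^sub>L 'h) ^ 'n \<Rightarrow> _)"
    have f: "f \<in> H2_ball" "H2_norm f \<le> sqrt (1 / s)"
      unfolding f_def by (rule ball_fun_H2[OF \<open>l2_le a (1 / s)\<close>])+
    have Xk: "(scalar_tuple (z k) :: ('h \<Rightarrow>\<^sub>L 'h) ^ 'n) \<in> nc_ball" by (rule scalar_tuple_nc_ball[OF z1])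
    have X0: "(scalar_tuple 0 :: ('h \<Rightarrow>\<^sub>L 'h) ^ 'n) \<in> nc_ball" by (rule scalar_tuple_nc_ball) simp
    define v where "v = sev a (z k)"
    have fv: "f (scalar_tuple (z k)) = v *\<^sub>C id_blinfun"
      using Xk by (simp add: f_def ball_fun_def v_def ev_scalar_tuple[OF a z1])
    \<comment> \<open>The value of the kernel at its own point comes from the resolvent equation at
      a scalar tuple, where \<open>lin\<close> acts as the scalar
      \<open>(norm (z k))\<^sup>2\<close>.\<close>
    have "v * of_real s = 1"
    proof -
      have "lin (vcnj (z k)) (scalar_tuple (z k)) h = of_real ((norm (z k))\<^sup>2) *\<^sub>C h" for h :: 'h
        by (simp add: lin_apply scaleC_scaleC scaleC_sum_left[symmetric] norm_vec_sq complex_norm_square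
            mult.commute del: of_real_power)
      moreover have "norm (vcnj (z k)) < 1" using z1[of k] by simp
      ultimately have "v *\<^sub>C e [] = e [] + of_real ((norm (z k))\<^sup>2) *\<^sub>C (v *\<^sub>C e [])"
        using resolvent_left[OF _ Xk, of "vcnj (z k)" "e []"]
        by (simp only: a_def[symmetric] ev_scalar_tuple[OF a z1] v_def[symmetric] scaleC_blinfun.rep_eq
            blinfun_apply_id_blinfun simp_thms)
      from arg_cong[OF this, of "\<lambda>x. cinner x (e [])"] show ?thesis
        by (simp add: cinner_simps cinner_e s_def algebra_simps)
    qed
    then have v: "v = of_real (1 / s)" using s by (simp add: field_simps)
    define F where "F = (comp_op \<phi> ^^ k) f"
    have F: "F \<in> H2_ball" using bounded_op_funpow[OF T, of k] f(1) by (simp add: bounded_op_on_def F_def)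
    have "F (scalar_tuple 0) = free_coeff F [] *\<^sub>C id_blinfun"
      using H2_ball_eq[OF F] X0 ev_scalar_tuple[OF H2_ball_hol_coeffs[OF F], of 0]
      by (metis ball_fun_def norm_zero sev_zero zero_less_one)
    moreover have "F (scalar_tuple 0) = v *\<^sub>C id_blinfun"
      unfolding F_def iter[OF f(1) X0] orbit by (rule fv)
    ultimately have "blinfun_apply (free_coeff F [] *\<^sub>C id_blinfun) (e []) = blinfun_apply (v *\<^sub>C id_blinfun) (e [])"
      by (simp only:)
    then have "cinner (free_coeff F [] *\<^sub>C e []) (e []) = cinner (v *\<^sub>C e []) (e [])"
      by (simp only: scaleC_blinfun.rep_eq blinfun_apply_id_blinfun)
    then have "free_coeff F [] = v" by (simp add: cinner_scaleC_left cinner_e)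
    then have "(1 / s)\<^sup>2 \<le> (H2_norm F)\<^sup>2"
      using l2_leD[OF H2_ball_l2_le[OF F], of "{[]}"] v s by (simp add: norm_divide)
    then have "1 / s \<le> H2_norm F" by (rule power2_le_imp_le) simp
    also have "H2_norm F \<le> M * H2_norm f"
      unfolding F_def using op_norm_on_bound[OF bounded_op_funpow[OF T] f(1), of k]
        mult_right_mono[OF M H2_norm_nonneg, of k f] by linarith
    finally have *: "1 / s \<le> M * H2_norm f" .
    have "(1 / s)\<^sup>2 \<le> (M * H2_norm f)\<^sup>2" using * s by (intro power_mono) auto
    also have "\<dots> \<le> M\<^sup>2 * (sqrt (1 / s))\<^sup>2"
      unfolding power_mult_distrib by (intro mult_left_mono power_mono f(2)) auto
    also have "\<dots> = M\<^sup>2 * (1 / s)" using s by simp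
    finally have "(1 / s)\<^sup>2 * s\<^sup>2 \<le> (M\<^sup>2 * (1 / s)) * s\<^sup>2" by (intro mult_right_mono) auto
    then show ?thesis unfolding s_def[symmetric] using s by (simp add: power2_eq_square)
  qed
  have cont: "continuous_on (cball 0 r) g" if "r < 1" for r
    unfolding g_def using \<phi> that
    by (intro continuous_intros continuous_on_sev) (auto simp: self_map_coeffs_def)
  have pick: "(cmod (1 - cdot (g x) (g y)))\<^sup>2 * ((1 - (norm x)\<^sup>2) * (1 - (norm y)\<^sup>2))
      \<le> (cmod (1 - cdot x y))\<^sup>2 * ((1 - (norm (g x))\<^sup>2) * (1 - (norm (g y))\<^sup>2))"
    if "norm x < 1" "norm y < 1" for x y
    using schwarz_pick[OF \<phi> that] ball[OF that(1)] ball[OF that(2)] unfolding g_def by blast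
  obtain \<xi> where "norm \<xi> < 1" "g \<xi> = \<xi>"
    using bounded_orbit_fixpoint[OF ball cont pick K[unfolded z_def]] by blast
  then show ?thesis using \<phi>g by metis
qed

end

theorem theorem2p6:
  fixes \<phi> :: "('h::chilbert_space \<Rightarrow>\<^sub>L 'h) ^ 'n::finite \<Rightarrow> ('h \<Rightarrow>\<^sub>L 'h) ^ 'n"
  assumes separable: "separable_space (euclidean :: 'h topology)"
    and infinite_dimensional: "\<not> (\<exists>B :: 'h set. finite B \<and> cspan B = UNIV)"
    and self_map: "free_holomorphic_self_map \<phi>"
  shows
    "(similar_to_contraction_on H2_ball H2_norm (comp_op \<phi>)
        \<longleftrightarrow> polynomially_bounded_on H2_ball H2_norm (comp_op \<phi>)) \<and>
     (polynomially_bounded_on H2_ball H2_norm (comp_op \<phi>)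
        \<longleftrightarrow> power_bounded_on H2_ball H2_norm (comp_op \<phi>)) \<and>
     (power_bounded_on H2_ball H2_norm (comp_op \<phi>)
        \<longleftrightarrow> (\<exists>\<xi> :: complex ^ 'n. \<xi> \<in> ball 0 1 \<and> \<phi> (scalar_tuple \<xi>) = scalar_tuple \<xi>))"
proof -
  obtain e :: "'n list \<Rightarrow> 'h" where "orthonormal e"
    using orthonormal_family_exists[OF infinite_dimensional] by blast
  then interpret fock e by unfold_locales
  obtain c where \<phi>: "self_map_coeffs \<phi> c" using self_map self_map_iff by blast
  let ?T = "comp_op \<phi>"
  have "similar_to_contraction_on H2_ball H2_norm ?T \<Longrightarrow> polynomially_bounded_on H2_ball H2_norm ?T"
    by (rule similar_imp_polynomially_bounded)
  moreover have "polynomially_bounded_on H2_ball H2_norm ?T \<Longrightarrow> power_bounded_on H2_ball H2_norm ?T"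
    by (rule polynomially_bounded_imp_power_bounded)
  moreover have "power_bounded_on H2_ball H2_norm ?T
      \<Longrightarrow> \<exists>\<xi>. norm \<xi> < 1 \<and> \<phi> (scalar_tuple \<xi>) = scalar_tuple \<xi>"
    by (rule power_bounded_imp_fixpoint[OF \<phi>])
  moreover have "\<exists>\<xi>. norm \<xi> < 1 \<and> \<phi> (scalar_tuple \<xi>) = scalar_tuple \<xi>
      \<Longrightarrow> similar_to_contraction_on H2_ball H2_norm ?T"
    using fixpoint_imp_similar[OF \<phi>] by blast
  ultimately show ?thesis unfolding mem_ball_0 by blast
qed

end
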